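(* Let $G\le\mathrm{Aut}(T)$ be a finitely generated weakly branch group. Then $G$ does not admit a faithful action on $\mathbb{R}/\mathbb{Z}$ by interval exchange transformations (i.e. $G$ is not isomorphic to a subgroup of $\mathrm{IET}$).
   Context: $T$ is a locally finite rooted tree and $\mathrm{Aut}(T)$ its root-fixing automorphism group. $G$ is weakly branch if $T$ is infinite and spherically homogeneous, $G$ is transitive on each level, and for every vertex $v$ the subgroup of elements acting trivially outside the subtree below $v$ is non-trivial. An interval exchange transformation is a left-continuous bijection of $\mathbb{R}/\mathbb{Z}$ with finitely many discontinuity points which coincides with a translation on each interval of continuity; these form a group $\mathrm{IET}$. *)

theory Defs
  imports Complex_Main
begin

text \<open>A rooted tree is represented as a set T of finite words, closed under
  taking prefixes; the root is the empty word and the children of v are the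
  words v @ [a] in T.  Every rooted tree is isomorphic to one of this form.\<close>

definition rooted_tree :: "'a list set \<Rightarrow> bool" where
  "rooted_tree T \<longleftrightarrow> [] \<in> T \<and> (\<forall>v a. v @ [a] \<in> T \<longrightarrow> v \<in> T)"

definition children :: "'a list set \<Rightarrow> 'a list \<Rightarrow> 'a list set" where
  "children T v = {w \<in> T. \<exists>a. w = v @ [a]}"

definition locally_finite_tree :: "'a list set \<Rightarrow> bool" where
  "locally_finite_tree T \<longleftrightarrow> rooted_tree T \<and> (\<forall>v\<in>T. finite (children T v))"

definition spherically_homogeneous :: "'a list set \<Rightarrow> bool" where
  "spherically_homogeneous T \<longleftrightarrow>
     (\<forall>v\<in>T. \<forall>w\<in>T. length v = length w \<longrightarrow> card (children T v) = card (children T w))"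

definition tree_aut :: "'a list set \<Rightarrow> ('a list \<Rightarrow> 'a list) \<Rightarrow> bool" where
  "tree_aut T g \<longleftrightarrow> bij_betw g T T \<and> (\<forall>x. x \<notin> T \<longrightarrow> g x = x) \<and> g [] = [] \<and>
     (\<forall>v\<in>T. \<forall>w\<in>T. (\<exists>a. w = v @ [a]) \<longleftrightarrow> (\<exists>b. g w = g v @ [b]))"

definition is_subgroup_aut :: "'a list set \<Rightarrow> ('a list \<Rightarrow> 'a list) set \<Rightarrow> bool" where
  "is_subgroup_aut T G \<longleftrightarrow> (\<forall>g\<in>G. tree_aut T g) \<and> id \<in> G \<and>
     (\<forall>g\<in>G. \<forall>h\<in>G. g \<circ> h \<in> G) \<and> (\<forall>g\<in>G. inv g \<in> G)"

inductive_set gen_group :: "('b \<Rightarrow> 'b) set \<Rightarrow> ('b \<Rightarrow> 'b) set" for S where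
  gen_id: "id \<in> gen_group S"
| gen_base: "s \<in> S \<Longrightarrow> s \<in> gen_group S"
| gen_comp: "g \<in> gen_group S \<Longrightarrow> h \<in> gen_group S \<Longrightarrow> g \<circ> h \<in> gen_group S"
| gen_inv: "g \<in> gen_group S \<Longrightarrow> inv g \<in> gen_group S"

definition finitely_generated :: "('b \<Rightarrow> 'b) set \<Rightarrow> bool" where
  "finitely_generated G \<longleftrightarrow> (\<exists>S. finite S \<and> S \<subseteq> G \<and> gen_group S = G)"

definition weakly_branch :: "'a list set \<Rightarrow> ('a list \<Rightarrow> 'a list) set \<Rightarrow> bool" where
  "weakly_branch T G \<longleftrightarrow>
     infinite T \<and> spherically_homogeneous T \<and>
     (\<forall>v\<in>T. \<forall>w\<in>T. length v = length w \<longrightarrow> (\<exists>g\<in>G. g v = w)) \<and>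
     (\<forall>v\<in>T. \<exists>g\<in>G. g \<noteq> id \<and> (\<forall>w\<in>T. \<not> (\<exists>u. w = v @ u) \<longrightarrow> g w = w))"

text \<open>A map of R/Z is represented by a 1-periodic function f :: real \<Rightarrow> real
  with values in [0,1) (the value f x is the representative in [0,1) of the image
  of the class of x).  It is an IET iff it induces a bijection of the circle, and
  there is a finite set D \<subseteq> [0,1) (the discontinuity points) such that near every
  point f is a translation mod 1 on a left half-neighbourhood (x-e, x]
  (left-continuity) and on a full neighbourhood if x is not in D.\<close>

definition is_IET :: "(real \<Rightarrow> real) \<Rightarrow> bool" where
  "is_IET f \<longleftrightarrow>
     (\<forall>x. f (x + 1) = f x) \<and> (\<forall>x. 0 \<le> f x \<and> f x < 1) \<and>
     bij_betw f {0..<1} {0..<1} \<and>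
     (\<exists>D. finite D \<and> D \<subseteq> {0..<1} \<and>
        (\<forall>x. \<exists>e>0. \<exists>c. (\<forall>y. x - e < y \<and> y \<le> x \<longrightarrow> f y = frac (y + c)) \<and>
                       (frac x \<notin> D \<longrightarrow> (\<forall>y. x < y \<and> y < x + e \<longrightarrow> f y = frac (y + c)))))"

definition embeds_in_IET :: "('b \<Rightarrow> 'b) set \<Rightarrow> bool" where
  "embeds_in_IET G \<longleftrightarrow>
     (\<exists>\<phi> :: ('b \<Rightarrow> 'b) \<Rightarrow> (real \<Rightarrow> real).
        inj_on \<phi> G \<and> (\<forall>g\<in>G. is_IET (\<phi> g)) \<and>
        (\<forall>g\<in>G. \<forall>h\<in>G. \<phi> (g \<circ> h) = \<phi> g \<circ> \<phi> h))"

end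

theory Submission
  imports Defs "HOL-Analysis.Analysis" "HOL-Library.Sublist"
begin

text \<open>
  After flipping the circle, every \<open>g \<in> G\<close> is a piecewise translation of
  \<open>[0,1)\<close> whose cut points and displacements lie in a finitely generated group \<open>M
  \<subset> \<real>\<close>. Consider \<open>G\<close> acting on pairs (finite union of intervals,
  vertex of \<open>T\<close>), and a maximal proper invariant ideal of such pairs containing those
  on which all commutators of commutators \<open>rist''\<close> of rigid stabilizers act trivially.
  As the cut points of finitely many generators are the only obstruction to having finite orbits, at
  each vertex \<open>v\<close> the ideal is generated by a single finite union of intervals with
  ends in \<open>M\<close>; let \<open>res v\<close> be its complement. By maximality every point of
  \<open>res []\<close> lies in the same number of sets \<open>res v\<close> with \<open>v\<close>
  of a given level, so the length of \<open>res v\<close> is a rational multiple of the length of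
  \<open>res []\<close>. It lies in \<open>M\<close>, which bounds the denominators, hence
  \<open>res\<close> becomes constant below some vertex \<open>v\<close>.

  If a non-trivial element of the rigid stabilizer of \<open>v\<close> fixes a point of \<open>res
  v\<close>, then by minimality finitely many such elements have fixed points covering \<open>res
  v\<close>; a point stabilizer is therefore confined and must contain \<open>rist'' w\<close> for
  some \<open>w\<close> below \<open>v\<close>, which is impossible. So the rigid stabilizer of
  \<open>v\<close> acts freely on \<open>res v\<close>. Fundamental domains of its finite subgroups
  have lengths in \<open>M\<close>, so these subgroups have bounded order, and the rigid stabilizers
  below \<open>v\<close> contain finitely generated infinite subgroups. Taking more of them, at
  incomparable vertices, than the rank of \<open>M\<close> contradicts the polynomial growth of
  orbits.
\<close>

section \<open>Groups acting on rooted trees\<close>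

text \<open>The ideals live on the product of the circle with the ends of \<open>T\<close>, because
  freeness is wanted for a rigid stabilizer on a set attached to its vertex, and a minimal set in
  the circle alone does not record vertices. There a maximal ideal is the complement of a minimal
  closed invariant set. All sets are finite unions of intervals \<open>[a, b)\<close>, so that
  Boolean operations are exact and every non-empty set has positive length. Two layers of
  commutators are needed. One commutator suffices to enter the kernel of an action on a finite set.
  In a confined subgroup one commutator can be isolated only up to a factor supported elsewhere in
  the tree; the commutator of two such elements with disjoint factors removes both. As
  \<open>nul\<close> is defined by the same \<open>rist''\<close>, a point stabilizer containing
  some \<open>rist'' w\<close> clashes with the fact that each point of the residual set is moved by
  some element of \<open>rist'' w\<close>. The group \<open>M\<close> serves three times: it bounds
  the denominators of the lengths of residual sets, bounds those of fundamental domains, and its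
  boxes count displacements along words.\<close>

definition comm :: "'g::group_add \<Rightarrow> 'g \<Rightarrow> 'g" where
  "comm a b = a + b - a - b"

lemma comm_eq_0_iff: "comm a b = 0 \<longleftrightarrow> a + b = b + (a::'g::group_add)"
  unfolding comm_def by (metis add_diff_cancel diff_add_cancel diff_diff_eq2 eq_iff_diff_eq_0)

lemmas group_norm = diff_conv_add_uminus add.assoc minus_add

lemma conj_comm: "x + comm a b - x = comm (x + a - x) (x + b - (x::'g::group_add))"
  unfolding comm_def by (simp add: group_norm del: add_uminus_conv_diff)

text \<open>\<open>j\<close> and \<open>j'\<close> commute with each other and with
  \<open>c\<close>, \<open>c'\<close>, so they are central in the subgroup generated by all four and
  cancel from the commutator.\<close>

lemma comm_add_commuting:
  fixes c j c' j' :: "'g::group_add"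
  assumes "j + c = c + j" "j + c' = c' + j" "j' + c = c + j'" "j + j' = j' + j" "j' + c' = c' + j'"
  shows "comm (c + j) (c' + j') = comm c c'"
proof -
  have *: "x + y = y + x \<Longrightarrow> x + - y = - y + x" for x y :: 'g
    by (metis add.assoc add.right_neutral add.right_inverse add_minus_cancel minus_add_cancel)
  have n: "- j' + - c' = - c' + - j'" "- c + - j' = - j' + - c" "- j + - j' = - j' + - j"
     "- j + - c' = - c' + - j" "- c + - j = - j + - c"
    using assms by (metis minus_add)+
  have "comm (c + j) (c' + j') = c + (j + c') + j' - j - c - j' - c'"
    unfolding comm_def by (simp add: group_norm del: add_uminus_conv_diff)
  also have "\<dots> = c + c' + (j + j') - j - c - j' - c'"
    by (simp add: assms add.assoc)
  also have "\<dots> = c + c' + j' - c - j' - c'"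
    by (simp add: assms(4) diff_conv_add_uminus add.assoc minus_add del: add_uminus_conv_diff)
  also have "\<dots> = c + c' + j' + (- c + - j') - c'"
    by (simp add: group_norm del: add_uminus_conv_diff)
  also have "\<dots> = comm c c'"
    unfolding n(2) comm_def by (simp add: group_norm del: add_uminus_conv_diff)
  finally show ?thesis .
qed

lemma infinite_fibre:
  assumes "finite A" "\<And>l::nat. f l \<in> A"
  shows "\<exists>c. infinite {l. f l = c}"
proof -
  have "finite (range f)" using assms by (meson finite_subset image_subsetI)
  then obtain a where "infinite {l \<in> UNIV. f l = f a}"
    using pigeonhole_infinite[of UNIV f] by auto
  then show ?thesis by auto
qed

text \<open>The group is abstract and acts through \<open>\<tau>\<close>, because its elements are
  to act on the circle as well. Preservation of prefixes and lengths replaces the edge condition of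
  an automorphism.\<close>

locale tree_group =
  fixes T :: "'a list set" and G :: "'g::group_add set" and \<tau> :: "'g \<Rightarrow> 'a list \<Rightarrow> 'a list"
  assumes zero_G: "0 \<in> G" and add_G: "g \<in> G \<Longrightarrow> h \<in> G \<Longrightarrow> g + h \<in> G"
    and neg_G: "g \<in> G \<Longrightarrow> - g \<in> G"
    and act_add: "g \<in> G \<Longrightarrow> h \<in> G \<Longrightarrow> v \<in> T \<Longrightarrow> \<tau> (g + h) v = \<tau> g (\<tau> h v)"
    and act_0: "v \<in> T \<Longrightarrow> \<tau> 0 v = v"
    and act_T: "g \<in> G \<Longrightarrow> v \<in> T \<Longrightarrow> \<tau> g v \<in> T"
    and act_length: "g \<in> G \<Longrightarrow> v \<in> T \<Longrightarrow> length (\<tau> g v) = length v"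
    and act_prefix: "g \<in> G \<Longrightarrow> v \<in> T \<Longrightarrow> w \<in> T \<Longrightarrow> prefix v w \<Longrightarrow> prefix (\<tau> g v) (\<tau> g w)"
    and act_faithful: "g \<in> G \<Longrightarrow> (\<And>v. v \<in> T \<Longrightarrow> \<tau> g v = v) \<Longrightarrow> g = 0"
    and Nil_T: "[] \<in> T" and prefix_T: "w \<in> T \<Longrightarrow> prefix v w \<Longrightarrow> v \<in> T"
    and finite_level: "finite {v \<in> T. length v = n}"
    and level_transitive: "v \<in> T \<Longrightarrow> w \<in> T \<Longrightarrow> length v = length w \<Longrightarrow> \<exists>g\<in>G. \<tau> g v = w"
    and rist_nontrivial: "v \<in> T \<Longrightarrow> \<exists>g\<in>G. g \<noteq> 0 \<and> (\<forall>w\<in>T. \<not> prefix v w \<longrightarrow> \<tau> g w = w)"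
begin

lemma diff_G: "g \<in> G \<Longrightarrow> h \<in> G \<Longrightarrow> g - h \<in> G"
  using add_G[of g "- h"] neg_G by simp

lemma act_neg_act [simp]: "g \<in> G \<Longrightarrow> v \<in> T \<Longrightarrow> \<tau> (- g) (\<tau> g v) = v"
  by (metis act_0 act_add left_minus neg_G)

lemma act_act_neg [simp]: "g \<in> G \<Longrightarrow> v \<in> T \<Longrightarrow> \<tau> g (\<tau> (- g) v) = v"
  using act_neg_act[of "- g"] neg_G by simp

lemma act_inj: "g \<in> G \<Longrightarrow> v \<in> T \<Longrightarrow> w \<in> T \<Longrightarrow> \<tau> g v = \<tau> g w \<Longrightarrow> v = w"
  by (metis act_neg_act)

lemma act_prefix_iff:
  "g \<in> G \<Longrightarrow> v \<in> T \<Longrightarrow> w \<in> T \<Longrightarrow> prefix (\<tau> g v) (\<tau> g w) \<longleftrightarrow> prefix v w"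
  by (metis act_T act_neg_act act_prefix neg_G)

lemma act_eqI:
  assumes "g \<in> G" "h \<in> G" "\<And>v. v \<in> T \<Longrightarrow> \<tau> g v = \<tau> h v"
  shows "g = h"
proof -
  have "g - h = 0"
  proof (rule act_faithful)
    show "g - h \<in> G" using assms diff_G by blast
    fix v assume v: "v \<in> T"
    have "\<tau> (g - h) v = \<tau> g (\<tau> (- h) v)" using act_add[of g "- h" v] assms v neg_G by simp
    also have "\<dots> = v" using assms v neg_G act_T by simp
    finally show "\<tau> (g - h) v = v" .
  qed
  then show ?thesis by simp
qed

text \<open>Elements supported in \<open>A\<close>: the complement of \<open>A\<close> is fixed
  pointwise. Sets \<open>A\<close> other than subtrees are needed for products of elements supported
  below several vertices.\<close>

definition fixer :: "'a list set \<Rightarrow> 'g set" where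
  "fixer A = {g \<in> G. \<forall>w\<in>T. w \<notin> A \<longrightarrow> \<tau> g w = w}"

definition rist :: "'a list \<Rightarrow> 'g set" where
  "rist v = fixer {w. prefix v w}"

text \<open>Only the set of double commutators, not the subgroup they generate: conjugation
  invariance and monotonicity already hold for the set.\<close>

definition rist'' :: "'a list \<Rightarrow> 'g set" where
  "rist'' v = {comm (comm a b) (comm c d) | a b c d. a \<in> rist v \<and> b \<in> rist v \<and> c \<in> rist v \<and> d \<in> rist v}"

lemma fixer_G: "g \<in> fixer A \<Longrightarrow> g \<in> G"
  unfolding fixer_def by simp

lemma fixer_mono: "A \<subseteq> B \<Longrightarrow> fixer A \<subseteq> fixer B"
  unfolding fixer_def by blast

lemma fixer_maps: "g \<in> fixer A \<Longrightarrow> v \<in> T \<Longrightarrow> v \<in> A \<Longrightarrow> \<tau> g v \<in> A"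
  unfolding fixer_def by (metis (mono_tags, lifting) act_T act_inj mem_Collect_eq)

lemma fixer_commute:
  assumes "g \<in> fixer A" "h \<in> fixer B" "A \<inter> B = {}"
  shows "g + h = h + g"
proof (rule act_eqI)
  show "g + h \<in> G" "h + g \<in> G" using assms fixer_G add_G by auto
  fix v assume v: "v \<in> T"
  have gG: "g \<in> G" and hG: "h \<in> G" using assms fixer_G by auto
  have g: "w \<in> T \<Longrightarrow> w \<notin> A \<Longrightarrow> \<tau> g w = w" and h: "w \<in> T \<Longrightarrow> w \<notin> B \<Longrightarrow> \<tau> h w = w" for w
    using assms unfolding fixer_def by auto
  consider "v \<in> A" | "v \<in> B" | "v \<notin> A" "v \<notin> B" by blast
  then show "\<tau> (g + h) v = \<tau> (h + g) v"
  proof cases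
    case 1
    then have "\<tau> g v \<in> A" using fixer_maps assms v by blast
    then show ?thesis using 1 assms(3) v h gG hG act_T act_add by (metis disjoint_iff)
  next
    case 2
    then have "\<tau> h v \<in> B" using fixer_maps assms v by blast
    then show ?thesis using 2 assms(3) v g gG hG act_T act_add by (metis disjoint_iff)
  next
    case 3
    then show ?thesis using v g h gG hG act_add by simp
  qed
qed

lemma fixer_0: "0 \<in> fixer A"
  unfolding fixer_def using zero_G act_0 by simp

lemma fixer_add: "g \<in> fixer A \<Longrightarrow> h \<in> fixer A \<Longrightarrow> g + h \<in> fixer A"
  unfolding fixer_def using add_G act_add by simp

lemma fixer_neg: "g \<in> fixer A \<Longrightarrow> - g \<in> fixer A"
  unfolding fixer_def using neg_G by (auto, metis act_neg_act)

lemma fixer_diff: "g \<in> fixer A \<Longrightarrow> h \<in> fixer A \<Longrightarrow> g - h \<in> fixer A"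
  using fixer_add[of g A "- h"] fixer_neg by simp

lemma fixer_comm: "g \<in> fixer A \<Longrightarrow> h \<in> fixer A \<Longrightarrow> comm g h \<in> fixer A"
  unfolding comm_def by (intro fixer_diff fixer_add)

lemma fixer_empty: "fixer {} = {0}"
  using act_faithful fixer_0 unfolding fixer_def by auto

lemma fixer_Int: "g \<in> fixer A \<Longrightarrow> g \<in> fixer B \<Longrightarrow> g \<in> fixer (A \<inter> B)"
  unfolding fixer_def by blast

lemma rist_G: "g \<in> rist v \<Longrightarrow> g \<in> G"
  unfolding rist_def using fixer_G .

lemmas rist_add = fixer_add[of _ "{w. prefix v w}" for v, folded rist_def]
lemmas rist_neg = fixer_neg[of _ "{w. prefix v w}" for v, folded rist_def]
lemmas rist_diff = fixer_diff[of _ "{w. prefix v w}" for v, folded rist_def]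
lemmas rist_comm = fixer_comm[of _ "{w. prefix v w}" for v, folded rist_def]
lemmas rist_0 = fixer_0[of "{w. prefix v w}" for v, folded rist_def]

lemma rist_mono: "prefix v w \<Longrightarrow> rist w \<subseteq> rist v"
  unfolding rist_def by (intro fixer_mono) auto

lemma rist''_mono: "prefix v w \<Longrightarrow> rist'' w \<subseteq> rist'' v"
  unfolding rist''_def using rist_mono by blast

lemma rist''_rist: "rist'' v \<subseteq> rist v"
  unfolding rist''_def using rist_comm by auto

lemma rist_fixes: "g \<in> rist v \<Longrightarrow> v \<in> T \<Longrightarrow> \<tau> g v = v"
proof -
  assume g: "g \<in> rist v" and v: "v \<in> T"
  then have "prefix v (\<tau> g v)" using fixer_maps[of g "{w. prefix v w}" v] by (simp add: rist_def)
  then show ?thesis using act_length[OF rist_G[OF g] v]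
    by (metis append_eq_conv_conj prefix_def take_all order_refl)
qed

lemma rist_conj:
  assumes "r \<in> rist v" "g \<in> G" "v \<in> T"
  shows "g + r - g \<in> rist (\<tau> g v)"
proof -
  have G: "g + r - g \<in> G" using assms rist_G add_G diff_G by blast
  have "\<tau> (g + r - g) w = w" if w: "w \<in> T" "\<not> prefix (\<tau> g v) w" for w
  proof -
    have 1: "\<not> prefix v (\<tau> (- g) w)" using act_prefix_iff[of g v "\<tau> (- g) w"] assms w neg_G act_T by simp
    have "\<tau> (g + r - g) w = \<tau> g (\<tau> r (\<tau> (- g) w))"
      using assms rist_G neg_G act_T add_G w by (simp add: act_add diff_conv_add_uminus del: add_uminus_conv_diff)
    also have "\<tau> r (\<tau> (- g) w) = \<tau> (- g) w"
      using assms(1) 1 act_T w assms neg_G unfolding rist_def fixer_def by auto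
    finally show ?thesis using assms w by simp
  qed
  with G show ?thesis unfolding rist_def fixer_def by auto
qed

lemma rist''_conj:
  assumes "r \<in> rist'' v" "g \<in> G" "v \<in> T"
  shows "g + r - g \<in> rist'' (\<tau> g v)"
  using assms rist_conj unfolding rist''_def by (fastforce simp: conj_comm)

lemma rist_inter: "v \<parallel> w \<Longrightarrow> g \<in> rist v \<Longrightarrow> g \<in> rist w \<Longrightarrow> g = 0"
proof -
  assume "v \<parallel> w" "g \<in> rist v" "g \<in> rist w"
  then have "g \<in> fixer ({x. prefix v x} \<inter> {x. prefix w x})" unfolding rist_def by (intro fixer_Int)
  moreover have "{x. prefix v x} \<inter> {x. prefix w x} = {}"
    using \<open>v \<parallel> w\<close> prefix_same_cases by blast
  ultimately show "g = 0" using fixer_empty by simp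
qed

lemma rist_commute: "v \<parallel> w \<Longrightarrow> g \<in> rist v \<Longrightarrow> h \<in> rist w \<Longrightarrow> g + h = h + g"
  unfolding rist_def by (rule fixer_commute) (use prefix_same_cases in blast)+

lemma same_length_parallel: "length v = length w \<Longrightarrow> v \<noteq> w \<Longrightarrow> v \<parallel> w"
  by (metis not_equal_is_parallel)

lemma rist_moves:
  assumes "r \<in> rist v" "r \<noteq> 0"
  obtains x where "x \<in> T" "prefix v x" "\<tau> r x \<noteq> x"
  using assms act_faithful[of r] unfolding rist_def fixer_def by blast

lemma rist_ex: assumes "v \<in> T" obtains r where "r \<in> rist v" "r \<noteq> 0"
  using rist_nontrivial[OF assms] unfolding rist_def fixer_def by blast

text \<open>A non-trivial element of \<open>rist v\<close> moves a vertex below \<open>v\<close>;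
  since lengths are preserved, that vertex and its image are incomparable.\<close>

lemma split_below:
  assumes "v \<in> T"
  obtains c d where "c \<in> T" "d \<in> T" "prefix v c" "prefix v d" "c \<parallel> d" "length c = length d"
proof -
  obtain r where r: "r \<in> rist v" "r \<noteq> 0" using rist_ex assms by blast
  then obtain x where x: "x \<in> T" "prefix v x" "\<tau> r x \<noteq> x" using rist_moves by blast
  have "prefix v (\<tau> r x)" using fixer_maps[of r "{w. prefix v w}" x] r x by (simp add: rist_def)
  then show ?thesis using that[of x "\<tau> r x"] x r rist_G act_T act_length same_length_parallel by metis
qed

text \<open>Repeated splitting produces arbitrarily long descendants; truncation then gives the
  required length.\<close>

lemma extend_below:
  assumes "v \<in> T" "length v \<le> n"
  obtains w where "w \<in> T" "prefix v w" "length w = n"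
proof -
  have "\<exists>w\<in>T. prefix v w \<and> n \<le> length w"
  proof (induction n)
    case 0 then show ?case using assms by auto
  next
    case (Suc n)
    then obtain w where w: "w \<in> T" "prefix v w" "n \<le> length w" by auto
    obtain c d where cd: "c \<in> T" "prefix w c" "prefix w d" "c \<parallel> d" "length c = length d"
      using split_below w(1) by metis
    have "c \<noteq> w" using cd by auto
    then have "length w < length c" using cd prefix_length_less by (metis strict_prefix_def)
    then show ?case using cd w by (meson Suc_leI le_less_trans prefix_order.trans)
  qed
  then obtain w where w: "w \<in> T" "prefix v w" "n \<le> length w" by auto
  have "prefix v (take n w)" using w assms by (metis append_eq_conv_conj prefix_def prefix_length_prefix take_is_prefix length_take min.absorb2)
  moreover have "take n w \<in> T" using w prefix_T take_is_prefix by blast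
  ultimately show ?thesis using that w by simp
qed

text \<open>The vertices \<open>E n\<close> form a descending chain obtained by always passing to
  the branch \<open>d\<close> of a split; \<open>W n\<close> is the other branch \<open>c\<close> at
  stage \<open>n\<close>, incomparable to everything below \<open>d\<close>.\<close>

lemma antichain_below:
  assumes "v \<in> T"
  obtains W :: "nat \<Rightarrow> 'a list"
  where "\<And>l. W l \<in> T" "\<And>l. prefix v (W l)" "\<And>l m. l \<noteq> m \<Longrightarrow> W l \<parallel> W m"
proof -
  have "\<forall>w. \<exists>c d. w \<in> T \<longrightarrow> c \<in> T \<and> d \<in> T \<and> prefix w c \<and> prefix w d \<and> c \<parallel> d"
    using split_below by metis
  then obtain c d where cd: "\<And>w. w \<in> T \<Longrightarrow> c w \<in> T \<and> d w \<in> T \<and> prefix w (c w) \<and> prefix w (d w) \<and> c w \<parallel> d w"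
    by metis
  define E where "E n = (d ^^ n) v" for n
  have ES: "E (Suc n) = d (E n)" for n unfolding E_def by simp
  have ET: "E n \<in> T" for n by (induction n) (use assms cd ES in \<open>auto simp: E_def\<close>)
  have Em: "prefix (E l) (E (l + k))" for l k
    by (induction k) (use cd ET ES prefix_order.trans in \<open>auto, blast\<close>)
  define W where "W n = c (E n)" for n
  have par: "W l \<parallel> W m" if lm: "l < m" for l m
  proof -
    obtain k where "m = Suc l + k" using less_imp_Suc_add[OF lm] by auto
    then have "prefix (d (E l)) (W m)" using Em[of "Suc l" k] ES cd ET unfolding W_def
      by (metis prefix_order.trans)
    moreover have "c (E l) \<parallel> d (E l)" using cd ET by blast
    ultimately show ?thesis unfolding W_def
      by (metis parallel_append prefix_def append_Nil2)
  qed
  show ?thesis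
  proof
    show "W l \<in> T" for l unfolding W_def using cd ET by blast
    show "prefix v (W l)" for l using Em[of 0 l] cd ET unfolding W_def E_def
      by (metis add_0 funpow_0 prefix_order.trans)
    show "W l \<parallel> W m" if "l \<noteq> m" for l m
      using that par parallel_commute by (metis linorder_neqE_nat)
  qed
qed

text \<open>Being moved and being acted on trivially below are both inherited by descendants. Hence
  the elements of \<open>Q\<close> can be treated in turn, passing to a moved vertex whenever the
  current element acts non-trivially below.\<close>

lemma generic_below:
  assumes "finite Q" "Q \<subseteq> G" "w \<in> T"
  obtains w' where "w' \<in> T" "prefix w w'"
    "\<And>q. q \<in> Q \<Longrightarrow> \<tau> q w' \<noteq> w' \<or> (\<forall>x\<in>T. prefix w' x \<longrightarrow> \<tau> q x = x)"
proof -
  have "\<exists>w'\<in>T. prefix w w' \<and> (\<forall>q\<in>Q. \<tau> q w' \<noteq> w' \<or> (\<forall>x\<in>T. prefix w' x \<longrightarrow> \<tau> q x = x))"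
    using assms(1,2)
  proof (induction Q rule: finite_induct)
    case empty then show ?case using assms(3) by auto
  next
    case (insert q Q)
    then obtain w' where w': "w' \<in> T" "prefix w w'"
      "\<forall>q\<in>Q. \<tau> q w' \<noteq> w' \<or> (\<forall>x\<in>T. prefix w' x \<longrightarrow> \<tau> q x = x)" by auto
    show ?case
    proof (cases "\<forall>x\<in>T. prefix w' x \<longrightarrow> \<tau> q x = x")
      case True then show ?thesis using w' by auto
    next
      case False
      then obtain x where x: "x \<in> T" "prefix w' x" "\<tau> q x \<noteq> x" by auto
      have "\<tau> p x \<noteq> x \<or> (\<forall>y\<in>T. prefix x y \<longrightarrow> \<tau> p y = y)" if p: "p \<in> Q" for p
      proof (cases "\<tau> p w' = w'")
        case True then show ?thesis using w'(3) p x by (meson prefix_order.trans)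
      next
        case False
        have pG: "p \<in> G" using p insert by auto
        have "\<tau> p x \<noteq> x"
        proof
          assume "\<tau> p x = x"
          then have "prefix (\<tau> p w') x" using act_prefix[OF pG w'(1) x(1) x(2)] by simp
          then have "\<tau> p w' = w'" using x(2) act_length[OF pG w'(1)]
            by (metis False parallelE prefix_same_cases same_length_parallel)
          then show False using False by simp
        qed
        then show ?thesis by simp
      qed
      then have "\<forall>p\<in>insert q Q. \<tau> p x \<noteq> x \<or> (\<forall>y\<in>T. prefix x y \<longrightarrow> \<tau> p y = y)"
        using x(3) by blast
      moreover have "prefix w x" using x(2) w'(2) by (rule prefix_order.trans[rotated])
      ultimately show ?thesis using x(1) by blast
    qed
  qed
  then show ?thesis using that by blast
qed

lemma comm_below:
  assumes "x \<in> T" "r \<in> G" "\<tau> r x \<noteq> x" "s \<in> rist x"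
  obtains \<alpha> where "\<alpha> \<in> rist (\<tau> r x)" "comm r s = \<alpha> - s"
  using that[of "r + s - r"] rist_conj[OF assms(4,2,1)] unfolding comm_def by simp

text \<open>If \<open>r\<close> moves \<open>x\<close> and \<open>s\<close> is non-trivial below
  \<open>x\<close>, then \<open>comm r s\<close> is the product of \<open>- s\<close> with an
  element supported below the incomparable vertex \<open>\<tau> r x\<close>; it could vanish only if
  \<open>s\<close> were supported below both.\<close>

lemma rist_nonabelian:
  assumes "v \<in> T" obtains a b where "a \<in> rist v" "b \<in> rist v" "comm a b \<noteq> 0"
proof -
  obtain r where r: "r \<in> rist v" "r \<noteq> 0" using rist_ex assms by blast
  then obtain x where x: "x \<in> T" "prefix v x" "\<tau> r x \<noteq> x" using rist_moves by blast
  obtain s where s: "s \<in> rist x" "s \<noteq> 0" using rist_ex x by blast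
  have rG: "r \<in> G" using r rist_G by blast
  obtain \<alpha> where a: "\<alpha> \<in> rist (\<tau> r x)" "comm r s = \<alpha> - s" using comm_below[OF x(1) rG x(3) s(1)] .
  have "comm r s \<noteq> 0"
  proof
    assume "comm r s = 0"
    then have "s \<in> rist (\<tau> r x)" using a by simp
    then show False using s rist_inter x same_length_parallel act_length[OF rG x(1)] by metis
  qed
  then show ?thesis using that r s rist_mono[OF x(2)] by blast
qed

text \<open>The commutators of \<open>r\<close> with \<open>- a\<close> and \<open>- b\<close> are
  \<open>a\<close> and \<open>b\<close> up to factors supported below \<open>\<tau> r x\<close>.
  Their commutator therefore has the component \<open>comm a b \<noteq> 0\<close> below
  \<open>x\<close>.\<close>

lemma rist''_nontrivial:
  assumes "v \<in> T" obtains c where "c \<in> rist'' v" "c \<noteq> 0"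
proof -
  obtain r where r: "r \<in> rist v" "r \<noteq> 0" using rist_ex assms by blast
  then obtain x where x: "x \<in> T" "prefix v x" "\<tau> r x \<noteq> x" using rist_moves by blast
  have rG: "r \<in> G" using r rist_G by blast
  obtain a b where ab: "a \<in> rist x" "b \<in> rist x" "comm a b \<noteq> 0" using rist_nonabelian x by blast
  have na: "- a \<in> rist x" "- b \<in> rist x" using ab rist_neg by auto
  obtain \<alpha> where al: "\<alpha> \<in> rist (\<tau> r x)" "comm r (- a) = \<alpha> - - a" using comm_below[OF x(1) rG x(3) na(1)] .
  obtain \<beta> where be: "\<beta> \<in> rist (\<tau> r x)" "comm r (- b) = \<beta> - - b" using comm_below[OF x(1) rG x(3) na(2)] .
  have par: "\<tau> r x \<parallel> x" using x same_length_parallel act_length[OF rG x(1)] by metis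
  have cA: "p + q = q + p" if "p \<in> rist (\<tau> r x)" "q \<in> rist x" for p q
    using rist_commute[OF par that] .
  define e where "e = comm (comm r (- a)) (comm r (- b))"
  have e: "e = comm (\<alpha> + a) (\<beta> + b)" unfolding e_def al be by simp
  have "e \<noteq> 0"
  proof
    assume "e = 0"
    then have "(\<alpha> + a) + (\<beta> + b) = (\<beta> + b) + (\<alpha> + a)" using e comm_eq_0_iff by metis
    moreover have "(\<alpha> + a) + (\<beta> + b) = (\<alpha> + \<beta>) + (a + b)"
      using cA[OF be(1) ab(1)] by (metis add.assoc)
    moreover have "(\<beta> + b) + (\<alpha> + a) = (\<beta> + \<alpha>) + (b + a)"
      using cA[OF al(1) ab(2)] by (metis add.assoc)
    ultimately have eq: "(\<alpha> + \<beta>) + (a + b) = (\<beta> + \<alpha>) + (b + a)" by simp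
    then have "- (\<beta> + \<alpha>) + (\<alpha> + \<beta>) = (b + a) - (a + b)"
      by (metis add.assoc add_diff_cancel minus_add_cancel)
    moreover have "- (\<beta> + \<alpha>) + (\<alpha> + \<beta>) \<in> rist (\<tau> r x)" using al be rist_add rist_neg by blast
    moreover have "(b + a) - (a + b) \<in> rist x" using ab rist_add rist_diff by blast
    ultimately have "(b + a) - (a + b) = 0" using rist_inter[OF par] by metis
    then show False using ab(3) comm_eq_0_iff[of a b] by simp
  qed
  moreover have "e \<in> rist'' v" unfolding e_def rist''_def
    using r ab na rist_mono[OF x(2)] by blast
  ultimately show ?thesis using that by blast
qed

end

section \<open>Finite actions and confined subgroups\<close>

lemma comm_disjoint_parts:
  fixes a b :: "'g::group_add"
  assumes "a' + b = b + a'" "a + b' = b' + a" "a' + b' = b' + a'"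
    "a' + a = a + a'" "b' + b = b + b'"
  shows "comm (a + a') (b + b') = comm a b"
  by (rule comm_add_commuting) (use assms in auto)

text \<open>Seven indices provide one common \<open>l\<close> and two disjoint triples, one triple
  for each inner commutator of an element of \<open>rist''\<close>.\<close>

lemma infinite_pick:
  assumes "infinite (A::nat set)"
  obtains l m n k m' n' k' where "l \<in> A" "m \<in> A" "n \<in> A" "k \<in> A" "m' \<in> A" "n' \<in> A" "k' \<in> A"
    "distinct [l, m, n, k, m', n', k']"
proof -
  have i: "i \<noteq> j \<Longrightarrow> enumerate A i \<noteq> enumerate A j" for i j
    using strict_mono_enumerate[OF assms] by (metis strict_mono_eq)
  show ?thesis
    by (rule that[of "enumerate A 0" "enumerate A 1" "enumerate A 2" "enumerate A 3" "enumerate A 4"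
          "enumerate A 5" "enumerate A 6"])
      (use i enumerate_in_set[OF assms] in auto)
qed

context tree_group
begin

text \<open>Three antichain members inducing the same pair of permutations give
  \<open>a\<^sub>l - a\<^sub>m\<close> and \<open>b\<^sub>l - b\<^sub>n\<close> in the kernel, and their commutator is the one of
  \<open>a\<^sub>l\<close> and \<open>b\<^sub>l\<close>.\<close>

lemma rist_comm_fixes_finite:
  assumes fin: "finite P" and v: "v \<in> T"
    and maps: "\<And>g o'. g \<in> G \<Longrightarrow> o' \<in> P \<Longrightarrow> \<pi> g o' \<in> P"
    and hom: "\<And>g h o'. g \<in> G \<Longrightarrow> h \<in> G \<Longrightarrow> o' \<in> P \<Longrightarrow> \<pi> (g + h) o' = \<pi> g (\<pi> h o')"
    and one: "\<And>o'. o' \<in> P \<Longrightarrow> \<pi> 0 o' = o'"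
  obtains w where "w \<in> T" "prefix v w"
    "\<And>a b o'. a \<in> rist w \<Longrightarrow> b \<in> rist w \<Longrightarrow> o' \<in> P \<Longrightarrow> \<pi> (comm a b) o' = o'"
proof -
  have "\<exists>w\<in>T. prefix v w \<and> (\<forall>a\<in>rist w. \<forall>b\<in>rist w. \<forall>o'\<in>P. \<pi> (comm a b) o' = o')"
  proof (rule ccontr)
    assume neg: "\<not> ?thesis"
    obtain W :: "nat \<Rightarrow> _" where W: "\<And>l. W l \<in> T" "\<And>l. prefix v (W l)" "\<And>l m. l \<noteq> m \<Longrightarrow> W l \<parallel> W m"
      using antichain_below[OF v] by blast
    have "\<forall>l. \<exists>a b o'. a \<in> rist (W l) \<and> b \<in> rist (W l) \<and> o' \<in> P \<and> \<pi> (comm a b) o' \<noteq> o'"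
      using neg W by blast
    then obtain a b p where ab: "\<And>l. a l \<in> rist (W l)" "\<And>l. b l \<in> rist (W l)" "\<And>l. p l \<in> P"
      "\<And>l. \<pi> (comm (a l) (b l)) (p l) \<noteq> p l" by metis
    have G: "a l \<in> G" "b l \<in> G" for l using rist_G[OF ab(1)] rist_G[OF ab(2)] by auto
    define f where "f l = (restrict (\<pi> (a l)) P, restrict (\<pi> (b l)) P)" for l
    have "finite ((P \<rightarrow>\<^sub>E P) \<times> (P \<rightarrow>\<^sub>E P))" using fin by (simp add: finite_PiE)
    moreover have "f l \<in> (P \<rightarrow>\<^sub>E P) \<times> (P \<rightarrow>\<^sub>E P)" for l unfolding f_def using maps G by auto
    ultimately obtain c where "infinite {l. f l = c}" using infinite_fibre by metis
    then obtain l m n where lmn: "f l = c" "f m = c" "f n = c" "distinct [l, m, n]"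
      using infinite_pick[of "{l. f l = c}"] by (metis distinct_length_2_or_more mem_Collect_eq distinct_singleton)
    have e1: "\<pi> (a l) o' = \<pi> (a m) o'" if "o' \<in> P" for o'
      using lmn(1,2) that unfolding f_def by (metis prod.inject restrict_apply)
    have e2: "\<pi> (b l) o' = \<pi> (b n) o'" if "o' \<in> P" for o'
      using lmn(1,3) that unfolding f_def by (metis prod.inject restrict_apply)
    have inv: "\<pi> g (\<pi> (- g) o') = o'" if "g \<in> G" "o' \<in> P" for g o'
      using hom[of g "- g" o'] one that neg_G by simp
    have k1: "\<pi> (a l - a m) o' = o'" if "o' \<in> P" for o'
      using hom[of "a l" "- a m" o'] that G neg_G e1[of "\<pi> (- a m) o'"] maps inv by simp
    have k2: "\<pi> (b l - b n) o' = o'" if "o' \<in> P" for o'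
      using hom[of "b l" "- b n" o'] that G neg_G e2[of "\<pi> (- b n) o'"] maps inv by simp
    have inv': "\<pi> (- g) o' = o'" if "g \<in> G" "o' \<in> P" "\<pi> g o' = o'" for g o'
      using hom[of "- g" g o'] one that neg_G by simp
    have kG: "a l - a m \<in> G" "b l - b n \<in> G" using G diff_G by auto
    have "\<pi> (comm (a l - a m) (b l - b n)) o' = o'" if "o' \<in> P" for o'
      unfolding comm_def using that k1 k2 inv' kG hom neg_G add_G
      by (simp add: diff_conv_add_uminus del: add_uminus_conv_diff minus_diff_eq)
    moreover have "comm (a l + - a m) (b l + - b n) = comm (a l) (b l)"
    proof (rule comm_disjoint_parts)
      have P: "W m \<parallel> W l" "W l \<parallel> W n" "W m \<parallel> W n" "W n \<parallel> W l" using W lmn by auto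
      show "- a m + b l = b l + - a m" using rist_commute[OF P(1) rist_neg[OF ab(1)] ab(2)] .
      show "a l + - b n = - b n + a l" using rist_commute[OF P(2) ab(1) rist_neg[OF ab(2)]] .
      show "- a m + - b n = - b n + - a m" using rist_commute[OF P(3) rist_neg[OF ab(1)] rist_neg[OF ab(2)]] .
      show "- a m + a l = a l + - a m" using rist_commute[OF P(1) rist_neg[OF ab(1)] ab(1)] .
      show "- b n + b l = b l + - b n" using rist_commute[OF P(4) rist_neg[OF ab(2)] ab(2)] .
    qed
    ultimately have "\<pi> (comm (a l) (b l)) (p l) = p l" using ab(3)[of l] by simp
    then show False using ab(4)[of l] by simp
  qed
  then show ?thesis using that by blast
qed

text \<open>Here \<open>p\<close> moves \<open>w\<close>, so \<open>- a + p + a - p\<close> is the product of the commuting elements \<open>- a\<close>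
  and \<open>p + a - p\<close> with disjoint supports. Commutators or products of two such elements for
  different \<open>p\<close> isolate the part below \<open>w\<close>.\<close>

lemma isolate_commutator:
  assumes Hadd: "\<And>g h. g \<in> H \<Longrightarrow> h \<in> H \<Longrightarrow> g + h \<in> H" and Hneg: "\<And>g. g \<in> H \<Longrightarrow> - g \<in> H"
    and w: "w \<in> T" and JG: "J \<subseteq> G" and mv: "\<And>p. p \<in> J \<Longrightarrow> \<tau> p w \<noteq> w"
    and sep: "\<And>p q. p \<in> J \<Longrightarrow> q \<in> J \<Longrightarrow> \<tau> p w = \<tau> q w \<Longrightarrow> (\<And>x. x \<in> T \<Longrightarrow> prefix w x \<Longrightarrow> \<tau> p x = \<tau> q x)"
    and WT: "\<And>l. W l \<in> T" and Ww: "\<And>l. prefix w (W l)" and Wp: "\<And>l m. l \<noteq> m \<Longrightarrow> W l \<parallel> W m"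
    and V: "\<And>l. V l = {x \<in> T. \<exists>q\<in>insert 0 J. prefix (\<tau> q (W l)) x}"
    and a: "\<And>l. a l \<in> rist (W l)" and b: "\<And>l. b l \<in> rist (W l)"
    and pJ: "p \<in> J" "p' \<in> J" "p'' \<in> J"
    and cp: "\<And>l. l \<in> L \<Longrightarrow> - a l + p + a l \<in> H"
    and cp': "\<And>l. l \<in> L \<Longrightarrow> - b l + p' + b l \<in> H"
    and cp'': "\<And>l. l \<in> L \<Longrightarrow> - (a l + b l) + p'' + (a l + b l) \<in> H"
    and L: "l \<in> L" "m \<in> L" "n \<in> L" "k \<in> L" "distinct [l, m, n, k]"
    and Vdisj: "\<And>l m. l \<noteq> m \<Longrightarrow> V l \<inter> V m = {}"
  shows "\<exists>j \<in> fixer (V m \<union> V n \<union> V k). comm (- a l) (- b l) + j \<in> H"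
proof -
  define D where "D p a = - a + p + a - p" for p a :: 'g
  have Hdiff: "g - h \<in> H" if "g \<in> H" "h \<in> H" for g h
    using Hadd[of g "- h"] Hneg that by simp
  have Hcomm: "comm g h \<in> H" if "g \<in> H" "h \<in> H" for g h
    unfolding comm_def using Hadd Hdiff that by simp
  have DD: "(- a + p + a) - (- b + p + b) = D p a - D p b" for p a b
    unfolding D_def by (simp add: group_norm del: add_uminus_conv_diff)
  have memV: "r \<in> fixer (V l)" if r: "r \<in> rist (W l)" for r l
    using r WT unfolding rist_def fixer_def V by (auto simp: act_0)
  have conjV: "q + r - q \<in> fixer (V l)" if r: "r \<in> rist (W l)" "q \<in> J" for r l q
  proof -
    have "q + r - q \<in> rist (\<tau> q (W l))" using r JG WT rist_conj by blast
    then show ?thesis using r unfolding rist_def fixer_def V by auto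
  qed
  have DV: "D q r \<in> fixer (V l)" if r: "r \<in> rist (W l)" "q \<in> J" for r l q
  proof -
    have "D q r = - r + (q + r - q)" unfolding D_def by (simp add: add.assoc diff_conv_add_uminus del: add_uminus_conv_diff)
    then show ?thesis using conjV[OF r] memV[OF r(1)] fixer_add fixer_neg by simp
  qed
  have comV: "g + h = h + g" if "g \<in> fixer (V i)" "h \<in> fixer (V j)" "i \<noteq> j" for g h i j
    using fixer_commute[OF that(1,2)] Vdisj that by blast
  have ne: "l \<noteq> m" "l \<noteq> n" "l \<noteq> k" "m \<noteq> n" "m \<noteq> k" "n \<noteq> k" using L by auto
  \<comment> \<open>In the difference of two conjugates of the same \<open>p\<close> the middle
    \<open>p\<close> cancels, which leaves a difference of two values of \<open>D\<close> supported
    in different sets \<open>V\<close>.\<close>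
  have Da: "D p (a l) - D p (a i) \<in> H" if "i \<in> L" for i
    using Hdiff[OF cp[OF L(1)] cp[OF that]] DD by simp
  have Db: "D p' (b l) - D p' (b i) \<in> H" if "i \<in> L" for i
    using Hdiff[OF cp'[OF L(1)] cp'[OF that]] DD by simp
  have Dab: "D p'' (a l + b l) - D p'' (a i + b i) \<in> H" if "i \<in> L" for i
    using Hdiff[OF cp''[OF L(1)] cp''[OF that]] DD by simp
  have ab: "a i + b i \<in> rist (W i)" for i using a b rist_add by blast
  have key: "comm (x - x') (y - y') = comm x y"
    if "x \<in> fixer (V l)" "y \<in> fixer (V l)" "x' \<in> fixer (V i)" "y' \<in> fixer (V j)"
      "l \<noteq> i" "l \<noteq> j" "i \<noteq> j" for x y x' y' i j
  proof -
    have "comm (x + - x') (y + - y') = comm x y"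
      by (rule comm_disjoint_parts; rule comV) (use that fixer_neg in blast)+
    then show ?thesis by simp
  qed
  have cross: "comm (- r + (q + r - q)) (- s + (q' + s - q')) = comm (- r) (- s)"
    if r: "r \<in> rist w" and s: "s \<in> rist w" and q: "q \<in> J" "q' \<in> J" "\<tau> q w \<noteq> \<tau> q' w" for r s q q'
  proof -
    have G: "q \<in> G" "q' \<in> G" using q JG by auto
    have par: "\<tau> q w \<parallel> w" "\<tau> q' w \<parallel> w" "\<tau> q w \<parallel> \<tau> q' w"
      using mv q same_length_parallel act_length G w by metis+
    have c: "q + r - q \<in> rist (\<tau> q w)" "q' + s - q' \<in> rist (\<tau> q' w)" using rist_conj r s G w by auto
    have n: "- r \<in> rist w" "- s \<in> rist w" using r s rist_neg by auto
    show ?thesis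
    proof (rule comm_disjoint_parts)
      show "q + r - q + - s = - s + (q + r - q)" using rist_commute[OF par(1) c(1) n(2)] .
      show "- r + (q' + s - q') = q' + s - q' + - r" using rist_commute[OF par(2) c(2) n(1)] by simp
      show "q + r - q + (q' + s - q') = q' + s - q' + (q + r - q)" using rist_commute[OF par(3) c(1,2)] .
      show "q + r - q + - r = - r + (q + r - q)" using rist_commute[OF par(1) c(1) n(1)] .
      show "q' + s - q' + - s = - s + (q' + s - q')" using rist_commute[OF par(2) c(2) n(2)] .
    qed
  qed
  have Dalt: "D q r = - r + (q + r - q)" for q r unfolding D_def
    by (simp add: add.assoc diff_conv_add_uminus del: add_uminus_conv_diff)
  have aw: "a i \<in> rist w" "b i \<in> rist w" for i using a b rist_mono[OF Ww] by blast+
  \<comment> \<open>The conjugated parts of \<open>D\<close> live below the images of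
    \<open>w\<close> under the colours. If two of these images differ, the conjugated parts commute
    and drop out of a commutator; otherwise all three colours agree below \<open>w\<close> and a
    product is used instead.\<close>
  consider (1) "\<tau> p w \<noteq> \<tau> p' w" | (2) "\<tau> p w = \<tau> p' w" "\<tau> p w \<noteq> \<tau> p'' w"
    | (3) "\<tau> p w = \<tau> p' w" "\<tau> p w = \<tau> p'' w" by blast
  then show ?thesis
  proof cases
    case 1
    have "comm (D p (a l) - D p (a m)) (D p' (b l) - D p' (b n)) \<in> H"
      using Hcomm Da Db L by blast
    also have "comm (D p (a l) - D p (a m)) (D p' (b l) - D p' (b n)) = comm (D p (a l)) (D p' (b l))"
      by (rule key[where i=m and j=n]) (use DV a b pJ ne in auto)
    also have "\<dots> = comm (- a l) (- b l)"
      unfolding Dalt using cross aw pJ 1 by blast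
    finally show ?thesis using fixer_0 by (intro bexI[of _ 0]) auto
  next
    case 2
    \<comment> \<open>Here \<open>b\<close> is replaced by \<open>a + b\<close>, whose colour
      \<open>p''\<close> sends \<open>w\<close> elsewhere; \<open>comm (- a) (- (a + b))\<close>
      equals \<open>comm (- a) (- b)\<close>.\<close>
    have "comm (D p (a l) - D p (a m)) (D p'' (a l + b l) - D p'' (a n + b n)) \<in> H"
      using Hcomm Da Dab L by blast
    also have "comm (D p (a l) - D p (a m)) (D p'' (a l + b l) - D p'' (a n + b n))
      = comm (D p (a l)) (D p'' (a l + b l))"
      by (rule key[where i=m and j=n]) (use DV a ab pJ ne in auto)
    also have "\<dots> = comm (- a l) (- (a l + b l))"
      unfolding Dalt using cross[of "a l" "a l + b l"] aw rist_add pJ 2 by blast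
    also have "\<dots> = comm (- a l) (- b l)"
      unfolding comm_def by (simp add: group_norm del: add_uminus_conv_diff)
    finally show ?thesis using fixer_0 by (intro bexI[of _ 0]) auto
  next
    case 3
    have same: "q + r - q = p + r - p" if r: "r \<in> rist w" and q: "q \<in> J" "\<tau> p w = \<tau> q w" for q r
    proof -
      have qG: "q \<in> G" and pG: "p \<in> G" using q pJ JG by auto
      have dG: "- p + q \<in> G" using qG pG add_G neg_G by blast
      have tr: "\<tau> (- p + q) x = x" if "x \<in> T" "prefix w x" for x
        using sep[OF pJ(1) q(1) q(2) that] that qG pG neg_G act_add[of "- p" q x] by (metis act_neg_act)
      have "- p + q \<in> fixer {x. \<not> prefix w x}" unfolding fixer_def using dG tr by auto
      then have "(- p + q) + r = r + (- p + q)"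
        using fixer_commute[of "- p + q" _ r "{x. prefix w x}"] r unfolding rist_def by blast
      then have "p + ((- p + q) + r) - q = p + (r + (- p + q)) - q" by simp
      then show ?thesis by (simp add: group_norm del: add_uminus_conv_diff)
    qed
    have D': "D p' r = D p r" "D p'' r = D p r" if "r \<in> rist w" for r
      unfolding Dalt using same[OF that pJ(2) 3(1)] same[OF that pJ(3) 3(2)] by auto
    define c where "c = comm (- a l) (- b l)"
    define x y z where "x = D p (a l)" and "y = D p (b l)" and "z = D p (a l + b l)"
    \<comment> \<open>With a single conjugating element the conjugated parts for \<open>a l\<close>
      and \<open>b l\<close> multiply to the one for \<open>a l + b l\<close>, whereas the inverses
      in front multiply in the opposite order; the quotient is the commutator.\<close>
    have Dmul: "x + y - z = c"
    proof -
      have par: "\<tau> p w \<parallel> w"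
        using mv[OF pJ(1)] same_length_parallel act_length JG pJ w by (metis subsetD)
      have "p + a l - p \<in> rist (\<tau> p w)" using aw rist_conj JG pJ w by blast
      then have cm: "(p + a l - p) + - b l = - b l + (p + a l - p)" using rist_commute[OF par] aw rist_neg by blast
      have "x + y - z = - a l + ((p + a l - p) + - b l) + (p + b l - p) - z"
        unfolding x_def y_def Dalt by (simp add: add.assoc del: add_uminus_conv_diff)
      also have "\<dots> = c" unfolding cm z_def D_def c_def comm_def
        by (simp add: group_norm del: add_uminus_conv_diff)
      finally show ?thesis .
    qed
    define x' y' z' where "x' = D p (a m)" and "y' = D p (b n)" and "z' = D p (a k + b k)"
    have F: "x \<in> fixer (V l)" "y \<in> fixer (V l)" "z \<in> fixer (V l)"
      "x' \<in> fixer (V m)" "y' \<in> fixer (V n)" "z' \<in> fixer (V k)"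
      unfolding x_def y_def z_def x'_def y'_def z'_def using DV a b ab pJ by auto
    have "x - x' \<in> H" "y - y' \<in> H" "z - z' \<in> H"
      unfolding x_def y_def z_def x'_def y'_def z'_def
      using Da Db Dab L D' aw rist_add by auto
    then have "(x - x') + (y - y') - (z - z') \<in> H" using Hadd Hdiff by blast
    moreover have "(x - x') + (y - y') - (z - z') = c + (- x' - y' + z')"
    proof -
      have "(x - x') + (y - y') - (z - z') = x + (- x' + y) + ((- y' + z') + - z)"
        by (simp add: group_norm del: add_uminus_conv_diff)
      also have "- x' + y = y + - x'" by (rule comV[where i=m and j=l]) (use F fixer_neg ne in auto)
      also have "(- y' + z') + - z = - z + (- y' + z')"
      proof (rule fixer_commute[of _ "V n \<union> V k" _ "V l"])
        have "y' \<in> fixer (V n \<union> V k)" "z' \<in> fixer (V n \<union> V k)"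
          using F fixer_mono[of "V n" "V n \<union> V k"] fixer_mono[of "V k" "V n \<union> V k"] by auto
        then show "- y' + z' \<in> fixer (V n \<union> V k)" by (intro fixer_add fixer_neg)
        show "- z \<in> fixer (V l)" using F fixer_neg by blast
        show "(V n \<union> V k) \<inter> V l = {}" using Vdisj[of n l] Vdisj[of k l] ne by blast
      qed
      also have "x + (y + - x') + (- z + (- y' + z')) = x + y + (- x' + - z) + (- y' + z')"
        by (simp add: add.assoc del: add_uminus_conv_diff)
      also have "- x' + - z = - z + - x'" by (rule comV[where i=m and j=l]) (use F fixer_neg ne in auto)
      also have "x + y + (- z + - x') + (- y' + z') = c + (- x' - y' + z')"
        unfolding Dmul[symmetric] by (simp add: diff_conv_add_uminus add.assoc del: add_uminus_conv_diff)
      finally show ?thesis .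
    qed
    moreover have "- x' - y' + z' \<in> fixer (V m \<union> V n \<union> V k)"
    proof -
      have "V m \<subseteq> V m \<union> V n \<union> V k" "V n \<subseteq> V m \<union> V n \<union> V k" "V k \<subseteq> V m \<union> V n \<union> V k" by auto
      then have "x' \<in> fixer (V m \<union> V n \<union> V k)" "y' \<in> fixer (V m \<union> V n \<union> V k)" "z' \<in> fixer (V m \<union> V n \<union> V k)"
        using F fixer_mono by blast+
      then show ?thesis by (intro fixer_add fixer_diff fixer_neg)
    qed
    ultimately show ?thesis unfolding c_def by auto
  qed
qed

text \<open>\<open>P\<close> gives each \<open>g\<close> in \<open>rist v\<close> a colour
  \<open>p\<close> whose conjugate by \<open>g\<close> lies in \<open>H\<close>. An extremal choice
  lets all colours be taken among those that move a fixed vertex \<open>w\<close>; by pigeonhole,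
  seven members of an antichain below \<open>w\<close> carry the same colours, and the commutators
  isolated from them combine to a double commutator.\<close>

lemma confined_contains_rist'':
  assumes Hadd: "\<And>g h. g \<in> H \<Longrightarrow> h \<in> H \<Longrightarrow> g + h \<in> H" and Hneg: "\<And>g. g \<in> H \<Longrightarrow> - g \<in> H"
    and v: "v \<in> T" and P: "finite P" "P \<subseteq> rist v" "0 \<notin> P"
    and conf: "\<And>g. g \<in> rist v \<Longrightarrow> \<exists>p\<in>P. - g + p + g \<in> H"
  obtains w where "w \<in> T" "prefix v w" "rist'' w \<subseteq> H"
proof -
  have PG: "P \<subseteq> G" using P rist_G by blast
  \<comment> \<open>The quotients \<open>- p + q\<close> are included so that elements of
    \<open>P\<close> that agree at the generic vertex \<open>w\<close> agree on its whole
    subtree.\<close>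
  define Q where "Q = P \<union> (\<lambda>(p, q). - p + q) ` (P \<times> P)"
  have Q: "finite Q" "Q \<subseteq> G" unfolding Q_def using P PG by (auto intro!: add_G neg_G)
  \<comment> \<open>The elements of \<open>P\<close> whose conjugate by \<open>x\<close> avoids
    \<open>H\<close>. For an \<open>x\<close> with as many of them as possible, a further
    conjugation by an element of \<open>rist w\<close> can never make all colours that move
    \<open>w\<close> fail.\<close>
  define hd where "hd x = {p \<in> P. - x + p + x \<notin> H}" for x
  have "\<exists>x. x \<in> rist v \<and> (\<forall>y. y \<in> rist v \<longrightarrow> card (hd y) \<le> card (hd x))"
  proof (rule ex_has_greatest_nat)
    show "0 \<in> rist v" by (rule rist_0)
    show "\<forall>y. y \<in> rist v \<longrightarrow> card (hd y) < Suc (card P)"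
      unfolding hd_def using P by (auto intro!: card_mono simp: less_Suc_eq_le)
  qed
  then obtain x where x: "x \<in> rist v" and xmax: "\<And>y. y \<in> rist v \<Longrightarrow> card (hd y) \<le> card (hd x)" by blast
  have xG: "x \<in> G" using x rist_G by blast
  obtain p0 where p0: "p0 \<in> P" "- x + p0 + x \<in> H" using conf[OF x] by blast
  then have p0v: "p0 \<in> rist v" "p0 \<noteq> 0" using P by auto
  obtain w0 where w0: "w0 \<in> T" "prefix v w0" "\<tau> p0 w0 \<noteq> w0" using rist_moves[OF p0v] by blast
  obtain w where w: "w \<in> T" "prefix w0 w"
    "\<And>q. q \<in> Q \<Longrightarrow> \<tau> q w \<noteq> w \<or> (\<forall>x\<in>T. prefix w x \<longrightarrow> \<tau> q x = x)"
    using generic_below[OF Q w0(1)] by blast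
  have vw: "prefix v w" using w0(2) w(2) by (rule prefix_order.trans)
  define J where "J = {p \<in> P. \<tau> p w \<noteq> w}"
  have JG: "J \<subseteq> G" using PG unfolding J_def by auto
  have mv: "\<tau> p w \<noteq> w" if "p \<in> J" for p using that unfolding J_def by auto
  have sep: "\<tau> p x = \<tau> q x" if "p \<in> J" "q \<in> J" "\<tau> p w = \<tau> q w" "x \<in> T" "prefix w x" for p q x
  proof -
    have G: "p \<in> G" "q \<in> G" using that JG by auto
    have "- p + q \<in> Q" using that unfolding Q_def J_def by force
    moreover have "\<tau> (- p + q) w = w" using G that(3) w(1) neg_G act_add by (metis act_neg_act)
    ultimately have "\<tau> (- p + q) x = x" using w(3) that by blast
    then have "\<tau> (- p) (\<tau> q x) = x" using G neg_G act_add that by simp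
    then show ?thesis using G that act_T by (metis act_act_neg)
  qed
  have p0J: "p0 \<in> J"
  proof -
    have "\<tau> p0 w \<noteq> w"
    proof
      assume a: "\<tau> p0 w = w"
      have pG: "p0 \<in> G" using p0 PG by auto
      have "prefix (\<tau> p0 w0) w" using act_prefix[OF pG w0(1) w(1,2)] a by simp
      then show False using w(2) w0(3) act_length[OF pG w0(1)]
        by (metis parallelE prefix_same_cases same_length_parallel)
    qed
    then show ?thesis using p0 unfolding J_def by simp
  qed
  have conf': "\<exists>p\<in>J. - (g + x) + p + (g + x) \<in> H" if g: "g \<in> rist w" for g
  proof (rule ccontr)
    assume neg: "\<not> ?thesis"
    have gv: "g \<in> rist v" using g rist_mono[OF vw] by blast
    have gxv: "g + x \<in> rist v" using gv x rist_add by blast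
    \<comment> \<open>An element of \<open>P\<close> that fixes \<open>w\<close> acts trivially
      below it and commutes with \<open>g\<close>, so its conjugates by \<open>x\<close> and
      \<open>g + x\<close> coincide. As \<open>p0\<close> is new, \<open>hd\<close> grows strictly,
      against the choice of \<open>x\<close>.\<close>
    have "hd x \<union> J \<subseteq> hd (g + x)"
    proof
      fix p assume p: "p \<in> hd x \<union> J"
      show "p \<in> hd (g + x)"
      proof (cases "p \<in> J")
        case True then show ?thesis using neg unfolding hd_def J_def by auto
      next
        case False
        then have pP: "p \<in> P" "- x + p + x \<notin> H" using p unfolding hd_def by auto
        then have "\<tau> p w = w" using False unfolding J_def by auto
        then have "\<forall>y\<in>T. prefix w y \<longrightarrow> \<tau> p y = y" using w(3)[of p] pP unfolding Q_def by blast
        then have "p \<in> fixer {y. \<not> prefix w y}" using pP PG unfolding fixer_def by auto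
        then have pg: "p + g = g + p" using g fixer_commute unfolding rist_def by blast
        have "- (g + x) + p + (g + x) = - x + (- g + (p + g)) + x"
          by (simp add: group_norm del: add_uminus_conv_diff)
        also have "\<dots> = - x + p + x" unfolding pg by simp
        finally show ?thesis using pP unfolding hd_def by simp
      qed
    qed
    moreover have "p0 \<notin> hd x" using p0 unfolding hd_def by simp
    ultimately have "hd x \<subset> hd (g + x)" using p0J by blast
    moreover have "finite (hd (g + x))" unfolding hd_def using P by simp
    ultimately have "card (hd x) < card (hd (g + x))" by (rule psubset_card_mono[rotated])
    then show False using xmax[OF gxv] by simp
  qed
  \<comment> \<open>Conjugating \<open>H\<close> by \<open>x\<close> turns the statement about
    conjugates by \<open>g + x\<close> into one about conjugates by \<open>g\<close>.\<close>
  define H' where "H' = {g. - x + g + x \<in> H}"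
  have H'add: "g + h \<in> H'" if "g \<in> H'" "h \<in> H'" for g h
    using Hadd[of "- x + g + x" "- x + h + x"] that unfolding H'_def
    by (simp add: group_norm del: add_uminus_conv_diff)
  have H'neg: "- g \<in> H'" if "g \<in> H'" for g
    using Hneg[of "- x + g + x"] that unfolding H'_def
    by (simp add: group_norm del: add_uminus_conv_diff)
  have "\<exists>p\<in>J. - g + p + g \<in> H'" if "g \<in> rist w" for g
    using conf'[OF that] unfolding H'_def by (simp add: group_norm del: add_uminus_conv_diff)
  then obtain colour where colour: "\<And>g. g \<in> rist w \<Longrightarrow> colour g \<in> J \<and> - g + colour g + g \<in> H'" by metis
  obtain W :: "nat \<Rightarrow> _" where W: "\<And>l. W l \<in> T" "\<And>l. prefix w (W l)" "\<And>l m. l \<noteq> m \<Longrightarrow> W l \<parallel> W m"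
    using antichain_below[OF w(1)] by blast
  have "\<exists>l. rist'' (W l) \<subseteq> H'"
  proof (rule ccontr)
    assume neg: "\<not> ?thesis"
    \<comment> \<open>The signs anticipate the form in which \<open>isolate_commutator\<close>
      delivers its result.\<close>
    have ex: "\<exists>a b c d. a \<in> rist (W l) \<and> b \<in> rist (W l) \<and> c \<in> rist (W l) \<and> d \<in> rist (W l)
      \<and> comm (comm (- a) (- b)) (comm (- c) (- d)) \<notin> H'" for l
    proof -
      obtain a b c d where h: "a \<in> rist (W l)" "b \<in> rist (W l)" "c \<in> rist (W l)" "d \<in> rist (W l)"
        "comm (comm a b) (comm c d) \<notin> H'" using neg unfolding rist''_def by blast
      then show ?thesis
        by (intro exI[of _ "- a"] exI[of _ "- b"] exI[of _ "- c"] exI[of _ "- d"]) (simp add: rist_neg)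
    qed
    then obtain a b c d where abcd: "\<And>l. a l \<in> rist (W l)" "\<And>l. b l \<in> rist (W l)" "\<And>l. c l \<in> rist (W l)"
      "\<And>l. d l \<in> rist (W l)" and nH: "\<And>l. comm (comm (- a l) (- b l)) (comm (- c l) (- d l)) \<notin> H'"
      by metis
    have abcdw: "a l \<in> rist w" "b l \<in> rist w" "c l \<in> rist w" "d l \<in> rist w" for l
      using abcd[of l] rist_mono[OF W(2)[of l]] by blast+
    then have sw: "a l + b l \<in> rist w" "c l + d l \<in> rist w" for l using rist_add by blast+
    \<comment> \<open>Six colours are recorded: for each inner commutator, those of its two entries
      and of their sum.\<close>
    define f where "f l = (colour (a l), colour (b l), colour (a l + b l), colour (c l), colour (d l), colour (c l + d l))" for l
    have "finite (J \<times> J \<times> J \<times> J \<times> J \<times> J)" unfolding J_def using P by simp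
    moreover have "f l \<in> J \<times> J \<times> J \<times> J \<times> J \<times> J" for l unfolding f_def using colour abcdw sw by auto
    ultimately obtain col where col: "infinite {l. f l = col}" using infinite_fibre by metis
    obtain l m n k m' n' k' where L: "l \<in> {l. f l = col}" "m \<in> {l. f l = col}" "n \<in> {l. f l = col}" "k \<in> {l. f l = col}"
      "m' \<in> {l. f l = col}" "n' \<in> {l. f l = col}" "k' \<in> {l. f l = col}" and dist: "distinct [l, m, n, k, m', n', k']"
      using infinite_pick[OF col] .
    obtain p p' p'' q q' q'' where cc: "col = (p, p', p'', q, q', q'')" by (cases col) auto
    have pJ: "p \<in> J" "p' \<in> J" "p'' \<in> J" "q \<in> J" "q' \<in> J" "q'' \<in> J"
      using L(1) colour abcdw sw cc unfolding f_def by auto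
    define V where "V l = {x \<in> T. \<exists>q\<in>insert 0 J. prefix (\<tau> q (W l)) x}" for l
    have Vdisj: "V i \<inter> V j = {}" if ij: "i \<noteq> j" for i j
    proof (rule ccontr)
      assume "V i \<inter> V j \<noteq> {}"
      then obtain y r s where y: "y \<in> T" "r \<in> insert 0 J" "s \<in> insert 0 J"
        "prefix (\<tau> r (W i)) y" "prefix (\<tau> s (W j)) y" unfolding V_def by blast
      have G: "r \<in> G" "s \<in> G" using y JG zero_G by auto
      have "prefix (\<tau> r w) y" "prefix (\<tau> s w) y"
        using y act_prefix[OF G(1) w(1) W(1,2)] act_prefix[OF G(2) w(1) W(1,2)] prefix_order.trans by blast+
      then have eqw: "\<tau> r w = \<tau> s w"
        using act_length[OF G(1) w(1)] act_length[OF G(2) w(1)]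
        by (metis parallelE prefix_same_cases same_length_parallel)
      have "\<tau> r (W j) = \<tau> s (W j)"
      proof (cases "r = 0 \<or> s = 0")
        case True
        then have "r = 0 \<and> s = 0" using eqw mv y(2,3) w(1) by (metis act_0 insertE)
        then show ?thesis by simp
      next
        case False then show ?thesis using sep[OF _ _ eqw W(1,2)] y by blast
      qed
      then have "\<not> \<tau> r (W i) \<parallel> \<tau> r (W j)" using y(4,5) prefix_same_cases by (metis parallelE)
      then have "\<not> W i \<parallel> W j" using act_prefix_iff[OF G(1) W(1) W(1)] by blast
      then show False using W(3)[OF ij] by simp
    qed
    have cp: "- a i + p + a i \<in> H'" "- b i + p' + b i \<in> H'" "- (a i + b i) + p'' + (a i + b i) \<in> H'"
        "- c i + q + c i \<in> H'" "- d i + q' + d i \<in> H'" "- (c i + d i) + q'' + (c i + d i) \<in> H'"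
      if "i \<in> {l. f l = col}" for i
    proof -
      have "colour (a i) = p" "colour (b i) = p'" "colour (a i + b i) = p''"
        "colour (c i) = q" "colour (d i) = q'" "colour (c i + d i) = q''"
        using that unfolding cc f_def by simp_all
      then show "- a i + p + a i \<in> H'" "- b i + p' + b i \<in> H'" "- (a i + b i) + p'' + (a i + b i) \<in> H'"
        "- c i + q + c i \<in> H'" "- d i + q' + d i \<in> H'" "- (c i + d i) + q'' + (c i + d i) \<in> H'"
        using colour[OF abcdw(1)[of i]] colour[OF abcdw(2)[of i]] colour[OF sw(1)[of i]]
          colour[OF abcdw(3)[of i]] colour[OF abcdw(4)[of i]] colour[OF sw(2)[of i]] by metis+
    qed
    have dist': "distinct [l, m, n, k]" "distinct [l, m', n', k']" using dist by auto
    have "\<exists>j \<in> fixer (V m \<union> V n \<union> V k). comm (- a l) (- b l) + j \<in> H'"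
      by (rule isolate_commutator[where H = H' and w = w and J = J and W = W and V = V and a = a and b = b
            and p = p and p' = p' and p'' = p'' and L = "{l. f l = col}"])
        (fact H'add | fact H'neg | fact w(1) | fact JG | fact mv | fact sep | fact W | fact V_def | fact abcd
          | fact pJ | fact cp | fact L | fact dist' | fact Vdisj)+
    then obtain j where j: "j \<in> fixer (V m \<union> V n \<union> V k)" "comm (- a l) (- b l) + j \<in> H'" by blast
    have "\<exists>j \<in> fixer (V m' \<union> V n' \<union> V k'). comm (- c l) (- d l) + j \<in> H'"
      by (rule isolate_commutator[where H = H' and w = w and J = J and W = W and V = V and a = c and b = d
            and p = q and p' = q' and p'' = q'' and L = "{l. f l = col}"])
        (fact H'add | fact H'neg | fact w(1) | fact JG | fact mv | fact sep | fact W | fact V_def | fact abcd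
          | fact pJ | fact cp | fact L | fact dist' | fact Vdisj)+
    then obtain j' where j': "j' \<in> fixer (V m' \<union> V n' \<union> V k')" "comm (- c l) (- d l) + j' \<in> H'" by blast
    have memV: "r \<in> fixer (V l)" if r: "r \<in> rist (W l)" for r
      using r W(1) unfolding rist_def fixer_def V_def by (auto simp: act_0)
    have F: "comm (- a l) (- b l) \<in> fixer (V l)" "comm (- c l) (- d l) \<in> fixer (V l)"
      using memV[OF rist_comm[OF rist_neg[OF abcd(1)] rist_neg[OF abcd(2)]]]
        memV[OF rist_comm[OF rist_neg[OF abcd(3)] rist_neg[OF abcd(4)]]] by blast+
    have ne: "l \<noteq> m" "l \<noteq> n" "l \<noteq> k" "l \<noteq> m'" "l \<noteq> n'" "l \<noteq> k'" "m \<noteq> m'" "m \<noteq> n'" "m \<noteq> k'"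
      "n \<noteq> m'" "n \<noteq> n'" "n \<noteq> k'" "k \<noteq> m'" "k \<noteq> n'" "k \<noteq> k'" using dist by auto
    have d1: "(V m \<union> V n \<union> V k) \<inter> V l = {}" using Vdisj[OF ne(1)] Vdisj[OF ne(2)] Vdisj[OF ne(3)] by blast
    have d2: "(V m' \<union> V n' \<union> V k') \<inter> V l = {}" using Vdisj[OF ne(4)] Vdisj[OF ne(5)] Vdisj[OF ne(6)] by blast
    have d3: "(V m \<union> V n \<union> V k) \<inter> (V m' \<union> V n' \<union> V k') = {}"
      using Vdisj[OF ne(7)] Vdisj[OF ne(8)] Vdisj[OF ne(9)] Vdisj[OF ne(10)] Vdisj[OF ne(11)]
        Vdisj[OF ne(12)] Vdisj[OF ne(13)] Vdisj[OF ne(14)] Vdisj[OF ne(15)] by blast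
    \<comment> \<open>The factors \<open>j\<close> and \<open>j'\<close> have supports disjoint from
      each other and from \<open>V l\<close>, so they cancel from the outer commutator.\<close>
    have "comm (comm (- a l) (- b l) + j) (comm (- c l) (- d l) + j') = comm (comm (- a l) (- b l)) (comm (- c l) (- d l))"
    proof (rule comm_disjoint_parts)
      show "j + comm (- c l) (- d l) = comm (- c l) (- d l) + j" using fixer_commute[OF j(1) F(2) d1] .
      show "comm (- a l) (- b l) + j' = j' + comm (- a l) (- b l)" using fixer_commute[OF j'(1) F(1) d2] by simp
      show "j + j' = j' + j" using fixer_commute[OF j(1) j'(1) d3] .
      show "j + comm (- a l) (- b l) = comm (- a l) (- b l) + j" using fixer_commute[OF j(1) F(1) d1] .
      show "j' + comm (- c l) (- d l) = comm (- c l) (- d l) + j'" using fixer_commute[OF j'(1) F(2) d2] .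
    qed
    moreover have "comm g h \<in> H'" if "g \<in> H'" "h \<in> H'" for g h
      using H'add[OF H'add[OF H'add[OF that] H'neg[OF that(1)]] H'neg[OF that(2)]] unfolding comm_def by simp
    ultimately have "comm (comm (- a l) (- b l)) (comm (- c l) (- d l)) \<in> H'" using j(2) j'(2) by metis
    then show False using nH by blast
  qed
  then obtain l where l: "rist'' (W l) \<subseteq> H'" by blast
  \<comment> \<open>Undoing the conjugation by \<open>x\<close> moves \<open>W l\<close> to
    \<open>\<tau> (- x) (W l)\<close>, which is still below \<open>v\<close> because
    \<open>x\<close> fixes \<open>v\<close>.\<close>
  have nx: "- x \<in> G" "- x \<in> rist v" using xG neg_G x rist_neg by auto
  show ?thesis
  proof
    show "\<tau> (- x) (W l) \<in> T" using nx W act_T by blast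
    show "prefix v (\<tau> (- x) (W l))"
      using act_prefix[OF nx(1) v W(1)[of l]] rist_fixes[OF nx(2) v] vw W(2) prefix_order.trans by metis
    show "rist'' (\<tau> (- x) (W l)) \<subseteq> H"
    proof
      fix r assume "r \<in> rist'' (\<tau> (- x) (W l))"
      then have "x + r - x \<in> rist'' (W l)"
        using rist''_conj[of r "\<tau> (- x) (W l)" x] xG act_T W(1) nx by simp
      then have "x + r - x \<in> H'" using l by blast
      then show "r \<in> H" unfolding H'_def
        by (simp add: group_norm del: add_uminus_conv_diff)
    qed
  qed
qed

end

section \<open>Finite unions of intervals and piecewise translations\<close>

text \<open>A finite union of intervals \<open>[a, b)\<close> described without listing them:
  membership changes only on passing a point of \<open>C\<close>. The gaps \<open>{x<..y}\<close>
  are open on the left because a cut point belongs to the piece on its right. As \<open>C\<close>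
  need not be minimal, Boolean operations simply unite the cut sets.\<close>

definition cut_set :: "real set \<Rightarrow> real set \<Rightarrow> bool" where
  "cut_set C B \<longleftrightarrow> finite C \<and> B \<subseteq> {0..<1} \<and>
     (\<forall>x y. 0 \<le> x \<longrightarrow> x < y \<longrightarrow> y < 1 \<longrightarrow> {x<..y} \<inter> C = {} \<longrightarrow> (x \<in> B \<longleftrightarrow> y \<in> B))"

lemma cut_setD:
  "cut_set C B \<Longrightarrow> 0 \<le> x \<Longrightarrow> x < y \<Longrightarrow> y < 1 \<Longrightarrow> {x<..y} \<inter> C = {} \<Longrightarrow> x \<in> B \<longleftrightarrow> y \<in> B"
  unfolding cut_set_def by blast

definition simple :: "real set \<Rightarrow> bool" where
  "simple B \<longleftrightarrow> (\<exists>C. cut_set C B)"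

lemma cut_set_mono: "cut_set C B \<Longrightarrow> C \<subseteq> C' \<Longrightarrow> finite C' \<Longrightarrow> cut_set C' B"
  unfolding cut_set_def by (meson disjoint_iff subsetD)

lemma cut_set_Un: "cut_set C B \<Longrightarrow> cut_set C' B' \<Longrightarrow> cut_set (C \<union> C') (B \<union> B')"
  unfolding cut_set_def by (auto simp: Int_Un_distrib)

lemma cut_set_Int: "cut_set C B \<Longrightarrow> cut_set C' B' \<Longrightarrow> cut_set (C \<union> C') (B \<inter> B')"
  unfolding cut_set_def by (auto simp: Int_Un_distrib)

lemma cut_set_Diff: "cut_set C B \<Longrightarrow> cut_set C' B' \<Longrightarrow> cut_set (C \<union> C') (B - B')"
  unfolding cut_set_def by (auto simp: Int_Un_distrib)

lemma cut_set_empty: "cut_set {} {}"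
  unfolding cut_set_def by auto

lemma cut_set_UNIV: "cut_set {} {0..<1}"
  unfolding cut_set_def by auto

lemma cut_set_interval: "0 \<le> a \<Longrightarrow> b \<le> 1 \<Longrightarrow> cut_set {a, b} {a..<b}"
  unfolding cut_set_def by auto

lemma simple_empty [simp]: "simple {}"
  unfolding simple_def using cut_set_empty by blast

lemma simple_UNIV [simp]: "simple {0..<1}"
  unfolding simple_def using cut_set_UNIV by blast

lemma simple_Un: "simple A \<Longrightarrow> simple B \<Longrightarrow> simple (A \<union> B)"
  unfolding simple_def using cut_set_Un by blast

lemma simple_Int: "simple A \<Longrightarrow> simple B \<Longrightarrow> simple (A \<inter> B)"
  unfolding simple_def using cut_set_Int by blast

lemma simple_Diff: "simple A \<Longrightarrow> simple B \<Longrightarrow> simple (A - B)"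
  unfolding simple_def using cut_set_Diff by blast

lemma simple_UN: "finite I \<Longrightarrow> (\<And>i. i \<in> I \<Longrightarrow> simple (A i)) \<Longrightarrow> simple (\<Union>i\<in>I. A i)"
  by (induction I rule: finite_induct) (auto intro: simple_Un)

lemma simple_interval: "0 \<le> a \<Longrightarrow> b \<le> 1 \<Longrightarrow> simple {a..<b}"
  unfolding simple_def using cut_set_interval by blast

lemma simple_sub: "simple B \<Longrightarrow> B \<subseteq> {0..<1}"
  unfolding simple_def cut_set_def by blast

lemma gap_sub: "{a<..<b} \<inter> C = {} \<Longrightarrow> x < b \<Longrightarrow> {a<..x} \<inter> C = {}" for a b x :: real
  by (force simp: disjoint_iff)

lemma finite_gap_right:
  assumes "finite (C::real set)"
  obtains e where "e > 0" "{x<..<x + e} \<inter> C = {}"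
proof -
  have "\<exists>e>0. \<forall>y\<in>C. y \<noteq> x \<longrightarrow> e \<le> dist x y" using finite_set_avoid[OF assms, of x] by auto
  then obtain e where e: "e > 0" "\<forall>y\<in>C. y \<noteq> x \<longrightarrow> e \<le> dist x y" by blast
  have "{x<..<x + e} \<inter> C = {}" using e by (auto simp: dist_real_def)
  then show ?thesis using that e by blast
qed

lemma simple_right_open:
  assumes "simple B" "x \<in> B"
  obtains e where "e > 0" "{x..<x + e} \<subseteq> B"
proof -
  obtain C where C: "cut_set C B" using assms unfolding simple_def by blast
  have x: "0 \<le> x" "x < 1" using simple_sub[OF assms(1)] assms(2) by auto
  obtain e where e: "e > 0" "{x<..<x + e} \<inter> C = {}"
    using finite_gap_right C unfolding cut_set_def by blast
  define e' where "e' = min e (1 - x)"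
  have "y \<in> B" if "y \<in> {x..<x + e'}" for y
  proof (cases "y = x")
    case False
    then have "x < y" "y < 1" "y < x + e" using that unfolding e'_def by auto
    moreover from this have "{x<..y} \<inter> C = {}" using gap_sub[OF e(2)] by blast
    ultimately show ?thesis using cut_setD[OF C x(1)] assms by blast
  qed (use assms in simp)
  moreover have "e' > 0" using e x unfolding e'_def by simp
  ultimately show ?thesis using that by blast
qed

text \<open>The same encoding for right-continuous piecewise translations: the displacement changes
  only at points of \<open>C\<close>. Displacements are real numbers, not classes modulo
  \<open>1\<close>, so a wrap past \<open>1\<close> also counts as a cut.\<close>

definition ptrans :: "real set \<Rightarrow> (real \<Rightarrow> real) \<Rightarrow> bool" where
  "ptrans C f \<longleftrightarrow> finite C \<and> bij_betw f {0..<1} {0..<1} \<and>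
     (\<forall>x y. 0 \<le> x \<longrightarrow> x < y \<longrightarrow> y < 1 \<longrightarrow> {x<..y} \<inter> C = {} \<longrightarrow> f y - f x = y - x)"

lemma ptransD:
  "ptrans C f \<Longrightarrow> 0 \<le> x \<Longrightarrow> x < y \<Longrightarrow> y < 1 \<Longrightarrow> {x<..y} \<inter> C = {} \<Longrightarrow> f y = f x + (y - x)"
  unfolding ptrans_def by force

lemma ptrans_in: "ptrans C f \<Longrightarrow> x \<in> {0..<1} \<Longrightarrow> f x \<in> {0..<1}"
  unfolding ptrans_def by (meson bij_betwE)

lemma ptrans_inj: "ptrans C f \<Longrightarrow> inj_on f {0..<1}"
  unfolding ptrans_def bij_betw_def by blast

lemma ptrans_mono: "ptrans C f \<Longrightarrow> C \<subseteq> C' \<Longrightarrow> finite C' \<Longrightarrow> ptrans C' f"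
  unfolding ptrans_def by (meson disjoint_iff subsetD)

text \<open>The cut point is the last one not exceeding \<open>x\<close>, with \<open>0\<close> as
  default. Consequently every displacement already occurs at \<open>0\<close> or at a cut
  point.\<close>

lemma ptrans_cell:
  assumes "ptrans C f" "0 \<le> x" "x < 1"
  obtains c where "c \<in> insert 0 C" "0 \<le> c" "c \<le> x" "{c<..x} \<inter> C = {}" "f x = f c + (x - c)"
proof -
  define A where "A = {c \<in> insert 0 C. 0 \<le> c \<and> c \<le> x}"
  have A: "finite A" "A \<noteq> {}" using assms unfolding A_def ptrans_def by auto
  define c where "c = Max A"
  have c: "c \<in> A" using A unfolding c_def by (rule Max_in)
  have e: "{c<..x} \<inter> C = {}"
  proof (rule ccontr)
    assume "{c<..x} \<inter> C \<noteq> {}"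
    then obtain d where "d \<in> C" "c < d" "d \<le> x" by auto
    moreover then have "d \<in> A" using c unfolding A_def by auto
    ultimately show False using Max_ge[OF A(1), of d] unfolding c_def by simp
  qed
  have "f x = f c + (x - c)"
  proof (cases "c = x")
    case False
    then show ?thesis using ptransD[OF assms(1), of c x] c e assms unfolding A_def by auto
  qed simp
  then show ?thesis using that c e unfolding A_def by blast
qed

text \<open>Adding the preimages of \<open>E\<close> to the cut points makes \<open>f\<close> map
  every gap by one translation to an interval that avoids \<open>E\<close>; this controls both
  preimages of sets and compositions.\<close>

lemma ptrans_preimage:
  assumes f: "ptrans C f" and E: "finite E"
  defines "C' \<equiv> C \<union> {x \<in> {0..<1}. f x \<in> E}"
  shows "finite C'"
    and "0 \<le> x \<Longrightarrow> x < y \<Longrightarrow> y < 1 \<Longrightarrow> {x<..y} \<inter> C' = {} \<Longrightarrow>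
      f y = f x + (y - x) \<and> {f x<..f y} \<inter> E = {}"
proof -
  have "finite {x \<in> {0..<1}. f x \<in> E}"
    using finite_vimage_IntI[of E f "{0..<1}"] ptrans_inj[OF f] E
    by (simp add: vimage_def Int_def conj_commute)
  then show "finite C'" unfolding C'_def using f unfolding ptrans_def by simp
  assume xy: "0 \<le> x" "x < y" "y < 1" "{x<..y} \<inter> C' = {}"
  then have e: "{x<..y} \<inter> C = {}" unfolding C'_def by blast
  have tr: "f t = f x + (t - x)" if "x < t" "t \<le> y" for t
    using ptransD[OF f, of x t] that xy(1,3) e by force
  have "{f x<..f y} \<inter> E = {}"
  proof (rule ccontr)
    assume "{f x<..f y} \<inter> E \<noteq> {}"
    then obtain u where u: "u \<in> E" "f x < u" "u \<le> f y" by auto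
    define t where "t = x + (u - f x)"
    have t: "x < t" "t \<le> y" using u tr[of y] xy unfolding t_def by auto
    then have "f t = u" using tr unfolding t_def by simp
    then have "t \<in> {x<..y} \<inter> {x \<in> {0..<1}. f x \<in> E}" using t u xy by auto
    then show False using xy(4) unfolding C'_def by blast
  qed
  then show "f y = f x + (y - x) \<and> {f x<..f y} \<inter> E = {}" using tr xy by simp
qed

lemma ptrans_comp_cut:
  assumes f: "ptrans C f" and B: "cut_set E B"
  shows "cut_set (C \<union> {x \<in> {0..<1}. f x \<in> E}) {x \<in> {0..<1}. f x \<in> B}"
proof -
  have E: "finite E" using B unfolding cut_set_def by blast
  have "f x \<in> B \<longleftrightarrow> f y \<in> B"
    if xy: "0 \<le> x" "x < y" "y < 1" "{x<..y} \<inter> (C \<union> {x \<in> {0..<1}. f x \<in> E}) = {}" for x y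
  proof -
    have "f x < f y" "0 \<le> f x" "f y < 1"
      using ptrans_preimage(2)[OF f E xy] xy ptrans_in[OF f, of x] ptrans_in[OF f, of y] by auto
    then show ?thesis using cut_setD[OF B] ptrans_preimage(2)[OF f E xy] by blast
  qed
  then show ?thesis using ptrans_preimage(1)[OF f E] unfolding cut_set_def by auto
qed

lemma ptrans_comp:
  assumes f: "ptrans C f" and h: "ptrans E h"
  shows "ptrans (C \<union> {x \<in> {0..<1}. f x \<in> E}) (\<lambda>x. h (f x))"
proof -
  have E: "finite E" using h unfolding ptrans_def by blast
  have "h (f y) - h (f x) = y - x"
    if xy: "0 \<le> x" "x < y" "y < 1" "{x<..y} \<inter> (C \<union> {x \<in> {0..<1}. f x \<in> E}) = {}" for x y
  proof -
    have "f x < f y" "0 \<le> f x" "f y < 1"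
      using ptrans_preimage(2)[OF f E xy] xy ptrans_in[OF f, of x] ptrans_in[OF f, of y] by auto
    then have "h (f y) = h (f x) + (f y - f x)"
      using ptransD[OF h] ptrans_preimage(2)[OF f E xy] by blast
    then show ?thesis using ptrans_preimage(2)[OF f E xy] by simp
  qed
  moreover have "bij_betw (\<lambda>x. h (f x)) {0..<1} {0..<1}"
    using f h bij_betw_trans[of f "{0..<1}" "{0..<1}" h "{0..<1}"] unfolding ptrans_def comp_def by blast
  ultimately show ?thesis using ptrans_preimage(1)[OF f E] unfolding ptrans_def by blast
qed

section \<open>Lengths of finite unions of intervals\<close>

abbreviation len :: "real set \<Rightarrow> real" where "len B \<equiv> measure lborel B"

text \<open>Induction along the cut points from left to right: between the previous cut point
  \<open>c\<close> and \<open>t\<close> the set \<open>B\<close> is everything or nothing. The extra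
  point \<open>t0\<close> lets the induction end at \<open>1\<close>.\<close>

lemma simple_initial_induct:
  assumes C: "cut_set C B" "t \<le> 1" "0 \<le> t"
    and base: "P 0"
    and step: "\<And>c t. 0 \<le> c \<Longrightarrow> c < t \<Longrightarrow> t \<le> 1 \<Longrightarrow> c \<in> insert 0 C \<Longrightarrow> {c<..<t} \<inter> C = {} \<Longrightarrow>
      (B \<inter> {c..<t} = {} \<or> B \<inter> {c..<t} = {c..<t}) \<Longrightarrow> P c \<Longrightarrow> t \<in> C \<union> {0, t0} \<Longrightarrow> P t"
    and t: "t \<in> C \<union> {0, t0}"
  shows "P t"
  using C(2,3) t
proof (induction "card (C \<inter> {0<..<t})" arbitrary: t rule: less_induct)
  case less
  have fin: "finite C" using C unfolding cut_set_def by blast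
  show ?case
  proof (cases "t = 0")
    case False
    define A where "A = insert 0 (C \<inter> {0<..<t})"
    have A: "finite A" "A \<noteq> {}" using fin unfolding A_def by auto
    define c where "c = Max A"
    have c: "c \<in> A" using A unfolding c_def by (rule Max_in)
    then have c0: "0 \<le> c" "c < t" "c \<in> insert 0 C" using less.prems False unfolding A_def by auto
    have e: "{c<..<t} \<inter> C = {}"
    proof (rule ccontr)
      assume "{c<..<t} \<inter> C \<noteq> {}"
      then obtain d where "d \<in> C" "c < d" "d < t" by auto
      moreover then have "d \<in> A" using c0 unfolding A_def by auto
      ultimately show False using Max_ge[OF A(1), of d] unfolding c_def by simp
    qed
    have mem: "x \<in> B \<longleftrightarrow> c \<in> B" if "c \<le> x" "x < t" for x
    proof (cases "x = c")
      case False
      have "{c<..x} \<inter> C = {}" using gap_sub[OF e that(2)] .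
      then show ?thesis using cut_setD[OF C(1) c0(1), of x] False that less.prems by auto
    qed simp
    have Pc: "P c"
    proof (cases "c = 0")
      case False
      have "c \<in> C \<inter> {0<..<t}" using c False unfolding A_def by auto
      then have "C \<inter> {0<..<c} \<subset> C \<inter> {0<..<t}" by auto
      then have "card (C \<inter> {0<..<c}) < card (C \<inter> {0<..<t})" using fin by (intro psubset_card_mono) auto
      then show ?thesis using less.hyps[of c] c0 less.prems by auto
    qed (use base in simp)
    have "B \<inter> {c..<t} = {} \<or> B \<inter> {c..<t} = {c..<t}"
    proof (cases "c \<in> B")
      case True
      then have "{c..<t} \<subseteq> B" using mem by auto
      then show ?thesis by blast
    next
      case False
      then have "x \<notin> B" if "x \<in> {c..<t}" for x using mem[of x] that by auto
      then show ?thesis by blast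
    qed
    then show ?thesis using step[OF c0(1,2) less.prems(1) c0(3) e _ Pc less.prems(3)] by blast
  qed (use base in simp)
qed

lemma simple_borel: "simple B \<Longrightarrow> B \<in> sets lborel"
proof -
  assume "simple B"
  then obtain C where C: "cut_set C B" unfolding simple_def by blast
  have "B \<inter> {0..<1} \<in> sets lborel"
  proof (rule simple_initial_induct[OF C, where t0 = 1 and P = "\<lambda>t. B \<inter> {0..<t} \<in> sets lborel"])
    fix c t assume *: "0 \<le> c" "c < t" "B \<inter> {c..<t} = {} \<or> B \<inter> {c..<t} = {c..<t}" "B \<inter> {0..<c} \<in> sets lborel"
    have "B \<inter> {0..<t} = B \<inter> {0..<c} \<union> B \<inter> {c..<t}" using *(1,2) by auto
    moreover have "B \<inter> {c..<t} \<in> sets lborel" using *(3) by (elim disjE) simp_all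
    ultimately show "B \<inter> {0..<t} \<in> sets lborel" using *(4) by (metis sets.Un)
  qed auto
  moreover have "B \<inter> {0..<1} = B" using simple_sub \<open>simple B\<close> by blast
  ultimately show ?thesis by simp
qed

lemma simple_finite_measure: "simple B \<Longrightarrow> B \<in> fmeasurable lborel"
proof -
  assume B: "simple B"
  have "emeasure lborel B \<le> emeasure lborel {0..<1::real}"
    using simple_sub[OF B] by (intro emeasure_mono) auto
  also have "\<dots> < \<infinity>" by simp
  finally show ?thesis using simple_borel[OF B] by (intro fmeasurableI) auto
qed

lemma len_Un: "simple A \<Longrightarrow> simple B \<Longrightarrow> A \<inter> B = {} \<Longrightarrow> len (A \<union> B) = len A + len B"
  by (rule measure_Un3[THEN trans]) (auto simp: simple_finite_measure)

lemma len_UN: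
  assumes "finite I" "\<And>i. i \<in> I \<Longrightarrow> simple (A i)" "\<And>i j. i \<in> I \<Longrightarrow> j \<in> I \<Longrightarrow> i \<noteq> j \<Longrightarrow> A i \<inter> A j = {}"
  shows "len (\<Union>i\<in>I. A i) = (\<Sum>i\<in>I. len (A i))"
  using assms
proof (induction I rule: finite_induct)
  case (insert i I)
  have "len (A i \<union> (\<Union>i\<in>I. A i)) = len (A i) + len (\<Union>i\<in>I. A i)"
    by (rule len_Un) (use insert in \<open>auto intro!: simple_UN\<close>)
  then show ?case using insert by simp
qed simp

lemma len_pos: "simple B \<Longrightarrow> B \<noteq> {} \<Longrightarrow> len B > 0"
proof -
  assume B: "simple B" "B \<noteq> {}"
  then obtain x e where e: "e > 0" "{x..<x + e} \<subseteq> B" using simple_right_open by (metis ex_in_conv)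
  have "0 < len {x..<x + e}" using e by simp
  also have "\<dots> \<le> len B" by (rule measure_mono_fmeasurable) (use e B simple_finite_measure in auto)
  finally show ?thesis .
qed

text \<open>The length is a sum of differences of consecutive points of \<open>C\<close>, with
  \<open>0\<close> and \<open>1\<close> added.\<close>

lemma len_in_subgroup:
  assumes C: "cut_set C B" "C \<subseteq> M" and M: "0 \<in> M" "1 \<in> M" "\<And>x y. x \<in> M \<Longrightarrow> y \<in> M \<Longrightarrow> x + y \<in> M" "\<And>x. x \<in> M \<Longrightarrow> - x \<in> M"
  shows "len B \<in> M"
proof -
  have sB: "simple B" using C unfolding simple_def by blast
  have "len (B \<inter> {0..<1}) \<in> M"
  proof (rule simple_initial_induct[OF C(1), where t0 = 1 and P = "\<lambda>t. len (B \<inter> {0..<t}) \<in> M"])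
    fix c t assume *: "0 \<le> c" "c < t" "t \<le> 1" "B \<inter> {c..<t} = {} \<or> B \<inter> {c..<t} = {c..<t}"
      "len (B \<inter> {0..<c}) \<in> M" "c \<in> insert 0 C" "t \<in> C \<union> {0, 1}"
    have cM: "c \<in> M" "t \<in> M" using * C M by auto
    have eq: "B \<inter> {0..<t} = B \<inter> {0..<c} \<union> B \<inter> {c..<t}" using *(1,2) by auto
    have "len (B \<inter> {0..<t}) = len (B \<inter> {0..<c}) + len (B \<inter> {c..<t})"
      unfolding eq by (intro len_Un simple_Int simple_interval sB) (use *(1,2,3) in auto)
    moreover have "len (B \<inter> {c..<t}) \<in> M"
      using *(4)
    proof
      assume "B \<inter> {c..<t} = {c..<t}"
      then have "len (B \<inter> {c..<t}) = t + - c" using *(2) by simp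
      then show ?thesis using M cM by metis
    qed (use M in simp)
    ultimately show "len (B \<inter> {0..<t}) \<in> M" using M(3) *(5) by metis
  qed (use M in auto)
  moreover have "B \<inter> {0..<1} = B" using simple_sub sB by blast
  ultimately show ?thesis by simp
qed

text \<open>When \<open>B\<close> is also cut at the cut points of \<open>f\<close>, each piece is
  translated as a whole. Through the inverse \<open>h\<close>, images become preimages and are again
  finite unions of intervals.\<close>

lemma len_ptrans:
  assumes f: "ptrans C f" and h: "ptrans E h" and fh: "\<And>x. x \<in> {0..<1} \<Longrightarrow> h (f x) = x \<and> f (h x) = x"
    and B: "simple B"
  shows "simple (f ` B) \<and> len (f ` B) = len B"
proof -
  have im: "f ` A = {x \<in> {0..<1}. h x \<in> A}" if "A \<subseteq> {0..<1}" for A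
  proof -
    have "x \<in> f ` A" if "x \<in> {0..<1}" "h x \<in> A" for x using fh[OF that(1)] that(2) by (metis image_eqI)
    then show ?thesis using that fh ptrans_in[OF f] by auto
  qed
  have S: "simple (f ` A)" if "simple A" for A
    using im[OF simple_sub[OF that]] ptrans_comp_cut[OF h] that unfolding simple_def by metis
  obtain C0 where C0: "cut_set C0 B" using B unfolding simple_def by blast
  define C' where "C' = C0 \<union> C"
  have C': "cut_set C' B" "C \<subseteq> C'" using cut_set_mono[OF C0] f C0 unfolding C'_def ptrans_def cut_set_def by auto
  have "len (f ` (B \<inter> {0..<1})) = len (B \<inter> {0..<1})"
  proof (rule simple_initial_induct[OF C'(1), where t0 = 1 and P = "\<lambda>t. len (f ` (B \<inter> {0..<t})) = len (B \<inter> {0..<t})"])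
    fix c t assume *: "0 \<le> c" "c < t" "t \<le> 1" "B \<inter> {c..<t} = {} \<or> B \<inter> {c..<t} = {c..<t}"
      "len (f ` (B \<inter> {0..<c})) = len (B \<inter> {0..<c})" "{c<..<t} \<inter> C' = {}"
    have eq: "B \<inter> {0..<t} = B \<inter> {0..<c} \<union> B \<inter> {c..<t}" using *(1,2) by auto
    have s: "simple (B \<inter> {0..<c})" "simple (B \<inter> {c..<t})"
      using *(1,2,3) by (intro simple_Int simple_interval B; simp)+
    have "f ` (B \<inter> {0..<c}) \<inter> f ` (B \<inter> {c..<t}) = f ` ((B \<inter> {0..<c}) \<inter> (B \<inter> {c..<t}))"
      using inj_on_image_Int[OF ptrans_inj[OF f]] simple_sub[OF B] by (metis inf.coboundedI1)
    also have "\<dots> = {}" by auto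
    finally have "len (f ` (B \<inter> {0..<t})) = len (f ` (B \<inter> {0..<c})) + len (f ` (B \<inter> {c..<t}))"
      unfolding eq image_Un by (intro len_Un S s)
    moreover have "len (B \<inter> {0..<t}) = len (B \<inter> {0..<c}) + len (B \<inter> {c..<t})"
      unfolding eq by (rule len_Un) (use s in auto)
    moreover have "len (f ` (B \<inter> {c..<t})) = len (B \<inter> {c..<t})"
      using *(4)
    proof
      assume a: "B \<inter> {c..<t} = {c..<t}"
      have tr: "f x = f c + (x - c)" if "c \<le> x" "x < t" for x
      proof (cases "x = c")
        case False
        have "{c<..x} \<inter> C = {}" using gap_sub[OF *(6) that(2)] C'(2) by blast
        then show ?thesis using ptransD[OF f *(1), of x] False that *(3) by auto
      qed simp
      have "f ` {c..<t} = (\<lambda>x. (f c - c) + x) ` {c..<t}"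
      proof (rule image_cong[OF refl])
        fix x assume "x \<in> {c..<t}"
        then have "f x = f c + (x - c)" using tr[of x] by auto
        then show "f x = f c - c + x" by simp
      qed
      also have "\<dots> = {f c..<f c + (t - c)}" unfolding image_add_atLeastLessThan by (simp add: algebra_simps)
      finally show ?thesis using a *(2) by simp
    qed simp
    ultimately show "len (f ` (B \<inter> {0..<t})) = len (B \<inter> {0..<t})" using *(5) by linarith
  qed auto
  moreover have "B \<inter> {0..<1} = B" using simple_sub B by blast
  ultimately show ?thesis using S B by simp
qed

section \<open>Finitely generated groups of real numbers\<close>

definition zspan :: "real set \<Rightarrow> real set" where
  "zspan A = {(\<Sum>a\<in>A. of_int (k a) * a) | k. True}"

lemma zspan_0: "0 \<in> zspan A"
  unfolding zspan_def by (auto intro!: exI[of _ "\<lambda>_. 0"])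

lemma zspan_add: "x \<in> zspan A \<Longrightarrow> y \<in> zspan A \<Longrightarrow> x + y \<in> zspan A"
proof -
  assume "x \<in> zspan A" "y \<in> zspan A"
  then obtain k l where "x = (\<Sum>a\<in>A. of_int (k a) * a)" "y = (\<Sum>a\<in>A. of_int (l a) * a)"
    unfolding zspan_def by auto
  then have "x + y = (\<Sum>a\<in>A. of_int (k a + l a) * a)" by (simp add: sum.distrib distrib_right)
  then show ?thesis unfolding zspan_def by (intro CollectI exI[of _ "\<lambda>a. k a + l a"]) simp
qed

lemma zspan_neg: "x \<in> zspan A \<Longrightarrow> - x \<in> zspan A"
proof -
  assume "x \<in> zspan A"
  then obtain k where "x = (\<Sum>a\<in>A. of_int (k a) * a)" unfolding zspan_def by auto
  then have "- x = (\<Sum>a\<in>A. of_int (- k a) * a)" by (simp add: sum_negf)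
  then show ?thesis unfolding zspan_def by (intro CollectI exI[of _ "\<lambda>a. - k a"]) simp
qed

lemma zspan_superset: "finite A \<Longrightarrow> A \<subseteq> zspan A"
proof
  fix x assume "finite A" "x \<in> A"
  then have "x = (\<Sum>a\<in>A. of_int (if a = x then 1 else 0) * a)"
    by (simp add: if_distrib[of of_int] if_distrib[of "\<lambda>z. z * _"] sum.delta cong: if_cong)
  then show "x \<in> zspan A" unfolding zspan_def by (intro CollectI exI[of _ "\<lambda>a. if a = x then 1 else 0"]) simp
qed

text \<open>A rational-linear functional with value \<open>1\<close> at \<open>x\<close> maps the span into \<open>(1/d) \<int>\<close>,
  where \<open>d\<close> is a common denominator of its values on the generators.\<close>

lemma zspan_denominators:
  assumes "finite A" "x \<noteq> 0"
  obtains d :: nat where "d > 0" "\<And>q::rat. of_rat q * x \<in> zspan A \<Longrightarrow> of_nat d * q \<in> \<int>"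
proof -
  interpret V: vector_space "\<lambda>(q::rat) (r::real). of_rat q * r"
    by unfold_locales (simp_all add: algebra_simps of_rat_add of_rat_mult)
  interpret W: vector_space "(*) :: rat \<Rightarrow> rat \<Rightarrow> rat"
    by unfold_locales (simp_all add: algebra_simps)
  interpret VW: vector_space_pair "\<lambda>(q::rat) (r::real). of_rat q * r" "(*) :: rat \<Rightarrow> rat \<Rightarrow> rat" ..
  have "V.independent {x}" using assms(2) by simp
  then obtain f where f: "Vector_Spaces.linear (\<lambda>(q::rat) (r::real). of_rat q * r) (*) f" "f x = 1"
    using VW.linear_independent_extend[of "{x}" "\<lambda>_. 1"] by auto
  interpret f: Vector_Spaces.linear "\<lambda>(q::rat) (r::real). of_rat q * r" "(*)" f using f(1) .
  define d where "d = (\<Prod>a\<in>A. nat (snd (quotient_of (f a))))"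
  have dpos: "d > 0" unfolding d_def using assms quotient_of_denom_pos' by (auto simp: prod_pos)
  have dint: "of_nat d * f a \<in> \<int>" if "a \<in> A" for a
  proof -
    define q where "q = quotient_of (f a)"
    have q: "f a = of_int (fst q) / of_int (snd q)" "snd q > 0" unfolding q_def
      using quotient_of_div[of "f a"] quotient_of_denom_pos' by (metis prod.collapse, blast)
    have "d = nat (snd q) * (\<Prod>a\<in>A - {a}. nat (snd (quotient_of (f a))))"
      unfolding d_def q_def using assms that by (simp add: prod.remove)
    then have "of_nat d * f a = of_int (fst q) * of_nat (\<Prod>a\<in>A - {a}. nat (snd (quotient_of (f a))))"
      using q by (simp add: field_simps)
    then show ?thesis by (metis Ints_mult Ints_of_int Ints_of_nat)
  qed
  show ?thesis
  proof
    show "d > 0" by fact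
    fix q :: rat assume "of_rat q * x \<in> zspan A"
    then obtain k where k: "of_rat q * x = (\<Sum>a\<in>A. of_rat (of_int (k a)) * a)" unfolding zspan_def by auto
    have "q = f (of_rat q * x)" using f.scale[of q x] f(2) by simp
    also have "\<dots> = (\<Sum>a\<in>A. of_int (k a) * f a)" unfolding k f.sum f.scale ..
    finally have "of_nat d * q = (\<Sum>a\<in>A. of_int (k a) * (of_nat d * f a))"
      by (simp add: sum_distrib_left algebra_simps)
    also have "\<dots> \<in> \<int>" by (rule Ints_sum) (rule Ints_mult[OF Ints_of_int dint])
    finally show "of_nat d * q \<in> \<int>" .
  qed
qed

section \<open>Invariant ideals\<close>

text \<open>Each property is required for all smaller values as well, so a minimum over
  \<open>P\<close> works.\<close>

lemma uniform_eps:
  assumes "finite P" "\<And>p. p \<in> P \<Longrightarrow> \<exists>e>0. \<forall>e'. 0 < e' \<longrightarrow> e' \<le> e \<longrightarrow> Q p (e'::real)"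
  obtains e where "e > 0" "\<And>p e'. p \<in> P \<Longrightarrow> 0 < e' \<Longrightarrow> e' \<le> e \<Longrightarrow> Q p e'"
proof -
  have "\<exists>e>0. \<forall>p\<in>P. \<forall>e'. 0 < e' \<longrightarrow> e' \<le> e \<longrightarrow> Q p e'"
    using assms
  proof (induction P rule: finite_induct)
    case (insert p P)
    then obtain e where e: "e > 0" "\<forall>p\<in>P. \<forall>e'. 0 < e' \<longrightarrow> e' \<le> e \<longrightarrow> Q p e'" by auto
    obtain e2 where e2: "e2 > 0" "\<forall>e'. 0 < e' \<longrightarrow> e' \<le> e2 \<longrightarrow> Q p e'" using insert by blast
    show ?case by (rule exI[of _ "min e e2"]) (use e e2 in auto)
  qed (auto intro: exI[of _ 1])
  then show ?thesis using that by blast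
qed

lemma finite_separated:
  assumes "l > 0" "A \<subseteq> {0..1::real}" "\<And>a a'. a \<in> A \<Longrightarrow> a' \<in> A \<Longrightarrow> a < a' \<Longrightarrow> a + l \<le> a'"
  shows "finite A"
proof (rule inj_on_finite[where f = "\<lambda>a. \<lfloor>a / l\<rfloor>" and B = "{0..\<lfloor>1 / l\<rfloor>}"])
  have "\<lfloor>a / l\<rfloor> < \<lfloor>a' / l\<rfloor>" if "a \<in> A" "a' \<in> A" "a < a'" for a a'
  proof -
    have "(a + l) / l \<le> a' / l" using assms(1) assms(3)[OF that] by (intro divide_right_mono) auto
    then have "a / l + 1 \<le> a' / l" using assms(1) by (simp add: add_divide_distrib)
    then show ?thesis by linarith
  qed
  then show "inj_on (\<lambda>a. \<lfloor>a / l\<rfloor>) A" by (intro inj_onI) (metis less_irrefl linorder_neqE)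
  show "(\<lambda>a. \<lfloor>a / l\<rfloor>) ` A \<subseteq> {0..\<lfloor>1 / l\<rfloor>}"
  proof
    fix z assume "z \<in> (\<lambda>a. \<lfloor>a / l\<rfloor>) ` A"
    then obtain a where a: "a \<in> A" "z = \<lfloor>a / l\<rfloor>" by blast
    then have "0 \<le> a / l" "a / l \<le> 1 / l" using assms(1,2) by (auto intro!: divide_right_mono divide_nonneg_pos)
    then show "z \<in> {0..\<lfloor>1 / l\<rfloor>}" unfolding a(2) by (auto intro: floor_mono)
  qed
qed simp

lemma Ico_subset_unit: "{a..<b} \<subseteq> {0..<1} \<Longrightarrow> a < b \<Longrightarrow> 0 \<le> a \<and> b \<le> (1::real)"
proof -
  assume *: "{a..<b} \<subseteq> {0..<1}" "a < b"
  have "a \<in> {0..<1}" using * by auto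
  moreover have "\<not> 1 < b"
  proof
    assume "1 < b"
    then have "max a 1 \<in> {a..<b}" using * by auto
    then show False using *(1) by fastforce
  qed
  ultimately show ?thesis by auto
qed

lemma finite_gap:
  assumes "finite (C::real set)" "x \<notin> C"
  obtains e where "e > 0" "{x - e..x + e} \<inter> C = {}"
proof -
  obtain d where d: "d > 0" "\<forall>y\<in>C. y \<noteq> x \<longrightarrow> d \<le> dist x y" using finite_set_avoid[OF assms(1), of x] by auto
  have "y \<notin> C" if "y \<in> {x - d / 2..x + d / 2}" for y
    using d that assms(2) by (force simp: dist_real_def)
  then show ?thesis using that[of "d / 2"] d(1) by (metis disjoint_iff half_gt_zero)
qed

text \<open>\<open>D\<close> is a common cut set of all generators, and \<open>zspan A\<close>
  contains the cut points and the displacements. Elements are sums over \<open>S\<close> without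
  inverses, which suits induction over words; in the application \<open>S\<close> is closed under
  inverses.\<close>

locale iet_tree_group = tree_group T G \<tau>
  for T :: "'a list set" and G :: "'g::group_add set" and \<tau> +
  fixes \<Phi> :: "'g \<Rightarrow> real \<Rightarrow> real" and S :: "'g set" and D A :: "real set"
  assumes S_G: "S \<subseteq> G"
    and generated: "g \<in> G \<Longrightarrow> \<exists>ss. set ss \<subseteq> S \<and> g = sum_list ss"
    and Phi_add: "g \<in> G \<Longrightarrow> h \<in> G \<Longrightarrow> x \<in> {0..<1} \<Longrightarrow> \<Phi> (g + h) x = \<Phi> g (\<Phi> h x)"
    and Phi_0: "x \<in> {0..<1} \<Longrightarrow> \<Phi> 0 x = x"
    and Phi_faithful: "g \<in> G \<Longrightarrow> (\<And>x. x \<in> {0..<1} \<Longrightarrow> \<Phi> g x = x) \<Longrightarrow> g = 0"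
    and finite_A: "finite A" and one_M: "1 \<in> zspan A"
    and D_M: "D \<subseteq> zspan A" and finite_D: "finite D"
    and ptrans_S: "s \<in> S \<Longrightarrow> ptrans D (\<Phi> s)"
    and disp_S: "s \<in> S \<Longrightarrow> x \<in> {0..<1} \<Longrightarrow> \<Phi> s x - x \<in> zspan A"
begin

abbreviation X :: "real set" where "X \<equiv> {0..<1}"
abbreviation M :: "real set" where "M \<equiv> zspan A"

lemma G_induct [consumes 1, case_names zero step]:
  assumes "g \<in> G" "P 0" "\<And>s g. s \<in> S \<Longrightarrow> g \<in> G \<Longrightarrow> P g \<Longrightarrow> P (s + g)"
  shows "P g"
proof -
  obtain ss where ss: "set ss \<subseteq> S" "g = sum_list ss" using generated[OF assms(1)] by blast
  have "sum_list ss \<in> G \<and> P (sum_list ss)"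
    using ss(1) by (induction ss) (use zero_G assms add_G S_G in auto)
  then show ?thesis using ss by simp
qed

text \<open>A new cut point \<open>x\<close> of \<open>s + g\<close> satisfies
  \<open>\<Phi> g x \<in> D\<close>; as \<open>D\<close> and the displacement of \<open>g\<close> at
  \<open>x\<close> lie in \<open>M\<close>, so does \<open>x\<close>.\<close>

lemma G_ptrans: "g \<in> G \<Longrightarrow> \<exists>C. C \<subseteq> M \<and> ptrans C (\<Phi> g) \<and> (\<forall>x\<in>X. \<Phi> g x - x \<in> M)"
proof (induction rule: G_induct)
  case zero
  have "bij_betw (\<Phi> 0) X X" using bij_betw_cong[of X "\<Phi> 0" id X] Phi_0 by (simp add: bij_betw_id)
  then have "ptrans {} (\<Phi> 0)" unfolding ptrans_def using Phi_0 by auto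
  then show ?case using zspan_0 Phi_0 by (intro exI[of _ "{}"]) auto
next
  case (step s g)
  then obtain C where C: "C \<subseteq> M" "ptrans C (\<Phi> g)" "\<forall>x\<in>X. \<Phi> g x - x \<in> M" by blast
  have sG: "s \<in> G" using step S_G by blast
  have eq: "\<Phi> (s + g) x = \<Phi> s (\<Phi> g x)" if "x \<in> X" for x using Phi_add sG step that by blast
  define C' where "C' = C \<union> {x \<in> X. \<Phi> g x \<in> D}"
  have p: "ptrans C' (\<lambda>x. \<Phi> s (\<Phi> g x))" unfolding C'_def by (rule ptrans_comp[OF C(2) ptrans_S[OF step(1)]])
  have "bij_betw (\<Phi> (s + g)) X X"
    using p bij_betw_cong[of X "\<Phi> (s + g)" "\<lambda>x. \<Phi> s (\<Phi> g x)" X] eq unfolding ptrans_def by blast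
  then have "ptrans C' (\<Phi> (s + g))" using p eq unfolding ptrans_def by auto
  moreover have "C' \<subseteq> M"
  proof -
    have "x \<in> M" if "x \<in> X" "\<Phi> g x \<in> D" for x
    proof -
      have "\<Phi> g x + - (\<Phi> g x - x) \<in> M" by (intro zspan_add zspan_neg) (use C that D_M in blast)+
      then show ?thesis by simp
    qed
    then show ?thesis using C unfolding C'_def by auto
  qed
  moreover have "\<Phi> (s + g) x - x \<in> M" if "x \<in> X" for x
  proof -
    have "(\<Phi> s (\<Phi> g x) - \<Phi> g x) + (\<Phi> g x - x) \<in> M"
      by (rule zspan_add[OF disp_S[OF step(1) ptrans_in[OF C(2) that]] C(3)[rule_format, OF that]])
    then show ?thesis using eq that by simp
  qed
  ultimately show ?case by blast
qed

lemma Phi_in: "g \<in> G \<Longrightarrow> x \<in> X \<Longrightarrow> \<Phi> g x \<in> X"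
  using G_ptrans ptrans_in by blast

lemma Phi_neg_Phi [simp]: "g \<in> G \<Longrightarrow> x \<in> X \<Longrightarrow> \<Phi> (- g) (\<Phi> g x) = x"
  using Phi_add[of "- g" g x] Phi_0[of x] neg_G by simp

lemma Phi_Phi_neg [simp]: "g \<in> G \<Longrightarrow> x \<in> X \<Longrightarrow> \<Phi> g (\<Phi> (- g) x) = x"
  using Phi_neg_Phi[of "- g"] neg_G by simp

lemma disp_G: "g \<in> G \<Longrightarrow> x \<in> X \<Longrightarrow> \<Phi> g x - x \<in> M"
  using G_ptrans by blast

lemma Phi_inj: "g \<in> G \<Longrightarrow> inj_on (\<Phi> g) X"
  using G_ptrans ptrans_inj by blast

lemma simple_len_image: "g \<in> G \<Longrightarrow> simple B \<Longrightarrow> simple (\<Phi> g ` B) \<and> len (\<Phi> g ` B) = len B"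
proof -
  assume g: "g \<in> G" and B: "simple B"
  obtain C where C: "ptrans C (\<Phi> g)" using G_ptrans g by blast
  obtain E where E: "ptrans E (\<Phi> (- g))" using G_ptrans g neg_G by blast
  show ?thesis by (rule len_ptrans[OF C E _ B]) (use g in simp)
qed

lemma simple_image: "g \<in> G \<Longrightarrow> simple B \<Longrightarrow> simple (\<Phi> g ` B)"
  using simple_len_image by blast

lemma image_neg: "g \<in> G \<Longrightarrow> B \<subseteq> X \<Longrightarrow> \<Phi> (- g) ` (\<Phi> g ` B) = B"
proof -
  assume g: "g \<in> G" "B \<subseteq> X"
  have "\<Phi> (- g) ` (\<Phi> g ` B) = (\<lambda>x. x) ` B" unfolding image_image by (rule image_cong) (use g in auto)
  then show ?thesis by simp
qed

text \<open>Eventual validity along the tree. Ignoring finitely many levels is what lets a property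
  pass back from all descendants at one level to the vertex, as the gluing clause of an ideal
  requires.\<close>

definition ev :: "('a list \<Rightarrow> bool) \<Rightarrow> 'a list \<Rightarrow> bool" where
  "ev P v \<longleftrightarrow> (\<exists>n. \<forall>w\<in>T. prefix v w \<longrightarrow> n \<le> length w \<longrightarrow> P w)"

lemma ev_conj: "ev P v \<Longrightarrow> ev Q v \<Longrightarrow> (\<And>w. w \<in> T \<Longrightarrow> P w \<Longrightarrow> Q w \<Longrightarrow> R w) \<Longrightarrow> ev R v"
  unfolding ev_def by (metis max.bounded_iff)

lemma ev_mono: "ev P v \<Longrightarrow> (\<And>w. w \<in> T \<Longrightarrow> P w \<Longrightarrow> R w) \<Longrightarrow> ev R v"
  unfolding ev_def by blast

lemma ev_prefix: "ev P v \<Longrightarrow> prefix v w \<Longrightarrow> ev P w"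
  unfolding ev_def by (meson prefix_order.trans)

lemma ev_glue:
  assumes "\<And>w. w \<in> T \<Longrightarrow> prefix v w \<Longrightarrow> length w = n \<Longrightarrow> ev P w" "length v \<le> n"
  shows "ev P v"
proof -
  define L where "L = {w \<in> T. prefix v w \<and> length w = n}"
  have "finite L" by (rule finite_subset[OF _ finite_level[of n]]) (auto simp: L_def)
  have "\<forall>w\<in>L. \<exists>m. \<forall>x\<in>T. prefix w x \<longrightarrow> m \<le> length x \<longrightarrow> P x"
    using assms unfolding L_def ev_def by auto
  then obtain m where m: "\<And>w x. w \<in> L \<Longrightarrow> x \<in> T \<Longrightarrow> prefix w x \<Longrightarrow> m w \<le> length x \<Longrightarrow> P x" by metis
  have "P x" if x: "x \<in> T" "prefix v x" "max n (Max (insert 0 (m ` L))) \<le> length x" for x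
  proof -
    have w: "take n x \<in> L" unfolding L_def using x assms(2) prefix_T[OF x(1) take_is_prefix]
      by (auto intro: prefix_length_prefix[OF x(2) take_is_prefix])
    have "m (take n x) \<le> Max (insert 0 (m ` L))" using w \<open>finite L\<close> by (intro Max_ge) auto
    then show ?thesis using m[OF w x(1) take_is_prefix] x by simp
  qed
  then show ?thesis unfolding ev_def by blast
qed

lemma ev_act:
  assumes "ev P v" "g \<in> G" "v \<in> T" "\<And>w. w \<in> T \<Longrightarrow> P w \<Longrightarrow> Q (\<tau> g w)"
  shows "ev Q (\<tau> g v)"
proof -
  obtain n where n: "\<And>w. w \<in> T \<Longrightarrow> prefix v w \<Longrightarrow> n \<le> length w \<Longrightarrow> P w" using assms(1) unfolding ev_def by blast
  have "Q w" if w: "w \<in> T" "prefix (\<tau> g v) w" "n \<le> length w" for w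
  proof -
    have u: "\<tau> (- g) w \<in> T" "length (\<tau> (- g) w) = length w" "\<tau> g (\<tau> (- g) w) = w"
      using w assms(2) neg_G act_T act_length by auto
    have "prefix v (\<tau> (- g) w)" using act_prefix_iff[of g v "\<tau> (- g) w"] u w assms by simp
    then show ?thesis using n[OF u(1)] u w assms(4)[OF u(1)] by simp
  qed
  then show ?thesis unfolding ev_def by blast
qed

text \<open>A pair \<open>(B, v)\<close> stands for the product of \<open>B\<close> with the cylinder of ends of \<open>T\<close> below \<open>v\<close>,
  and an ideal for an invariant open subset of the product space. The sixth clause says that this
  cylinder is the union of the cylinders of the descendants of \<open>v\<close> at level \<open>n\<close>.\<close>

definition ideal :: "(real set \<times> 'a list) set \<Rightarrow> bool" where
  "ideal I \<longleftrightarrow>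
     (\<forall>B v. (B, v) \<in> I \<longrightarrow> simple B \<and> v \<in> T) \<and>
     (\<forall>v\<in>T. ({}, v) \<in> I) \<and>
     (\<forall>B B' v. (B, v) \<in> I \<longrightarrow> B' \<subseteq> B \<longrightarrow> simple B' \<longrightarrow> (B', v) \<in> I) \<and>
     (\<forall>B B' v. (B, v) \<in> I \<longrightarrow> (B', v) \<in> I \<longrightarrow> (B \<union> B', v) \<in> I) \<and>
     (\<forall>B v w. (B, v) \<in> I \<longrightarrow> w \<in> T \<longrightarrow> prefix v w \<longrightarrow> (B, w) \<in> I) \<and>
     (\<forall>B v n. simple B \<longrightarrow> v \<in> T \<longrightarrow> length v \<le> n \<longrightarrow>
        (\<forall>w\<in>T. prefix v w \<longrightarrow> length w = n \<longrightarrow> (B, w) \<in> I) \<longrightarrow> (B, v) \<in> I) \<and>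
     (\<forall>B v g. (B, v) \<in> I \<longrightarrow> g \<in> G \<longrightarrow> (\<Phi> g ` B, \<tau> g v) \<in> I)"

lemma idealD:
  assumes "ideal I"
  shows ideal_simple: "(B, v) \<in> I \<Longrightarrow> simple B" and ideal_T: "(B, v) \<in> I \<Longrightarrow> v \<in> T"
    and ideal_empty: "v \<in> T \<Longrightarrow> ({}, v) \<in> I"
    and ideal_down: "(B, v) \<in> I \<Longrightarrow> B' \<subseteq> B \<Longrightarrow> simple B' \<Longrightarrow> (B', v) \<in> I"
    and ideal_Un: "(B, v) \<in> I \<Longrightarrow> (B', v) \<in> I \<Longrightarrow> (B \<union> B', v) \<in> I"
    and ideal_prefix: "(B, v) \<in> I \<Longrightarrow> w \<in> T \<Longrightarrow> prefix v w \<Longrightarrow> (B, w) \<in> I"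
    and ideal_glue: "simple B \<Longrightarrow> v \<in> T \<Longrightarrow> length v \<le> n \<Longrightarrow>
        (\<And>w. w \<in> T \<Longrightarrow> prefix v w \<Longrightarrow> length w = n \<Longrightarrow> (B, w) \<in> I) \<Longrightarrow> (B, v) \<in> I"
    and ideal_act: "(B, v) \<in> I \<Longrightarrow> g \<in> G \<Longrightarrow> (\<Phi> g ` B, \<tau> g v) \<in> I"
  using assms unfolding ideal_def by blast+

lemma ideal_UN:
  assumes "ideal I" "finite K" "v \<in> T" "\<And>k. k \<in> K \<Longrightarrow> (F k, v) \<in> I"
  shows "((\<Union>k\<in>K. F k), v) \<in> I"
  using assms(2,4) by (induction K rule: finite_induct) (auto intro: ideal_Un ideal_empty assms)

text \<open>Trivial action of \<open>rist''\<close> is demanded only at deep descendants; demanding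
  it at \<open>v\<close> itself need not be compatible with gluing.\<close>

definition nul :: "(real set \<times> 'a list) set" where
  "nul = {(B, v). simple B \<and> v \<in> T \<and> ev (\<lambda>w. \<forall>r\<in>rist'' w. \<forall>x\<in>B. \<Phi> r x = x) v}"

lemma rist''_G: "r \<in> rist'' v \<Longrightarrow> r \<in> G"
  using rist''_rist rist_G by blast

lemma Phi_conj_fix:
  assumes "g \<in> G" "r \<in> G" "x \<in> X" "\<Phi> (- g + r + g) x = x"
  shows "\<Phi> r (\<Phi> g x) = \<Phi> g x"
proof -
  have "\<Phi> (- g + r + g) x = \<Phi> (- g) (\<Phi> r (\<Phi> g x))"
    using assms neg_G add_G Phi_in Phi_add by simp
  then have "\<Phi> g (\<Phi> (- g) (\<Phi> r (\<Phi> g x))) = \<Phi> g x" using assms by simp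
  then show ?thesis using assms Phi_in by simp
qed

lemma rist''_conj':
  assumes "r \<in> rist'' (\<tau> g w)" "g \<in> G" "w \<in> T"
  shows "- g + r + g \<in> rist'' w"
proof -
  have "- g + r - - g \<in> rist'' (\<tau> (- g) (\<tau> g w))" by (rule rist''_conj) (use assms neg_G act_T in auto)
  then show ?thesis using assms(2,3) by (simp only: diff_minus_eq_add act_neg_act)
qed

lemma nul_ideal: "ideal nul"
  unfolding ideal_def
proof (intro conjI allI impI ballI)
  fix B v assume "(B, v) \<in> nul" then show "simple B" "v \<in> T" unfolding nul_def by auto
next
  fix v assume "v \<in> T" then show "({}, v) \<in> nul" unfolding nul_def ev_def by auto
next
  fix B B' v assume "(B, v) \<in> nul" "B' \<subseteq> B" "simple B'"
  then show "(B', v) \<in> nul" unfolding nul_def by (auto elim!: ev_mono)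
next
  fix B B' v assume "(B, v) \<in> nul" "(B', v) \<in> nul"
  then have B: "simple B" "simple B'" "v \<in> T" "ev (\<lambda>w. \<forall>r\<in>rist'' w. \<forall>x\<in>B. \<Phi> r x = x) v"
    "ev (\<lambda>w. \<forall>r\<in>rist'' w. \<forall>x\<in>B'. \<Phi> r x = x) v" unfolding nul_def by auto
  have "ev (\<lambda>w. \<forall>r\<in>rist'' w. \<forall>x\<in>B \<union> B'. \<Phi> r x = x) v" by (rule ev_conj[OF B(4,5)]) blast
  then show "(B \<union> B', v) \<in> nul" unfolding nul_def using simple_Un[OF B(1,2)] B(3) by simp
next
  fix B v w assume "(B, v) \<in> nul" "w \<in> T" "prefix v w"
  then show "(B, w) \<in> nul" unfolding nul_def using ev_prefix by auto
next
  fix B v n assume "simple B" "v \<in> T" "length v \<le> n" "\<forall>w\<in>T. prefix v w \<longrightarrow> length w = n \<longrightarrow> (B, w) \<in> nul"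
  then show "(B, v) \<in> nul" unfolding nul_def using ev_glue[of v n] by auto
next
  fix B v g assume a: "(B, v) \<in> nul" and g: "g \<in> G"
  have B: "simple B" "v \<in> T" "ev (\<lambda>w. \<forall>r\<in>rist'' w. \<forall>x\<in>B. \<Phi> r x = x) v" using a unfolding nul_def by auto
  have "ev (\<lambda>w. \<forall>r\<in>rist'' w. \<forall>x\<in>\<Phi> g ` B. \<Phi> r x = x) (\<tau> g v)"
  proof (rule ev_act[OF B(3) g B(2)], intro ballI)
    fix w r x assume w: "w \<in> T" "\<forall>r\<in>rist'' w. \<forall>x\<in>B. \<Phi> r x = x" "r \<in> rist'' (\<tau> g w)" "x \<in> \<Phi> g ` B"
    then obtain y where y: "y \<in> B" "x = \<Phi> g y" by blast
    have "\<Phi> (- g + r + g) y = y" using rist''_conj'[OF w(3) g w(1)] w(2) y by blast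
    then show "\<Phi> r x = x" unfolding y(2)
      by (intro Phi_conj_fix) (use g w rist''_G y simple_sub[OF B(1)] in auto)
  qed
  then show "(\<Phi> g ` B, \<tau> g v) \<in> nul" unfolding nul_def using B g simple_image act_T by auto
qed

text \<open>Otherwise a non-trivial element of some \<open>rist'' w\<close> would act trivially on
  the whole circle, against faithfulness.\<close>

lemma nul_proper: "(X, []) \<notin> nul"
proof
  assume "(X, []) \<in> nul"
  then obtain n where n: "\<And>w. w \<in> T \<Longrightarrow> n \<le> length w \<Longrightarrow> \<forall>r\<in>rist'' w. \<forall>x\<in>X. \<Phi> r x = x"
    unfolding nul_def ev_def by auto
  obtain w where w: "w \<in> T" "length w = n" using extend_below[OF Nil_T, of n] by auto
  obtain c where "c \<in> rist'' w" "c \<noteq> 0" using rist''_nontrivial w by blast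
  then show False using n[OF w(1)] w Phi_faithful rist''_G by blast
qed

text \<open>The subgroup fixing each of the finitely many intervals has finite index, hence contains the
  commutators of some rigid stabilizer.\<close>

lemma finite_orbit_nul:
  assumes P: "finite P" "e > 0"
    and PX: "\<And>p. p \<in> P \<Longrightarrow> 0 \<le> p \<and> p + e \<le> 1"
    and PS: "\<And>s p t. s \<in> S \<Longrightarrow> p \<in> P \<Longrightarrow> \<Phi> s p \<in> P \<and> (p \<le> t \<longrightarrow> t < p + e \<longrightarrow> \<Phi> s t = \<Phi> s p + (t - p))"
    and p: "p \<in> P" "v \<in> T"
  shows "({p..<p + e}, v) \<in> nul"
proof -
  have inX: "t \<in> X" if "q \<in> P" "q \<le> t" "t < q + e" for q t using PX[OF that(1)] that by auto
  \<comment> \<open>By induction over words, the whole group translates the intervals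
    \<open>[q, q + e)\<close> among themselves.\<close>
  have PG: "\<forall>q\<in>P. \<Phi> g q \<in> P \<and> (\<forall>t. q \<le> t \<longrightarrow> t < q + e \<longrightarrow> \<Phi> g t = \<Phi> g q + (t - q))" if "g \<in> G" for g
    using that
  proof (induction rule: G_induct)
    case zero
    have "\<Phi> 0 t = t" if "q \<in> P" "q \<le> t" "t < q + e" for q t using Phi_0 inX[OF that] by blast
    then show ?case using P(2) by simp
  next
    case (step s g)
    show ?case
    proof (intro ballI conjI allI impI)
      fix q assume q: "q \<in> P"
      have sG: "s \<in> G" using step S_G by blast
      have ad: "\<Phi> (s + g) t = \<Phi> s (\<Phi> g t)" if "q \<le> t" "t < q + e" for t
        using Phi_add sG step inX[OF q that] by blast
      have gq: "\<Phi> g q \<in> P" using step q by blast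
      have adq: "\<Phi> (s + g) q = \<Phi> s (\<Phi> g q)" by (rule ad) (use P in auto)
      show "\<Phi> (s + g) q \<in> P" unfolding adq using PS[OF step(1) gq] by blast
      fix t assume t: "q \<le> t" "t < q + e"
      then have gt: "\<Phi> g t = \<Phi> g q + (t - q)" using step q by blast
      then have "\<Phi> s (\<Phi> g t) = \<Phi> s (\<Phi> g q) + (\<Phi> g t - \<Phi> g q)"
        using PS[OF step(1) gq, of "\<Phi> g t"] t by auto
      then show "\<Phi> (s + g) t = \<Phi> (s + g) q + (t - q)" unfolding adq ad[OF t] gt by simp
    qed
  qed
  obtain w where w: "w \<in> T" "prefix v w"
    and wc: "\<And>a b q. a \<in> rist w \<Longrightarrow> b \<in> rist w \<Longrightarrow> q \<in> P \<Longrightarrow> \<Phi> (comm a b) q = q"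
  proof (rule rist_comm_fixes_finite[OF P(1) p(2), of \<Phi>])
    show "\<Phi> g q \<in> P" if "g \<in> G" "q \<in> P" for g q using PG that by blast
    show "\<Phi> (g + h) q = \<Phi> g (\<Phi> h q)" if "g \<in> G" "h \<in> G" "q \<in> P" for g h q
      using Phi_add that inX[of q q] P by auto
    show "\<Phi> 0 q = q" if "q \<in> P" for q using Phi_0 that inX[of q q] P by auto
  qed blast
  have fixw: "\<Phi> r t = t" if r: "r \<in> rist'' w" and q: "q \<in> P" "q \<le> t" "t < q + e" for r q t
  proof -
    obtain a b where "a \<in> rist w" "b \<in> rist w" "r = comm a b"
      using r rist_comm unfolding rist''_def by blast
    then have "\<Phi> r q = q" using wc q by blast
    moreover have "\<Phi> r t = \<Phi> r q + (t - q)" using PG[OF rist''_G[OF r]] q by blast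
    ultimately show ?thesis by simp
  qed
  have "ev (\<lambda>u. \<forall>r\<in>rist'' u. \<forall>t\<in>{p..<p + e}. \<Phi> r t = t) v"
    unfolding ev_def
  proof (intro exI[of _ "length w"] ballI impI)
    fix u r t assume u: "u \<in> T" "length w \<le> length u" and r: "r \<in> rist'' u" and t: "t \<in> {p..<p + e}"
    define u' where "u' = take (length w) u"
    have u': "u' \<in> T" "length u' = length w" "prefix u' u" unfolding u'_def using u prefix_T[OF u(1) take_is_prefix]
      by (auto simp: take_is_prefix)
    \<comment> \<open>So far only commutators at \<open>w\<close> are known to fix \<open>P\<close>.
      At other vertices of the same level, level transitivity reduces to \<open>w\<close> by
      conjugation, and \<open>P\<close> is invariant under the conjugating element.\<close>
    obtain g where g: "g \<in> G" "\<tau> g w = u'" using level_transitive[OF w(1) u'(1)] u' by auto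
    have r': "- g + r + g \<in> rist'' w" using rist''_conj'[of r g w] g w r rist''_mono[OF u'(3)] by blast
    have ng: "- g \<in> G" using g neg_G by blast
    have "p \<le> t" "t < p + e" using t by auto
    then have nt: "\<Phi> (- g) t = \<Phi> (- g) p + (t - p)" "\<Phi> (- g) p \<in> P" using PG[OF ng] p(1) by blast+
    have "\<Phi> (- g + r + g) (\<Phi> (- g) t) = \<Phi> (- g) t"
      by (rule fixw[OF r' nt(2)]) (use nt(1) t in auto)
    moreover have tX: "t \<in> X" using inX[OF p(1)] t by simp
    ultimately have "\<Phi> r (\<Phi> g (\<Phi> (- g) t)) = \<Phi> g (\<Phi> (- g) t)"
      using Phi_conj_fix[OF g(1) rist''_G[OF r] Phi_in[OF ng tX]] by blast
    then show "\<Phi> r t = t" using g(1) tX by simp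
  qed
  moreover have "simple {p..<p + e}" using PX[OF p(1)] by (intro simple_interval) auto
  ultimately show ?thesis unfolding nul_def using p by auto
qed

definition trans_on :: "'g \<Rightarrow> real \<Rightarrow> real \<Rightarrow> real \<Rightarrow> bool" where
  "trans_on g a b d \<longleftrightarrow> g \<in> G \<and> 0 \<le> a \<and> a < b \<and> b \<le> 1 \<and> (\<forall>t. a \<le> t \<longrightarrow> t < b \<longrightarrow> \<Phi> g t = t + d)"

lemma trans_onD: "trans_on g a b d \<Longrightarrow> a \<le> t \<Longrightarrow> t < b \<Longrightarrow> \<Phi> g t = t + d"
  unfolding trans_on_def by blast

lemma trans_on_S:
  assumes "s \<in> S" "0 \<le> a" "a < b" "b \<le> 1" "{a<..<b} \<inter> D = {}" "a \<le> p" "p < b"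
  shows "trans_on s a b (\<Phi> s p - p)"
proof -
  have tr: "\<Phi> s t = \<Phi> s a + (t - a)" if "a \<le> t" "t < b" for t
  proof (cases "t = a")
    case False
    then show ?thesis using ptransD[OF ptrans_S[OF assms(1)] assms(2), of t] that gap_sub[OF assms(5) that(2)] assms by auto
  qed simp
  have "\<Phi> s t = t + (\<Phi> s p - p)" if "a \<le> t" "t < b" for t
    using tr[OF that] tr[OF assms(6,7)] by linarith
  then show ?thesis unfolding trans_on_def using assms S_G by blast
qed

lemma trans_on_bounds:
  assumes "trans_on g a b d" shows "0 \<le> a + d" "b + d \<le> 1"
proof -
  have g: "g \<in> G" "0 \<le> a" "a < b" "b \<le> 1" using assms unfolding trans_on_def by auto
  have "\<Phi> g a \<in> X" by (rule Phi_in) (use g in auto)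
  then show "0 \<le> a + d" using trans_onD[OF assms, of a] g by auto
  show "b + d \<le> 1"
  proof (rule ccontr)
    assume "\<not> b + d \<le> 1"
    then have t: "a \<le> max a (1 - d)" "max a (1 - d) < b" using g by auto
    have "\<Phi> g (max a (1 - d)) \<in> X" by (rule Phi_in) (use g t in auto)
    then show False using trans_onD[OF assms t] by auto
  qed
qed

lemma trans_on_image:
  assumes "trans_on g a b d" "a \<le> x" "y \<le> b"
  shows "\<Phi> g ` {x..<y} = {x + d..<y + d}"
proof -
  have "\<Phi> g ` {x..<y} = (\<lambda>t. t + d) ` {x..<y}"
    by (rule image_cong) (use trans_onD[OF assms(1)] assms(2,3) in auto)
  then show ?thesis by simp
qed

end

section \<open>Components of the region covered by an ideal\<close>

locale invariant_ideal = iet_tree_group +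
  fixes I assumes I: "ideal I" and nulI: "nul \<subseteq> I"
begin

lemma trans_on_mem:
  assumes "trans_on g a b d" "a \<le> x" "y \<le> b" "v \<in> T"
  shows "({x..<y}, v) \<in> I \<longleftrightarrow> ({x + d..<y + d}, \<tau> g v) \<in> I"
proof
  have g: "g \<in> G" "0 \<le> a" "b \<le> 1" using assms unfolding trans_on_def by auto
  note im = trans_on_image[OF assms(1-3)]
  show "({x + d..<y + d}, \<tau> g v) \<in> I" if "({x..<y}, v) \<in> I" using ideal_act[OF I that g(1)] im by simp
  assume "({x + d..<y + d}, \<tau> g v) \<in> I"
  then have "(\<Phi> (- g) ` (\<Phi> g ` {x..<y}), \<tau> (- g) (\<tau> g v)) \<in> I"
    unfolding im using ideal_act[OF I _ neg_G[OF g(1)]] by blast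
  moreover have "\<Phi> (- g) ` (\<Phi> g ` {x..<y}) = {x..<y}" by (rule image_neg[OF g(1)]) (use g assms in auto)
  ultimately show "({x..<y}, v) \<in> I" using g assms by simp
qed

text \<open>Two-sided neighbourhoods make this set open in the real line, so that it has components,
  and exclude the points \<open>0\<close> and \<open>1\<close>.\<close>

definition open_part :: "'a list \<Rightarrow> real set" where
  "open_part v = {x. \<exists>e>0. ({x - e..<x + e}, v) \<in> I}"

lemma Ico_down: "({a..<b}, v) \<in> I \<Longrightarrow> a \<le> c \<Longrightarrow> d \<le> b \<Longrightarrow> ({c..<d}, v) \<in> I"
proof (cases "c < d")
  case True
  assume a: "({a..<b}, v) \<in> I" "a \<le> c" "d \<le> b"
  have "{a..<b} \<subseteq> X" using simple_sub[OF ideal_simple[OF I a(1)]] .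
  moreover have "a < b" using a(2,3) True by linarith
  ultimately have ab: "0 \<le> a" "b \<le> 1" using Ico_subset_unit[of a b] by blast+
  have "{c..<d} \<subseteq> {a..<b}" using a(2,3) by auto
  moreover have "simple {c..<d}" by (rule simple_interval) (use a(2,3) ab in linarith)+
  ultimately show ?thesis using ideal_down[OF I a(1)] by blast
next
  case False
  assume "({a..<b}, v) \<in> I"
  then show ?thesis using False ideal_empty[OF I ideal_T[OF I]] by auto
qed

lemma open_partI: "e > 0 \<Longrightarrow> ({x - e..<x + e}, v) \<in> I \<Longrightarrow> x \<in> open_part v"
  unfolding open_part_def by blast

lemma open_partE: assumes "x \<in> open_part v" obtains e where "e > 0" "({x - e..<x + e}, v) \<in> I"
  using assms unfolding open_part_def by blast

lemma open_part_unit: "open_part v \<subseteq> {0<..<1}"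
proof
  fix x assume "x \<in> open_part v"
  then obtain e where e: "e > 0" "({x - e..<x + e}, v) \<in> I" unfolding open_part_def by blast
  have "{x - e..<x + e} \<subseteq> X" using simple_sub[OF ideal_simple[OF I e(2)]] .
  then have "0 \<le> x - e" "x + e \<le> 1" using Ico_subset_unit[of "x - e" "x + e"] e(1) by auto
  then show "x \<in> {0<..<1}" using e(1) by simp
qed

lemma Ico_open_part: "({a..<b}, v) \<in> I \<Longrightarrow> {a<..<b} \<subseteq> open_part v"
proof
  fix x assume a: "({a..<b}, v) \<in> I" "x \<in> {a<..<b}"
  have "({x - min (x - a) (b - x)..<x + min (x - a) (b - x)}, v) \<in> I" by (rule Ico_down[OF a(1)]) auto
  then show "x \<in> open_part v" by (rule open_partI[rotated]) (use a(2) in simp)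
qed

lemma open_open_part: "open (open_part v)"
proof (subst open_contains_ball, intro ballI)
  fix x assume "x \<in> open_part v"
  then obtain e where e: "e > 0" "({x - e..<x + e}, v) \<in> I" unfolding open_part_def by blast
  have "ball x e = {x - e<..<x + e}" by (auto simp: dist_real_def)
  then show "\<exists>e>0. ball x e \<subseteq> open_part v" using Ico_open_part[OF e(2)] e(1) by auto
qed

lemma open_part_shift:
  assumes "trans_on g a b d" "a < x" "x < b" "v \<in> T"
  shows "x \<in> open_part v \<longleftrightarrow> x + d \<in> open_part (\<tau> g v)"
proof
  define m where "m = min (x - a) (b - x)"
  have m: "m > 0" "\<And>e. e \<le> m \<Longrightarrow> a \<le> x - e \<and> x + e \<le> b" unfolding m_def using assms by auto
  have eq: "({x - e..<x + e}, v) \<in> I \<longleftrightarrow> ({x + d - e..<x + d + e}, \<tau> g v) \<in> I" if "e \<le> m" for e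
    using trans_on_mem[OF assms(1), of "x - e" "x + e" v] m(2)[OF that] assms(4) by (simp add: algebra_simps)
  show "x + d \<in> open_part (\<tau> g v)" if mem: "x \<in> open_part v"
  proof -
    obtain e where e: "e > 0" "({x - e..<x + e}, v) \<in> I" using open_partE[OF mem] .
    have "({x - min e m..<x + min e m}, v) \<in> I" by (rule Ico_down[OF e(2)]) simp_all
    then show ?thesis using eq[of "min e m"] by (intro open_partI[of "min e m"]) (use e(1) m(1) in simp_all)
  qed
  show "x \<in> open_part v" if mem: "x + d \<in> open_part (\<tau> g v)"
  proof -
    obtain e where e: "e > 0" "({x + d - e..<x + d + e}, \<tau> g v) \<in> I" using open_partE[OF mem] .
    have "({x + d - min e m..<x + d + min e m}, \<tau> g v) \<in> I" by (rule Ico_down[OF e(2)]) simp_all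
    then show ?thesis using eq[of "min e m"] by (intro open_partI[of "min e m"]) (use e(1) m(1) in simp_all)
  qed
qed

text \<open>The interval \<open>(a, b)\<close> is a connected component of
  \<open>open_part v\<close>.\<close>

definition maxint :: "'a list \<Rightarrow> real \<Rightarrow> real \<Rightarrow> bool" where
  "maxint v a b \<longleftrightarrow> 0 \<le> a \<and> a < b \<and> b \<le> 1 \<and> {a<..<b} \<subseteq> open_part v \<and> a \<notin> open_part v \<and> b \<notin> open_part v"

lemma right_end:
  assumes "a < b" "b \<le> 1" "{a<..<b} \<subseteq> open_part v"
  obtains c where "b \<le> c" "c \<le> 1" "{a<..<c} \<subseteq> open_part v" "c \<notin> open_part v"
proof -
  define R where "R = {b..1} - open_part v"
  have "1 \<in> R" unfolding R_def using open_part_unit[of v] assms by auto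
  have cl: "closed R" unfolding R_def by (intro closed_Diff open_open_part) auto
  have bd: "bdd_below R" unfolding R_def by (intro bdd_belowI[of _ b]) auto
  define c where "c = Inf R"
  have c: "c \<in> R" unfolding c_def using closed_contains_Inf[OF _ bd cl] \<open>1 \<in> R\<close> by blast
  have "t \<in> open_part v" if "a < t" "t < c" for t
  proof (cases "t < b")
    case False
    have "t \<notin> R" using cInf_lower[OF _ bd, of t] that unfolding c_def by auto
    then show ?thesis using False that c unfolding R_def by auto
  qed (use assms that in auto)
  then have "{a<..<c} \<subseteq> open_part v" by auto
  then show ?thesis using that[of c] c unfolding R_def by simp
qed

lemma left_end:
  assumes "a < b" "0 \<le> a" "{a<..<b} \<subseteq> open_part v"
  obtains c where "c \<le> a" "0 \<le> c" "{c<..<b} \<subseteq> open_part v" "c \<notin> open_part v"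
proof -
  define R where "R = {0..a} - open_part v"
  have "0 \<in> R" unfolding R_def using open_part_unit[of v] assms by auto
  have cl: "closed R" unfolding R_def by (intro closed_Diff open_open_part) auto
  have bd: "bdd_above R" unfolding R_def by (intro bdd_aboveI[of _ a]) auto
  define c where "c = Sup R"
  have c: "c \<in> R" unfolding c_def using closed_contains_Sup[OF _ bd cl] \<open>0 \<in> R\<close> by blast
  have "t \<in> open_part v" if "c < t" "t < b" for t
  proof (cases "t > a")
    case False
    have "t \<notin> R" using cSup_upper[OF _ bd, of t] that unfolding c_def by auto
    then show ?thesis using False that c unfolding R_def by auto
  qed (use assms that in auto)
  then have "{c<..<b} \<subseteq> open_part v" by auto
  then show ?thesis using that[of c] c unfolding R_def by simp
qed

lemma maxint_from_left:
  assumes "0 \<le> a" "a < b" "b \<le> 1" "{a<..<b} \<subseteq> open_part v" "a \<notin> open_part v"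
  obtains c where "maxint v a c"
  using right_end[OF assms(2,3,4)] assms unfolding maxint_def by (metis less_le_trans)

lemma maxint_from_right:
  assumes "0 \<le> a" "a < b" "b \<le> 1" "{a<..<b} \<subseteq> open_part v" "b \<notin> open_part v"
  obtains c where "maxint v c b"
  using left_end[OF assms(2,1,4)] assms unfolding maxint_def by (metis le_less_trans)

lemma maxint_around:
  assumes "x \<in> open_part v"
  obtains a b where "maxint v a b" "a < x" "x < b"
proof -
  obtain e where e: "e > 0" "({x - e..<x + e}, v) \<in> I" using assms unfolding open_part_def by blast
  have "{x - e..<x + e} \<subseteq> X" using simple_sub[OF ideal_simple[OF I e(2)]] .
  then have e': "0 \<le> x - e" "x + e \<le> 1" using Ico_subset_unit[of "x - e" "x + e"] e(1) by auto
  obtain b where b: "x + e \<le> b" "b \<le> 1" "{x - e<..<b} \<subseteq> open_part v" "b \<notin> open_part v"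
    using right_end[of "x - e" "x + e" v] Ico_open_part[OF e(2)] e e' by auto
  obtain a where "a \<le> x - e" "0 \<le> a" "{a<..<b} \<subseteq> open_part v" "a \<notin> open_part v"
    using left_end[of "x - e" b v] b e e' by auto
  then show ?thesis using that[of a b] b e unfolding maxint_def by auto
qed

lemma maxint_disjoint_left:
  assumes "maxint v a b" "maxint v a' b'" "a < a'" shows "b \<le> a'"
  using assms unfolding maxint_def by (metis greaterThanLessThan_iff not_less subsetD)

lemma maxint_disjoint_right:
  assumes "maxint v a b" "maxint v a' b'" "b < b'" shows "b \<le> a'"
  using assms unfolding maxint_def by (metis greaterThanLessThan_iff not_less subsetD)

lemma maxint_shift:
  assumes "trans_on g a b d" "a < x" "y < b" "maxint v x y" "v \<in> T"
  shows "maxint (\<tau> g v) (x + d) (y + d)"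
proof -
  have xy: "x < y" "{x<..<y} \<subseteq> open_part v" "x \<notin> open_part v" "y \<notin> open_part v" using assms(4) unfolding maxint_def by auto
  have "t \<in> open_part (\<tau> g v)" if "x + d < t" "t < y + d" for t
  proof -
    have "t - d \<in> open_part v" using xy that by auto
    then show ?thesis using open_part_shift[OF assms(1), of "t - d" v] that assms by auto
  qed
  moreover have "x + d \<notin> open_part (\<tau> g v)" "y + d \<notin> open_part (\<tau> g v)"
    using open_part_shift[OF assms(1), of x v] open_part_shift[OF assms(1), of y v] assms xy by auto
  moreover have "0 \<le> x + d" "y + d \<le> 1" using trans_on_bounds[OF assms(1)] assms by auto
  ultimately show ?thesis unfolding maxint_def using xy by auto
qed

text \<open>As \<open>P\<close> avoids \<open>0\<close> and the cut points, there is a uniform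
  margin \<open>e\<close> on both sides on which all generators are translations; the intervals
  \<open>[q - e, q + e)\<close> then fall under \<open>finite_orbit_nul\<close>. In this way finite
  orbits away from the cut points are excluded among the ends of components.\<close>

lemma finite_orbit_open_part:
  assumes P: "finite P" "P \<subseteq> X" "P \<inter> insert 0 D = {}" and PS: "\<And>s p. s \<in> S \<Longrightarrow> p \<in> P \<Longrightarrow> \<Phi> s p \<in> P"
    and p: "p \<in> P" "v \<in> T"
  shows "p \<in> open_part v"
proof -
  have "\<exists>e>0. \<forall>e'. 0 < e' \<longrightarrow> e' \<le> e \<longrightarrow> {q - e'..q + e'} \<inter> (D \<union> {0, 1}) = {}" if q: "q \<in> P" for q
  proof -
    have "q \<notin> D \<union> {0, 1}" using P q by auto
    then obtain e where e: "e > 0" "{q - e..q + e} \<inter> (D \<union> {0, 1}) = {}"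
      using finite_gap[of "D \<union> {0, 1}" q] finite_D by auto
    have "{q - e'..q + e'} \<subseteq> {q - e..q + e}" if "e' \<le> e" for e' using that by auto
    then show ?thesis using e by (intro exI[of _ e]) blast
  qed
  then obtain e where e: "e > 0" "\<And>q. q \<in> P \<Longrightarrow> {q - e..q + e} \<inter> (D \<union> {0, 1}) = {}"
    using uniform_eps[OF P(1), of "\<lambda>q e'. {q - e'..q + e'} \<inter> (D \<union> {0, 1}) = {}"] by (metis order_refl)
  have b: "0 \<le> q - e" "q + e \<le> 1" if "q \<in> P" for q
  proof -
    have "0 \<notin> {q - e..q + e}" "1 \<notin> {q - e..q + e}" using e(2)[OF that] by auto
    then show "0 \<le> q - e" "q + e \<le> 1" using that P(2) e(1) by auto
  qed
  have tr: "trans_on s (q - e) (q + e) (\<Phi> s q - q)" if "s \<in> S" "q \<in> P" for s q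
  proof (rule trans_on_S[OF that(1)])
    have "{q - e<..<q + e} \<subseteq> {q - e..q + e}" by auto
    then show "{q - e<..<q + e} \<inter> D = {}" using e(2)[OF that(2)] by blast
  qed (use b[OF that(2)] e(1) in auto)
  have "({(p - e)..<(p - e) + 2 * e}, v) \<in> nul"
  proof (rule finite_orbit_nul[where P = "(\<lambda>q. q - e) ` P"])
    fix s q' t assume s: "s \<in> S" and "q' \<in> (\<lambda>q. q - e) ` P"
    then obtain q where q: "q \<in> P" "q' = q - e" by blast
    have *: "\<Phi> s (q - e) = \<Phi> s q - e" using trans_onD[OF tr[OF s q(1)], of "q - e"] e(1) by simp
    then have "\<Phi> s q' \<in> (\<lambda>q. q - e) ` P" using q PS[OF s q(1)] by auto
    moreover have "\<Phi> s t = \<Phi> s q' + (t - q')" if "q' \<le> t" "t < q' + 2 * e"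
      using trans_onD[OF tr[OF s q(1)], of t] that q * by simp
    ultimately show "\<Phi> s q' \<in> (\<lambda>q. q - e) ` P \<and> (q' \<le> t \<longrightarrow> t < q' + 2 * e \<longrightarrow> \<Phi> s t = \<Phi> s q' + (t - q'))" by blast
  next
    fix q' assume "q' \<in> (\<lambda>q. q - e) ` P"
    then obtain q where q: "q \<in> P" "q' = q - e" by blast
    then show "0 \<le> q' \<and> q' + 2 * e \<le> 1" using b[OF q(1)] by simp
  qed (use P(1) p e(1) in auto)
  moreover have "(p - e) + 2 * e = p + e" by simp
  ultimately have "({p - e..<p + e}, v) \<in> I" using nulI by (metis subsetD)
  then show ?thesis unfolding open_part_def using e(1) by blast
qed

end

section \<open>Invariant ideals are principal level by level\<close>

context invariant_ideal
begin

text \<open>All vertices of level \<open>n\<close> are taken together because the group permutes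
  them.\<close>

definition boundary :: "nat \<Rightarrow> real set" where
  "boundary n = {x. \<exists>v\<in>T. length v = n \<and> (\<exists>y. maxint v x y \<or> maxint v y x)}"

text \<open>Maximal intervals shorter than the gaps around the cut points stay away from the
  cut points under the whole group, so their endpoints have finite orbits.\<close>

lemma maxint_length_bound:
  obtains e where "e > 0" "\<And>v a b. v \<in> T \<Longrightarrow> length v = n \<Longrightarrow> maxint v a b \<Longrightarrow> a + e \<le> b"
proof -
  define D' where "D' = D \<union> {0, 1}"
  define L where "L = {v \<in> T. length v = n}"
  have fin: "finite D'" "finite L" unfolding D'_def L_def using finite_D finite_level by auto
  \<comment> \<open>For a cut point \<open>d\<close>: if some one-sided interval at \<open>d\<close>
    lies in the open part, so does the one of length \<open>e\<close>. Hence a component whose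
    closure contains \<open>d\<close> has length at least \<open>e\<close>.\<close>
  define Q where "Q p e \<longleftrightarrow> (case p of (d, v) \<Rightarrow>
      ((\<exists>e>0. {d<..<d + e} \<subseteq> open_part v) \<longrightarrow> {d<..<d + e} \<subseteq> open_part v) \<and>
      ((\<exists>e>0. {d - e<..<d} \<subseteq> open_part v) \<longrightarrow> {d - e<..<d} \<subseteq> open_part v))" for p :: "real \<times> 'a list" and e :: real
  have "\<exists>e>0. \<forall>e'. 0 < e' \<longrightarrow> e' \<le> e \<longrightarrow> Q p e'" for p
  proof -
    obtain d v where p: "p = (d, v)" by (cases p)
    obtain e1 where e1: "e1 > 0" "(\<exists>e>0. {d<..<d + e} \<subseteq> open_part v) \<Longrightarrow> {d<..<d + e1} \<subseteq> open_part v"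
      by (metis zero_less_one)
    obtain e2 where e2: "e2 > 0" "(\<exists>e>0. {d - e<..<d} \<subseteq> open_part v) \<Longrightarrow> {d - e2<..<d} \<subseteq> open_part v"
      by (metis zero_less_one)
    have "Q p e'" if "0 < e'" "e' \<le> min e1 e2" for e'
    proof -
      have "{d<..<d + e'} \<subseteq> {d<..<d + e1}" "{d - e'<..<d} \<subseteq> {d - e2<..<d}" using that by auto
      then show ?thesis unfolding Q_def p using e1(2) e2(2) by auto
    qed
    then show ?thesis using e1(1) e2(1) by (intro exI[of _ "min e1 e2"]) auto
  qed
  then obtain e where e: "e > 0" "\<And>p. p \<in> D' \<times> L \<Longrightarrow> Q p e"
    using uniform_eps[of "D' \<times> L" Q] fin by (metis finite_cartesian_product order_refl)
  have away: "{a..b} \<inter> D' = {}" if v: "v \<in> L" and m: "maxint v a b" and short: "b - a < e" for v a b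
  proof (rule ccontr)
    assume "{a..b} \<inter> D' \<noteq> {}"
    then obtain d where d: "d \<in> D'" "a \<le> d" "d \<le> b" by auto
    have q: "Q (d, v) e" using e(2) d v by blast
    have ab: "a < b" "{a<..<b} \<subseteq> open_part v" "a \<notin> open_part v" "b \<notin> open_part v" using m unfolding maxint_def by auto
    show False
    proof (cases "d < b")
      case True
      have "{d<..<d + (b - d)} \<subseteq> open_part v" using ab(2) d by auto
      then have "\<exists>e>0. {d<..<d + e} \<subseteq> open_part v" using True by (intro exI[of _ "b - d"]) auto
      then have "{d<..<d + e} \<subseteq> open_part v" using q unfolding Q_def by simp
      moreover have "b \<in> {d<..<d + e}" using True d short by simp
      ultimately show False using ab(4) by blast
    next
      case False
      then have "d = b" using d by simp
      then have "{d - (b - a)<..<d} \<subseteq> open_part v" using ab(2) by auto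
      then have "\<exists>e>0. {d - e<..<d} \<subseteq> open_part v" using ab(1) by (intro exI[of _ "b - a"]) auto
      then have "{d - e<..<d} \<subseteq> open_part v" using q unfolding Q_def by simp
      moreover have "a \<in> {d - e<..<d}" using ab(1) \<open>d = b\<close> short by simp
      ultimately show False using ab(3) by blast
    qed
  qed
  have "a + e \<le> b" if v: "v \<in> T" "length v = n" and m: "maxint v a b" for v a b
  proof (rule ccontr)
    assume short: "\<not> a + e \<le> b"
    define l where "l = b - a"
    have l: "l > 0" "l < e" using m short unfolding l_def maxint_def by auto
    \<comment> \<open>The left ends of all components of length exactly \<open>l\<close> at level
      \<open>n\<close>: fixing the length makes this set finite, and generators preserve it.\<close>
    define P where "P = (\<Union>u\<in>L. {x. maxint u x (x + l)})"
    have "finite {x. maxint u x (x + l)}" for u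
    proof (rule finite_separated[OF l(1)])
      show "{x. maxint u x (x + l)} \<subseteq> {0..1}" unfolding maxint_def using l by auto
      show "x + l \<le> x'" if "x \<in> {x. maxint u x (x + l)}" "x' \<in> {x. maxint u x (x + l)}" "x < x'" for x x'
        using maxint_disjoint_left that by blast
    qed
    then have Pfin: "finite P" unfolding P_def using fin by blast
    have aP: "a \<in> P" unfolding P_def L_def l_def using v m by auto
    have Paway: "{x..x + l} \<inter> D' = {}" "0 < x" "x + l < 1" if xP: "x \<in> P" for x
    proof -
      obtain u where u: "u \<in> L" "maxint u x (x + l)" using xP unfolding P_def by blast
      show e: "{x..x + l} \<inter> D' = {}" using away[OF u] l by simp
      have "0 \<notin> {x..x + l}" "1 \<notin> {x..x + l}" using e unfolding D'_def by blast+
      then show "0 < x" "x + l < 1" using u(2) unfolding maxint_def by auto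
    qed
    have "a \<in> open_part v"
    proof (rule finite_orbit_open_part[OF Pfin _ _ _ aP v(1)])
      show "P \<subseteq> X"
      proof
        fix x assume "x \<in> P" then show "x \<in> X" using Paway(2,3)[of x] l by auto
      qed
      show "P \<inter> insert 0 D = {}"
      proof (rule ccontr)
        assume "P \<inter> insert 0 D \<noteq> {}"
        then obtain x where x: "x \<in> P" "x \<in> D'" unfolding D'_def by blast
        moreover have "x \<in> {x..x + l}" using l by simp
        ultimately show False using Paway(1)[OF x(1)] by blast
      qed
      fix s x assume s: "s \<in> S" and x: "x \<in> P"
      obtain u where u: "u \<in> L" "maxint u x (x + l)" using x unfolding P_def by blast
      have "x \<in> {x..x + l}" "x + l \<in> {x..x + l}" using l by auto
      then have "x \<notin> D'" "x + l \<notin> D'" using Paway(1)[OF x] by blast+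
      then obtain e1 e2 where e1: "e1 > 0" "{x - e1..x + e1} \<inter> D' = {}"
        and e2: "e2 > 0" "{x + l - e2..x + l + e2} \<inter> D' = {}"
        using finite_gap[OF fin(1)] by metis
      \<comment> \<open>A margin beyond both ends, so that one translation carries the component
        together with its ends.\<close>
      define h where "h = min (min e1 e2) (min x (1 - (x + l)))"
      have h: "h > 0" "h \<le> e1" "h \<le> e2" "h \<le> x" "h \<le> 1 - (x + l)"
        unfolding h_def using e1(1) e2(1) Paway(2,3)[OF x] by auto
      have "{x - h<..<x + l + h} \<subseteq> {x - e1..x + e1} \<union> {x..x + l} \<union> {x + l - e2..x + l + e2}"
        using h l e1(1) e2(1) by auto
      then have "{x - h<..<x + l + h} \<inter> D = {}" using e1(2) e2(2) Paway(1)[OF x] unfolding D'_def by blast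
      then have tr: "trans_on s (x - h) (x + l + h) (\<Phi> s x - x)"
        by (intro trans_on_S[OF s]) (use h l in auto)
      have uT: "u \<in> T" "length u = n" using u unfolding L_def by auto
      have "maxint (\<tau> s u) (x + (\<Phi> s x - x)) (x + l + (\<Phi> s x - x))"
        by (rule maxint_shift[OF tr _ _ u(2) uT(1)]) (use h in auto)
      moreover have "\<tau> s u \<in> L" unfolding L_def using uT s S_G act_T act_length by auto
      ultimately show "\<Phi> s x \<in> P" unfolding P_def by (auto simp: algebra_simps)
    qed
    then show False using m unfolding maxint_def by simp
  qed
  then show ?thesis using that e(1) by blast
qed

text \<open>Components at one vertex are disjoint and their lengths are bounded below.\<close>

lemma finite_boundary: "finite (boundary n)"
proof -
  obtain e where e: "e > 0" "\<And>v a b. v \<in> T \<Longrightarrow> length v = n \<Longrightarrow> maxint v a b \<Longrightarrow> a + e \<le> b"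
    using maxint_length_bound by blast
  have "finite ({a. \<exists>b. maxint v a b} \<union> {b. \<exists>a. maxint v a b})" if v: "v \<in> {v \<in> T. length v = n}" for v
  proof (intro finite_UnI)
    show "finite {a. \<exists>b. maxint v a b}"
    proof (rule finite_separated[OF e(1)])
      show "{a. \<exists>b. maxint v a b} \<subseteq> {0..1}" unfolding maxint_def by auto
      fix a a' assume *: "a \<in> {a. \<exists>b. maxint v a b}" "a' \<in> {a. \<exists>b. maxint v a b}" "a < a'"
      then obtain b b' where "maxint v a b" "maxint v a' b'" by blast
      then show "a + e \<le> a'" using maxint_disjoint_left[of v a b a' b'] e(2)[of v a b] v *(3) by simp
    qed
    show "finite {b. \<exists>a. maxint v a b}"
    proof (rule finite_separated[OF e(1)])
      show "{b. \<exists>a. maxint v a b} \<subseteq> {0..1}" unfolding maxint_def by auto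
      fix b b' assume *: "b \<in> {b. \<exists>a. maxint v a b}" "b' \<in> {b. \<exists>a. maxint v a b}" "b < b'"
      then obtain a a' where "maxint v a b" "maxint v a' b'" by blast
      then show "b + e \<le> b'" using maxint_disjoint_right[of v a b a' b'] e(2)[of v a' b'] v *(3) by simp
    qed
  qed
  then have "finite (\<Union>v\<in>{v \<in> T. length v = n}. {a. \<exists>b. maxint v a b} \<union> {b. \<exists>a. maxint v a b})"
    using finite_level by blast
  then show ?thesis by (rule rev_finite_subset) (auto simp: boundary_def)
qed

text \<open>Ends outside \<open>M\<close> avoid \<open>0\<close>, \<open>1\<close> and the cut
  points, and generators keep them outside \<open>M\<close> because displacements lie in
  \<open>M\<close>. Being finite in number, they would lie in the open part at every vertex by
  \<open>finite_orbit_open_part\<close>, also at one whose component they bound.\<close>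

lemma boundary_M: "boundary n \<subseteq> M"
proof
  fix x assume xB: "x \<in> boundary n"
  obtain l where l: "l > 0" "\<And>v a b. v \<in> T \<Longrightarrow> length v = n \<Longrightarrow> maxint v a b \<Longrightarrow> a + l \<le> b"
    using maxint_length_bound by blast
  show "x \<in> M"
  proof (rule ccontr)
    assume xM: "x \<notin> M"
    define P where "P = boundary n - M"
    have unit: "0 < p" "p < 1" "p \<notin> D" if p: "p \<in> P" for p
    proof -
      have "0 \<le> p" "p \<le> 1" "p \<noteq> 0" "p \<noteq> 1" "p \<notin> D"
        using p zspan_0 one_M D_M unfolding P_def boundary_def maxint_def by auto
      then show "0 < p" "p < 1" "p \<notin> D" by auto
    qed
    obtain v where v: "v \<in> T" "x \<notin> open_part v" using xB unfolding boundary_def maxint_def by auto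
    have "x \<in> open_part v"
    proof (rule finite_orbit_open_part[OF _ _ _ _ _ v(1)])
      show "finite P" unfolding P_def using finite_boundary by blast
      show "P \<subseteq> X" "P \<inter> insert 0 D = {}" using unit by force+
      show "x \<in> P" unfolding P_def using xB xM by blast
      fix s p assume s: "s \<in> S" and p: "p \<in> P"
      have sG: "s \<in> G" using s S_G by blast
      obtain e where e: "e > 0" "{p - e..p + e} \<inter> D = {}" using finite_gap[OF finite_D unit(3)[OF p]] .
      define h where "h = min (min e l) (min p (1 - p))"
      have h: "h > 0" "h \<le> e" "h \<le> l" "h \<le> p" "h \<le> 1 - p" unfolding h_def using e l unit[OF p] by auto
      define d where "d = \<Phi> s p - p"
      have "{p - h<..<p + h} \<subseteq> {p - e..p + e}" using h by auto
      then have tr: "trans_on s (p - h) (p + h) d" unfolding d_def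
        by (intro trans_on_S[OF s]) (use h e in auto)
      obtain u y where u: "u \<in> T" "length u = n" and y: "maxint u p y \<or> maxint u y p"
        using p unfolding P_def boundary_def by blast
      have su: "\<tau> s u \<in> T" "length (\<tau> s u) = n" using u sG act_T act_length by auto
      have pn: "p \<notin> open_part u" using y unfolding maxint_def by auto
      then have pd: "p + d \<notin> open_part (\<tau> s u)" using open_part_shift[OF tr _ _ u(1), of p] h by simp
      note tb = trans_on_bounds[OF tr]
      have "p + d \<in> boundary n"
        using y
      proof
        assume m: "maxint u p y"
        have "p + l \<le> y" using l(2)[OF u m] .
        have "t \<in> open_part (\<tau> s u)" if t: "p + d < t" "t < p + d + h" for t
        proof -
          have "t - d \<in> open_part u" using m t h \<open>p + l \<le> y\<close> unfolding maxint_def by auto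
          then show ?thesis using open_part_shift[OF tr _ _ u(1), of "t - d"] t h by simp
        qed
        then have "{p + d<..<p + d + h} \<subseteq> open_part (\<tau> s u)" by auto
        then obtain c where "maxint (\<tau> s u) (p + d) c"
          using maxint_from_left[of "p + d" "p + d + h" "\<tau> s u"] pd tb h by auto
        then show ?thesis unfolding boundary_def using su by blast
      next
        assume m: "maxint u y p"
        have "y + l \<le> p" using l(2)[OF u m] .
        have "t \<in> open_part (\<tau> s u)" if t: "p + d - h < t" "t < p + d" for t
        proof -
          have "t - d \<in> open_part u" using m t h \<open>y + l \<le> p\<close> unfolding maxint_def by auto
          then show ?thesis using open_part_shift[OF tr _ _ u(1), of "t - d"] t h by simp
        qed
        then have "{p + d - h<..<p + d} \<subseteq> open_part (\<tau> s u)" by auto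
        then obtain c where "maxint (\<tau> s u) c (p + d)"
          using maxint_from_right[of "p + d - h" "p + d" "\<tau> s u"] pd tb h by auto
        then show ?thesis unfolding boundary_def using su by blast
      qed
      moreover have "p + d = \<Phi> s p" unfolding d_def by simp
      moreover have "\<Phi> s p \<notin> M"
      proof
        assume "\<Phi> s p \<in> M"
        moreover have "- d \<in> M" unfolding d_def by (intro zspan_neg disp_S[OF s]) (use unit[OF p] in simp)
        ultimately have "\<Phi> s p + - d \<in> M" by (rule zspan_add)
        then have "p \<in> M" unfolding d_def by simp
        then show False using p unfolding P_def by blast
      qed
      ultimately show "\<Phi> s p \<in> P" unfolding P_def by simp
    qed
    then show False using v by simp
  qed
qed

text \<open>A component \<open>(a, b)\<close> a priori yields only pairs away from its ends. If no
  \<open>[a, a + e)\<close> were in the ideal, the left ends with this defect would form a finite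
  set whose right germs are translated by the generators to right germs of the same kind, so
  \<open>finite_orbit_nul\<close> would put them into \<open>nul\<close>. A left end may itself be a
  cut point, as the maps are right-continuous.\<close>

lemma maxint_left_germ:
  assumes v: "v \<in> T" and m: "maxint v a b"
  obtains e where "e > 0" "({a..<a + e}, v) \<in> I"
proof -
  define n where "n = length v"
  obtain l where l: "l > 0" "\<And>v a b. v \<in> T \<Longrightarrow> length v = n \<Longrightarrow> maxint v a b \<Longrightarrow> a + l \<le> b"
    using maxint_length_bound by blast
  have "\<exists>e>0. ({a..<a + e}, v) \<in> I"
  proof (rule ccontr)
    assume neg: "\<not> ?thesis"
    define P where "P = {p. \<exists>u\<in>T. length u = n \<and> (\<exists>y. maxint u p y) \<and> \<not> (\<exists>e>0. ({p..<p + e}, u) \<in> I)}"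
    have Pfin: "finite P" by (rule finite_subset[OF _ finite_boundary[of n]]) (auto simp: P_def boundary_def)
    have aP: "a \<in> P" unfolding P_def n_def using v m neg by blast
    have "\<exists>e>0. \<forall>e'. 0 < e' \<longrightarrow> e' \<le> e \<longrightarrow> {p<..<p + e'} \<inter> D = {} \<and> e' \<le> l" for p
    proof -
      obtain e where e: "e > 0" "{p<..<p + e} \<inter> D = {}" using finite_gap_right[OF finite_D] .
      have "{p<..<p + e'} \<subseteq> {p<..<p + e}" if "e' \<le> e" for e' using that by auto
      then show ?thesis using e l(1) by (intro exI[of _ "min e l"]) fastforce
    qed
    then obtain e where e: "e > 0" "\<And>p. p \<in> P \<Longrightarrow> {p<..<p + e} \<inter> D = {} \<and> e \<le> l"
      using uniform_eps[OF Pfin, of "\<lambda>p e'. {p<..<p + e'} \<inter> D = {} \<and> e' \<le> l"] by (metis order_refl)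
    have bd: "0 \<le> p" "p + e \<le> 1" if p: "p \<in> P" for p
    proof -
      obtain u y where u: "u \<in> T" "length u = n" "maxint u p y" using p unfolding P_def by blast
      then show "0 \<le> p" "p + e \<le> 1" using l(2)[OF u] e(2)[OF p] unfolding maxint_def by auto
    qed
    have "({a..<a + e}, v) \<in> nul"
    proof (rule finite_orbit_nul[OF Pfin e(1) _ _ aP v])
      show "0 \<le> p \<and> p + e \<le> 1" if "p \<in> P" for p using bd[OF that] by blast
      fix s p t assume s: "s \<in> S" and p: "p \<in> P"
      have sG: "s \<in> G" using s S_G by blast
      define d where "d = \<Phi> s p - p"
      have tr: "trans_on s p (p + e) d" unfolding d_def
        by (rule trans_on_S[OF s]) (use bd[OF p] e(1) e(2)[OF p] in auto)
      obtain u y where u: "u \<in> T" "length u = n" and m: "maxint u p y" and ng: "\<not> (\<exists>e>0. ({p..<p + e}, u) \<in> I)"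
        using p unfolding P_def by blast
      have su: "\<tau> s u \<in> T" "length (\<tau> s u) = n" using u sG act_T act_length by auto
      have ng': "\<not> (\<exists>e'>0. ({p + d..<p + d + e'}, \<tau> s u) \<in> I)"
      proof
        assume "\<exists>e'>0. ({p + d..<p + d + e'}, \<tau> s u) \<in> I"
        then obtain e' where e': "e' > 0" "({p + d..<p + d + e'}, \<tau> s u) \<in> I" by blast
        have "({p + d..<p + d + min e e'}, \<tau> s u) \<in> I" by (rule Ico_down[OF e'(2)]) auto
        then have "({p + d..<(p + min e e') + d}, \<tau> s u) \<in> I" by (simp add: algebra_simps)
        then have "({p..<p + min e e'}, u) \<in> I"
          using trans_on_mem[OF tr, of p "p + min e e'" u] u by simp
        moreover have "min e e' > 0" using e(1) e'(1) by simp
        ultimately show False using ng by blast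
      qed
      have pd: "p + d \<notin> open_part (\<tau> s u)"
      proof
        assume "p + d \<in> open_part (\<tau> s u)"
        then obtain e' where e': "e' > 0" "({p + d - e'..<p + d + e'}, \<tau> s u) \<in> I" by (rule open_partE)
        have "({p + d..<p + d + e'}, \<tau> s u) \<in> I" by (rule Ico_down[OF e'(2)]) (use e'(1) in auto)
        then show False using ng' e'(1) by blast
      qed
      have "t \<in> open_part (\<tau> s u)" if t: "p + d < t" "t < p + d + e" for t
      proof -
        have "t - d \<in> open_part u" using m t l(2)[OF u m] e(2)[OF p] unfolding maxint_def by auto
        then show ?thesis using open_part_shift[OF tr _ _ u(1), of "t - d"] t by simp
      qed
      then have "{p + d<..<p + d + e} \<subseteq> open_part (\<tau> s u)" by auto
      then obtain c where "maxint (\<tau> s u) (p + d) c"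
        using maxint_from_left[of "p + d" "p + d + e" "\<tau> s u"] pd trans_on_bounds[OF tr] e(1) by auto
      then have "p + d \<in> P" unfolding P_def using su ng' by blast
      then have "\<Phi> s p \<in> P" unfolding d_def by simp
      moreover have "\<Phi> s t = \<Phi> s p + (t - p)" if "p \<le> t" "t < p + e"
        using trans_onD[OF tr that] unfolding d_def by simp
      ultimately show "\<Phi> s p \<in> P \<and> (p \<le> t \<longrightarrow> t < p + e \<longrightarrow> \<Phi> s t = \<Phi> s p + (t - p))" by blast
    qed
    then show False using nulI neg e(1) by blast
  qed
  then show ?thesis using that by blast
qed

text \<open>The mirror image for left germs, with \<open>p - e\<close> as base point of
  \<open>[p - e, p)\<close>; the displacement is read off there because the generator may jump at
  \<open>p\<close>.\<close>

lemma maxint_right_germ: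
  assumes v: "v \<in> T" and m: "maxint v a b"
  obtains e where "e > 0" "({b - e..<b}, v) \<in> I"
proof -
  define n where "n = length v"
  obtain l where l: "l > 0" "\<And>v a b. v \<in> T \<Longrightarrow> length v = n \<Longrightarrow> maxint v a b \<Longrightarrow> a + l \<le> b"
    using maxint_length_bound by blast
  have "\<exists>e>0. ({b - e..<b}, v) \<in> I"
  proof (rule ccontr)
    assume neg: "\<not> ?thesis"
    define P where "P = {p. \<exists>u\<in>T. length u = n \<and> (\<exists>y. maxint u y p) \<and> \<not> (\<exists>e>0. ({p - e..<p}, u) \<in> I)}"
    have Pfin: "finite P" by (rule finite_subset[OF _ finite_boundary[of n]]) (auto simp: P_def boundary_def)
    have bP: "b \<in> P" unfolding P_def n_def using v m neg by blast
    have "\<exists>e>0. \<forall>e'. 0 < e' \<longrightarrow> e' \<le> e \<longrightarrow> {p - e'<..<p} \<inter> D = {} \<and> e' \<le> l" for p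
    proof -
      obtain e where e: "e > 0" "{p - e..p + e} \<inter> (D - {p}) = {}"
        using finite_gap[of "D - {p}" p] finite_D by auto
      have "{p - e'<..<p} \<inter> D = {}" if "e' \<le> e" for e'
      proof -
        have "{p - e'<..<p} \<subseteq> {p - e..p + e} - {p}" using that e(1) by auto
        then show ?thesis using e(2) by blast
      qed
      then show ?thesis using e(1) l(1) by (intro exI[of _ "min e l"]) auto
    qed
    then obtain e where e: "e > 0" "\<And>p. p \<in> P \<Longrightarrow> {p - e<..<p} \<inter> D = {} \<and> e \<le> l"
      using uniform_eps[OF Pfin, of "\<lambda>p e'. {p - e'<..<p} \<inter> D = {} \<and> e' \<le> l"] by (metis order_refl)
    have bd: "0 \<le> p - e" "p \<le> 1" if p: "p \<in> P" for p
    proof -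
      obtain u y where u: "u \<in> T" "length u = n" "maxint u y p" using p unfolding P_def by blast
      then show "0 \<le> p - e" "p \<le> 1" using l(2)[OF u] e(2)[OF p] unfolding maxint_def by auto
    qed
    have "({b - e..<b - e + e}, v) \<in> nul"
    proof (rule finite_orbit_nul[where P = "(\<lambda>p. p - e) ` P", OF _ e(1) _ _ _ v])
      show "finite ((\<lambda>p. p - e) ` P)" using Pfin by blast
      show "b - e \<in> (\<lambda>p. p - e) ` P" using bP by blast
      show "0 \<le> q \<and> q + e \<le> 1" if "q \<in> (\<lambda>p. p - e) ` P" for q using bd that by auto
      fix s q t assume s: "s \<in> S" and "q \<in> (\<lambda>p. p - e) ` P"
      then obtain p where p: "p \<in> P" and q: "q = p - e" by blast
      have sG: "s \<in> G" using s S_G by blast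
      define d where "d = \<Phi> s (p - e) - (p - e)"
      have tr: "trans_on s (p - e) p d" unfolding d_def
        by (rule trans_on_S[OF s]) (use bd[OF p] e(1) e(2)[OF p] in auto)
      obtain u y where u: "u \<in> T" "length u = n" and m: "maxint u y p" and ng: "\<not> (\<exists>e>0. ({p - e..<p}, u) \<in> I)"
        using p unfolding P_def by blast
      have su: "\<tau> s u \<in> T" "length (\<tau> s u) = n" using u sG act_T act_length by auto
      have ng': "\<not> (\<exists>e'>0. ({p + d - e'..<p + d}, \<tau> s u) \<in> I)"
      proof
        assume "\<exists>e'>0. ({p + d - e'..<p + d}, \<tau> s u) \<in> I"
        then obtain e' where e': "e' > 0" "({p + d - e'..<p + d}, \<tau> s u) \<in> I" by blast
        have "({p + d - min e e'..<p + d}, \<tau> s u) \<in> I" by (rule Ico_down[OF e'(2)]) auto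
        then have "({(p - min e e') + d..<p + d}, \<tau> s u) \<in> I" by (simp add: algebra_simps)
        then have "({p - min e e'..<p}, u) \<in> I"
          using trans_on_mem[OF tr, of "p - min e e'" p u] u by simp
        moreover have "min e e' > 0" using e(1) e'(1) by simp
        ultimately show False using ng by blast
      qed
      have pd: "p + d \<notin> open_part (\<tau> s u)"
      proof
        assume "p + d \<in> open_part (\<tau> s u)"
        then obtain e' where e': "e' > 0" "({p + d - e'..<p + d + e'}, \<tau> s u) \<in> I" by (rule open_partE)
        have "({p + d - e'..<p + d}, \<tau> s u) \<in> I" by (rule Ico_down[OF e'(2)]) (use e'(1) in auto)
        then show False using ng' e'(1) by blast
      qed
      have "t \<in> open_part (\<tau> s u)" if t: "p + d - e < t" "t < p + d" for t
      proof -
        have "t - d \<in> open_part u" using m t l(2)[OF u m] e(2)[OF p] unfolding maxint_def by auto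
        then show ?thesis using open_part_shift[OF tr _ _ u(1), of "t - d"] t by simp
      qed
      then have "{p + d - e<..<p + d} \<subseteq> open_part (\<tau> s u)" by auto
      then obtain c where "maxint (\<tau> s u) c (p + d)"
        using maxint_from_right[of "p + d - e" "p + d" "\<tau> s u"] pd trans_on_bounds[OF tr] e(1) by auto
      then have "p + d \<in> P" unfolding P_def using su ng' by blast
      moreover have "\<Phi> s q = (p + d) - e" unfolding q d_def by simp
      ultimately have "\<Phi> s q \<in> (\<lambda>p. p - e) ` P" by blast
      moreover have "\<Phi> s t = \<Phi> s q + (t - q)" if "q \<le> t" "t < q + e"
        using trans_onD[OF tr, of t] that unfolding d_def q by simp
      ultimately show "\<Phi> s q \<in> (\<lambda>p. p - e) ` P \<and> (q \<le> t \<longrightarrow> t < q + e \<longrightarrow> \<Phi> s t = \<Phi> s q + (t - q))" by blast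
    qed
    then have "({b - e..<b}, v) \<in> I" using nulI by auto
    then show False using neg e(1) by blast
  qed
  then show ?thesis using that by blast
qed

lemma maxint_filled:
  assumes v: "v \<in> T" and m: "maxint v a b"
  shows "({a..<b}, v) \<in> I"
proof -
  have ab: "a < b" "{a<..<b} \<subseteq> open_part v" using m unfolding maxint_def by auto
  obtain e1 where e1: "e1 > 0" "({a..<a + e1}, v) \<in> I" using maxint_left_germ[OF v m] .
  obtain e2 where e2: "e2 > 0" "({b - e2..<b}, v) \<in> I" using maxint_right_germ[OF v m] .
  \<comment> \<open>Compactness of \<open>[a, b]\<close> in the form of \<open>Bolzano\<close>;
    truncation by \<open>max\<close> and \<open>min\<close> lets the germs at the two ends serve as
    neighbourhoods.\<close>
  have "({max a a..<min b b}, v) \<in> I"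
  proof (rule Bolzano[where P = "\<lambda>s t. ({max a s..<min b t}, v) \<in> I"])
    show "a \<le> b" using ab by simp
    fix x y z assume 1: "({max a x..<min b y}, v) \<in> I" and 2: "({max a y..<min b z}, v) \<in> I" and o: "x \<le> y" "y \<le> z"
    have "({max a x..<min b y} \<union> {max a y..<min b z}, v) \<in> I" using ideal_Un[OF I 1 2] .
    moreover have "{max a x..<min b y} \<union> {max a y..<min b z} = {max a x..<min b z}" using o by auto
    ultimately show "({max a x..<min b z}, v) \<in> I" by simp
  next
    fix x assume x: "a \<le> x" "x \<le> b"
    consider "x = a" | "x = b" | "a < x" "x < b" using x by linarith
    then show "\<exists>d>0. \<forall>s t. s \<le> x \<and> x \<le> t \<and> t - s < d \<longrightarrow> ({max a s..<min b t}, v) \<in> I"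
    proof cases
      case 1
      show ?thesis
      proof (intro exI[of _ e1] conjI allI impI)
        fix s t assume "s \<le> x \<and> x \<le> t \<and> t - s < e1"
        then show "({max a s..<min b t}, v) \<in> I" by (intro Ico_down[OF e1(2)]) (use 1 in auto)
      qed (rule e1(1))
    next
      case 2
      show ?thesis
      proof (intro exI[of _ e2] conjI allI impI)
        fix s t assume "s \<le> x \<and> x \<le> t \<and> t - s < e2"
        then show "({max a s..<min b t}, v) \<in> I" by (intro Ico_down[OF e2(2)]) (use 2 in auto)
      qed (rule e2(1))
    next
      case 3
      then have "x \<in> open_part v" using ab(2) by auto
      then obtain e where e: "e > 0" "({x - e..<x + e}, v) \<in> I" by (rule open_partE)
      show ?thesis
      proof (intro exI[of _ e] conjI allI impI)
        fix s t assume "s \<le> x \<and> x \<le> t \<and> t - s < e"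
        then show "({max a s..<min b t}, v) \<in> I" by (intro Ico_down[OF e(2)]) auto
      qed (rule e(1))
    qed
  qed
  then show ?thesis by simp
qed

text \<open>Left ends are added to the components and right ends are not, so that a finite union of
  intervals \<open>[a, b)\<close> results.\<close>

definition greatest :: "'a list \<Rightarrow> real set" where
  "greatest v = {x. \<exists>a b. maxint v a b \<and> a \<le> x \<and> x < b}"

lemma greatest_sub: "greatest v \<subseteq> X"
  unfolding greatest_def maxint_def by auto

lemma greatest_cut_set: assumes "v \<in> T" shows "cut_set (boundary (length v)) (greatest v)"
  unfolding cut_set_def
proof (intro conjI allI impI finite_boundary greatest_sub)
  fix x y :: real assume xy: "0 \<le> x" "x < y" "y < 1" "{x<..y} \<inter> boundary (length v) = {}"
  have nb: "c \<notin> {x<..y}" if "maxint v a b" "c = a \<or> c = b" for a b c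
    using xy(4) that assms unfolding boundary_def by blast
  show "x \<in> greatest v \<longleftrightarrow> y \<in> greatest v"
  proof
    assume "x \<in> greatest v"
    then obtain a b where ab: "maxint v a b" "a \<le> x" "x < b" unfolding greatest_def by blast
    then have "y < b" using nb[OF ab(1), of b] by auto
    then show "y \<in> greatest v" unfolding greatest_def using ab xy by (intro CollectI exI[of _ a] exI[of _ b]) auto
  next
    assume "y \<in> greatest v"
    then obtain a b where ab: "maxint v a b" "a \<le> y" "y < b" unfolding greatest_def by blast
    then have "a \<le> x" using nb[OF ab(1), of a] by auto
    then show "x \<in> greatest v" unfolding greatest_def using ab xy by (intro CollectI exI[of _ a] exI[of _ b]) auto
  qed
qed

lemma greatest_simple: "v \<in> T \<Longrightarrow> simple (greatest v)"
  unfolding simple_def using greatest_cut_set by blast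

lemma greatest_mem: assumes v: "v \<in> T" shows "(greatest v, v) \<in> I"
proof -
  define K where "K = {p. maxint v (fst p) (snd p)}"
  have "a \<in> boundary (length v) \<and> b \<in> boundary (length v)" if "maxint v a b" for a b
    using v that unfolding boundary_def by blast
  then have "K \<subseteq> boundary (length v) \<times> boundary (length v)" unfolding K_def by auto
  then have "finite K" using finite_boundary finite_subset by blast
  then have "((\<Union>p\<in>K. {fst p..<snd p}), v) \<in> I"
    using ideal_UN[OF I _ v, of K "\<lambda>p. {fst p..<snd p}"] maxint_filled[OF v] unfolding K_def by blast
  moreover have "(\<Union>p\<in>K. {fst p..<snd p}) = greatest v" unfolding K_def greatest_def by force
  ultimately show ?thesis by simp
qed

text \<open>If \<open>x\<close> in \<open>B\<close> is outside the open part, some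
  \<open>(x, x + e)\<close> still lies inside it, so \<open>x\<close> is the left end of a
  component.\<close>

lemma mem_greatest: assumes B: "(B, v) \<in> I" shows "B \<subseteq> greatest v"
proof
  fix x assume x: "x \<in> B"
  have sB: "simple B" using ideal_simple[OF I B] .
  obtain e where e: "e > 0" "{x..<x + e} \<subseteq> B" using simple_right_open[OF sB x] .
  have "{x..<x + e} \<subseteq> X" using e(2) simple_sub[OF sB] by blast
  from Ico_subset_unit[OF this] e(1) have u: "0 \<le> x" "x + e \<le> 1" by simp_all
  have "({x..<x + e}, v) \<in> I" by (rule ideal_down[OF I B e(2)]) (rule simple_interval[OF u])
  then have o: "{x<..<x + e} \<subseteq> open_part v" by (rule Ico_open_part)
  show "x \<in> greatest v"
  proof (cases "x \<in> open_part v")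
    case True
    obtain a b where ab: "maxint v a b" "a < x" "x < b" using maxint_around[OF True] .
    then show ?thesis unfolding greatest_def by (intro CollectI exI[of _ a] exI[of _ b]) simp
  next
    case False
    then obtain c where "maxint v x c" using maxint_from_left[of x "x + e" v] e(1) u o by auto
    moreover from this have "x < c" unfolding maxint_def by simp
    ultimately show ?thesis unfolding greatest_def by (intro CollectI exI[of _ x] exI[of _ c]) simp
  qed
qed

lemma ideal_iff_greatest: "v \<in> T \<Longrightarrow> (B, v) \<in> I \<longleftrightarrow> simple B \<and> B \<subseteq> greatest v"
  using mem_greatest ideal_simple[OF I] ideal_down[OF I greatest_mem] by blast

end

section \<open>Maximal invariant ideals\<close>

context iet_tree_group
begin

text \<open>Every closure property involves finitely many pairs at a time, the gluing clause because
  levels are finite, and finitely many pairs lie in one member of the chain.\<close>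

lemma chain_Union_ideal:
  assumes ch: "subset.chain {I. ideal I \<and> nul \<subseteq> I \<and> (X, []) \<notin> I} \<C>" and ne: "\<C> \<noteq> {}"
  shows "\<Union>\<C> \<in> {I. ideal I \<and> nul \<subseteq> I \<and> (X, []) \<notin> I}"
proof -
  have C: "ideal I" "nul \<subseteq> I" "(X, []) \<notin> I" if "I \<in> \<C>" for I
    using ch that unfolding subset.chain_def by auto
  have fin: "\<exists>I\<in>\<C>. K \<subseteq> I" if "finite K" "K \<subseteq> \<Union>\<C>" for K
    using finite_subset_Union_chain[OF that ne ch] by blast
  have "ideal (\<Union>\<C>)"
    unfolding ideal_def
  proof (intro conjI allI impI ballI)
    fix B v assume "(B, v) \<in> \<Union>\<C>"
    then obtain I where I: "I \<in> \<C>" "(B, v) \<in> I" by blast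
    show "simple B" by (rule ideal_simple[OF C(1)[OF I(1)] I(2)])
    show "v \<in> T" by (rule ideal_T[OF C(1)[OF I(1)] I(2)])
  next
    fix v assume "v \<in> T" then show "({}, v) \<in> \<Union>\<C>" using ne ideal_empty C(1) by blast
  next
    fix B B' v assume a: "(B, v) \<in> \<Union>\<C>" "B' \<subseteq> B" "simple B'"
    then obtain I where I: "I \<in> \<C>" "(B, v) \<in> I" by blast
    then show "(B', v) \<in> \<Union>\<C>" using ideal_down[OF C(1)[OF I(1)] I(2) a(2,3)] by blast
  next
    fix B B' v assume "(B, v) \<in> \<Union>\<C>" "(B', v) \<in> \<Union>\<C>"
    then obtain I where I: "I \<in> \<C>" "(B, v) \<in> I" "(B', v) \<in> I" using fin[of "{(B, v), (B', v)}"] by auto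
    then show "(B \<union> B', v) \<in> \<Union>\<C>" using ideal_Un[OF C(1)[OF I(1)]] by blast
  next
    fix B v w assume a: "(B, v) \<in> \<Union>\<C>" "w \<in> T" "prefix v w"
    then obtain I where I: "I \<in> \<C>" "(B, v) \<in> I" by blast
    then show "(B, w) \<in> \<Union>\<C>" using ideal_prefix[OF C(1)[OF I(1)] I(2) a(2,3)] by blast
  next
    fix B v n assume a: "simple B" "v \<in> T" "length v \<le> n" "\<forall>w\<in>T. prefix v w \<longrightarrow> length w = n \<longrightarrow> (B, w) \<in> \<Union>\<C>"
    define K where "K = Pair B ` {w \<in> T. prefix v w \<and> length w = n}"
    have "finite {w \<in> T. prefix v w \<and> length w = n}"
      by (rule finite_subset[OF _ finite_level[of n]]) auto
    then have "finite K" unfolding K_def by blast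
    moreover have "K \<subseteq> \<Union>\<C>" unfolding K_def using a(4) by auto
    ultimately obtain I where I: "I \<in> \<C>" "K \<subseteq> I" using fin by blast
    have "(B, v) \<in> I" by (rule ideal_glue[OF C(1)[OF I(1)] a(1-3)]) (use I(2) in \<open>auto simp: K_def\<close>)
    then show "(B, v) \<in> \<Union>\<C>" using I by blast
  next
    fix B v g assume a: "(B, v) \<in> \<Union>\<C>" "g \<in> G"
    then obtain I where I: "I \<in> \<C>" "(B, v) \<in> I" by blast
    then show "(\<Phi> g ` B, \<tau> g v) \<in> \<Union>\<C>" using ideal_act[OF C(1)[OF I(1)] I(2) a(2)] by blast
  qed
  then show ?thesis using C ne by blast
qed

lemma maximal_ideal_exists:
  obtains I where "ideal I" "nul \<subseteq> I" "(X, []) \<notin> I" "\<And>J. ideal J \<Longrightarrow> I \<subseteq> J \<Longrightarrow> (X, []) \<notin> J \<Longrightarrow> J = I"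
proof -
  have "\<exists>I\<in>{I. ideal I \<and> nul \<subseteq> I \<and> (X, []) \<notin> I}. \<forall>J\<in>{I. ideal I \<and> nul \<subseteq> I \<and> (X, []) \<notin> I}. I \<subseteq> J \<longrightarrow> J = I"
  proof (rule subset_Zorn_nonempty)
    show "{I. ideal I \<and> nul \<subseteq> I \<and> (X, []) \<notin> I} \<noteq> {}" using nul_ideal nul_proper by blast
  qed (rule chain_Union_ideal)
  then obtain I where I: "ideal I" "nul \<subseteq> I" "(X, []) \<notin> I"
    and mI: "\<forall>J\<in>{I. ideal I \<and> nul \<subseteq> I \<and> (X, []) \<notin> I}. I \<subseteq> J \<longrightarrow> J = I" by blast
  have "J = I" if "ideal J" "I \<subseteq> J" "(X, []) \<notin> J" for J using mI that I(2) by blast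
  then show ?thesis using that I by blast
qed

lemma cut_set_fixed: "ptrans C (\<Phi> g) \<Longrightarrow> cut_set C {x \<in> X. \<Phi> g x = x}"
  unfolding cut_set_def using ptransD by (auto simp: ptrans_def) (smt (verit, best))+

lemma simple_fixed: "g \<in> G \<Longrightarrow> simple {x \<in> X. \<Phi> g x = x}"
  using G_ptrans cut_set_fixed unfolding simple_def by blast

end

section \<open>Residual sets of a maximal ideal\<close>

lemma simple_INT:
  assumes "finite K" "\<And>k. k \<in> K \<Longrightarrow> simple (F k)"
  shows "simple ({0..<1} \<inter> (\<Inter>k\<in>K. F k))"
proof -
  have "simple ({0..<1} - (\<Union>k\<in>K. {0..<1} - F k))"
    by (intro simple_Diff simple_UN simple_UNIV assms)
  moreover have "{0..<1} - (\<Union>k\<in>K. {0..<1} - F k) = {0..<1} \<inter> (\<Inter>k\<in>K. F k)" by auto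
  ultimately show ?thesis by simp
qed

locale maximal_invariant_ideal = invariant_ideal +
  assumes proper: "(X, []) \<notin> I"
    and maximal: "ideal J \<Longrightarrow> I \<subseteq> J \<Longrightarrow> (X, []) \<notin> J \<Longrightarrow> J = I"
begin

text \<open>Heuristically, and up to ends of intervals, the projection to the circle of the part of
  a minimal closed invariant set that lies over the cylinder of \<open>v\<close>.\<close>

definition res :: "'a list \<Rightarrow> real set" where
  "res v = X - greatest v"

lemma res_sub: "res v \<subseteq> X"
  unfolding res_def by blast

lemma res_simple: "v \<in> T \<Longrightarrow> simple (res v)"
  unfolding res_def by (intro simple_Diff simple_UNIV greatest_simple)

lemma res_cut_set: "v \<in> T \<Longrightarrow> cut_set (boundary (length v)) (res v)"
  using cut_set_Diff[OF cut_set_UNIV greatest_cut_set] unfolding res_def by simp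

lemma mem_ideal_iff: "v \<in> T \<Longrightarrow> simple B \<Longrightarrow> (B, v) \<in> I \<longleftrightarrow> B \<inter> res v = {}"
  using ideal_iff_greatest[of v B] simple_sub[of B] unfolding res_def by blast

lemma res_mono: "w \<in> T \<Longrightarrow> prefix v w \<Longrightarrow> res w \<subseteq> res v"
  using mem_greatest[OF ideal_prefix[OF I greatest_mem]] prefix_T unfolding res_def by blast

lemma res_act: "g \<in> G \<Longrightarrow> v \<in> T \<Longrightarrow> x \<in> res v \<Longrightarrow> \<Phi> g x \<in> res (\<tau> g v)"
proof -
  assume g: "g \<in> G" "v \<in> T" and x: "x \<in> res v"
  have gv: "\<tau> g v \<in> T" using g act_T by blast
  have xX: "x \<in> X" using x res_sub by blast
  have "\<Phi> (- g) ` greatest (\<tau> g v) \<subseteq> greatest (\<tau> (- g) (\<tau> g v))"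
    by (rule mem_greatest[OF ideal_act[OF I greatest_mem[OF gv] neg_G[OF g(1)]]])
  moreover have "\<Phi> (- g) (\<Phi> g x) \<notin> greatest (\<tau> (- g) (\<tau> g v))" using g x xX unfolding res_def by simp
  ultimately have "\<Phi> g x \<notin> greatest (\<tau> g v)" by blast
  then show ?thesis unfolding res_def using Phi_in[OF g(1) xX] by blast
qed

lemma res_image: "g \<in> G \<Longrightarrow> v \<in> T \<Longrightarrow> \<Phi> g ` res v = res (\<tau> g v)"
proof
  assume g: "g \<in> G" "v \<in> T"
  show "\<Phi> g ` res v \<subseteq> res (\<tau> g v)" using res_act[OF g] by blast
  show "res (\<tau> g v) \<subseteq> \<Phi> g ` res v"
  proof
    fix y assume y: "y \<in> res (\<tau> g v)"
    then have "\<Phi> (- g) y \<in> res v" using res_act[OF neg_G[OF g(1)] act_T[OF g], of y] g by simp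
    moreover have "\<Phi> g (\<Phi> (- g) y) = y" by (rule Phi_Phi_neg[OF g(1) subsetD[OF res_sub y]])
    ultimately show "y \<in> \<Phi> g ` res v" by (metis image_eqI)
  qed
qed

text \<open>If \<open>x\<close> were in no \<open>res w\<close> at level \<open>n\<close>, the
  complement of these finitely many sets would belong to the ideal at each \<open>w\<close>, hence
  by gluing at \<open>v\<close>.\<close>

lemma res_extend:
  assumes "v \<in> T" "x \<in> res v" "length v \<le> n"
  obtains w where "w \<in> T" "prefix v w" "length w = n" "x \<in> res w"
proof -
  have "\<exists>w\<in>T. prefix v w \<and> length w = n \<and> x \<in> res w"
  proof (rule ccontr)
    assume neg: "\<not> ?thesis"
    define L where "L = {w \<in> T. prefix v w \<and> length w = n}"
    have fL: "finite L" by (rule finite_subset[OF _ finite_level[of n]]) (auto simp: L_def)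
    define B where "B = X - (\<Union>w\<in>L. res w)"
    have sB: "simple B" unfolding B_def
      by (intro simple_Diff simple_UN simple_UNIV fL res_simple) (auto simp: L_def)
    have "(B, v) \<in> I"
    proof (rule ideal_glue[OF I sB assms(1,3)])
      fix w assume w: "w \<in> T" "prefix v w" "length w = n"
      then have "B \<inter> res w = {}" unfolding B_def L_def by blast
      then show "(B, w) \<in> I" using mem_ideal_iff[OF w(1) sB] by blast
    qed
    then have "B \<inter> res v = {}" using mem_ideal_iff[OF assms(1) sB] by blast
    moreover have "x \<in> B" unfolding B_def L_def using assms(2) res_sub neg by blast
    ultimately show False using assms(2) by blast
  qed
  then show ?thesis using that by blast
qed

lemma res_Nil: "res [] \<noteq> {}"
proof
  assume "res [] = {}"
  then have "(X, []) \<in> I" using mem_ideal_iff[OF Nil_T, of X] by simp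
  then show False using proper by blast
qed

text \<open>Minimality as a covering property: the pairs that finitely many translates of
  \<open>(B0, v0)\<close> cover, modulo \<open>I\<close> and deep enough in the tree, form an ideal
  that contains \<open>I\<close> and also \<open>(B0, v0)\<close>. By maximality it contains
  \<open>(X, [])\<close>.\<close>

lemma res_cover:
  assumes v0: "v0 \<in> T" and B0: "simple B0" and ne: "B0 \<inter> res v0 \<noteq> {}"
  obtains Q n where "finite Q" "Q \<subseteq> G"
    "\<And>u x. u \<in> T \<Longrightarrow> n \<le> length u \<Longrightarrow> x \<in> res u \<Longrightarrow> \<exists>g\<in>Q. prefix (\<tau> g v0) u \<and> x \<in> \<Phi> g ` B0"
proof -
  \<comment> \<open>Over \<open>u\<close> only those translates count whose vertex
    \<open>\<tau> g v0\<close> lies above \<open>u\<close>.\<close>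
  define C where "C Q u = (\<Union>g\<in>{g \<in> Q. prefix (\<tau> g v0) u}. \<Phi> g ` B0)" for Q u
  have sC: "simple (C Q u)" if "finite Q" "Q \<subseteq> G" for Q u
    unfolding C_def by (rule simple_UN) (use that simple_image[OF _ B0] in auto)
  have CM: "C Q u \<subseteq> C Q' u" if "Q \<subseteq> Q'" for Q Q' u unfolding C_def using that by blast
  define J where "J = {(B, v). simple B \<and> v \<in> T \<and> (\<exists>Q. finite Q \<and> Q \<subseteq> G \<and> ev (\<lambda>u. (B - C Q u, u) \<in> I) v)}"
  have JI: "(B, v) \<in> J" if "simple B" "v \<in> T" "finite Q" "Q \<subseteq> G" "ev (\<lambda>u. (B - C Q u, u) \<in> I) v" for B v Q
    unfolding J_def using that by blast
  have JE: "\<exists>Q. finite Q \<and> Q \<subseteq> G \<and> ev (\<lambda>u. (B - C Q u, u) \<in> I) v" "simple B" "v \<in> T" if "(B, v) \<in> J" for B v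
    using that unfolding J_def by auto
  have "ideal J"
    unfolding ideal_def
  proof (intro conjI allI impI ballI)
    fix B v assume "(B, v) \<in> J" then show "simple B" "v \<in> T" using JE by blast+
  next
    fix v assume v: "v \<in> T"
    show "({}, v) \<in> J"
      by (rule JI[where Q = "{}"]) (use v ideal_empty[OF I] in \<open>auto simp: ev_def\<close>)
  next
    fix B B' v assume a: "(B, v) \<in> J" "B' \<subseteq> B" "simple B'"
    obtain Q where Q: "finite Q" "Q \<subseteq> G" "ev (\<lambda>u. (B - C Q u, u) \<in> I) v" using JE(1)[OF a(1)] by blast
    have "ev (\<lambda>u. (B' - C Q u, u) \<in> I) v"
    proof (rule ev_mono[OF Q(3)])
      fix u assume "u \<in> T" and m: "(B - C Q u, u) \<in> I"
      have "B' - C Q u \<subseteq> B - C Q u" using a(2) by blast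
      then show "(B' - C Q u, u) \<in> I"
        using ideal_down[OF I m _ simple_Diff[OF a(3) sC[OF Q(1,2)]]] by blast
    qed
    then show "(B', v) \<in> J" using JI[OF a(3) JE(3)[OF a(1)] Q(1,2)] by blast
  next
    fix B B' v assume a: "(B, v) \<in> J" "(B', v) \<in> J"
    obtain Q where Q: "finite Q" "Q \<subseteq> G" "ev (\<lambda>u. (B - C Q u, u) \<in> I) v" using JE(1)[OF a(1)] by blast
    obtain Q' where Q': "finite Q'" "Q' \<subseteq> G" "ev (\<lambda>u. (B' - C Q' u, u) \<in> I) v" using JE(1)[OF a(2)] by blast
    have s: "simple (B \<union> B')" using simple_Un[OF JE(2)[OF a(1)] JE(2)[OF a(2)]] .
    have "ev (\<lambda>u. (B \<union> B' - C (Q \<union> Q') u, u) \<in> I) v"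
    proof (rule ev_conj[OF Q(3) Q'(3)])
      fix u assume "u \<in> T" "(B - C Q u, u) \<in> I" "(B' - C Q' u, u) \<in> I"
      then have "((B - C Q u) \<union> (B' - C Q' u), u) \<in> I" using ideal_Un[OF I] by blast
      moreover have "simple (B \<union> B' - C (Q \<union> Q') u)" using simple_Diff[OF s sC] Q Q' by simp
      moreover have "B \<union> B' - C (Q \<union> Q') u \<subseteq> (B - C Q u) \<union> (B' - C Q' u)"
        using CM[of Q "Q \<union> Q'" u] CM[of Q' "Q \<union> Q'" u] by blast
      ultimately show "(B \<union> B' - C (Q \<union> Q') u, u) \<in> I" using ideal_down[OF I] by blast
    qed
    then show "(B \<union> B', v) \<in> J" using JI[OF s JE(3)[OF a(1)], of "Q \<union> Q'"] Q Q' by blast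
  next
    fix B v w assume a: "(B, v) \<in> J" "w \<in> T" "prefix v w"
    obtain Q where Q: "finite Q" "Q \<subseteq> G" "ev (\<lambda>u. (B - C Q u, u) \<in> I) v" using JE(1)[OF a(1)] by blast
    show "(B, w) \<in> J" using JI[OF JE(2)[OF a(1)] a(2) Q(1,2) ev_prefix[OF Q(3) a(3)]] .
  next
    fix B v n assume a: "simple B" "v \<in> T" "length v \<le> n" "\<forall>w\<in>T. prefix v w \<longrightarrow> length w = n \<longrightarrow> (B, w) \<in> J"
    define L where "L = {w \<in> T. prefix v w \<and> length w = n}"
    have fL: "finite L" by (rule finite_subset[OF _ finite_level[of n]]) (auto simp: L_def)
    have "\<forall>w\<in>L. \<exists>Q. finite Q \<and> Q \<subseteq> G \<and> ev (\<lambda>u. (B - C Q u, u) \<in> I) w"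
      using a(4) JE(1) unfolding L_def by blast
    from bchoice[OF this] obtain Q
      where Q: "\<forall>w\<in>L. finite (Q w) \<and> Q w \<subseteq> G \<and> ev (\<lambda>u. (B - C (Q w) u, u) \<in> I) w" by blast
    define Q' where "Q' = (\<Union>w\<in>L. Q w)"
    have Q': "finite Q'" "Q' \<subseteq> G" unfolding Q'_def using Q fL by auto
    have "ev (\<lambda>u. (B - C Q' u, u) \<in> I) v"
    proof (rule ev_glue[OF _ a(3)])
      fix w assume "w \<in> T" "prefix v w" "length w = n"
      then have w: "w \<in> L" unfolding L_def by blast
      then have e: "ev (\<lambda>u. (B - C (Q w) u, u) \<in> I) w" using Q by blast
      show "ev (\<lambda>u. (B - C Q' u, u) \<in> I) w"
      proof (rule ev_mono[OF e])
        fix u assume "u \<in> T" and m: "(B - C (Q w) u, u) \<in> I"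
        have "B - C Q' u \<subseteq> B - C (Q w) u" using CM[of "Q w" Q' u] w unfolding Q'_def by blast
        then show "(B - C Q' u, u) \<in> I"
          using ideal_down[OF I m] simple_Diff[OF a(1) sC[OF Q']] by blast
      qed
    qed
    then show "(B, v) \<in> J" using JI[OF a(1,2) Q'] by blast
  next
    fix B v g assume a: "(B, v) \<in> J" and g: "g \<in> G"
    obtain Q where Q: "finite Q" "Q \<subseteq> G" "ev (\<lambda>u. (B - C Q u, u) \<in> I) v" using JE(1)[OF a] by blast
    have sB: "simple B" and vT: "v \<in> T" using JE[OF a] by auto
    define Q' where "Q' = (+) g ` Q"
    have Q': "finite Q'" "Q' \<subseteq> G" unfolding Q'_def using Q g add_G by auto
    have sB': "simple (\<Phi> g ` B)" using simple_image[OF g sB] .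
    have "ev (\<lambda>u. (\<Phi> g ` B - C Q' u, u) \<in> I) (\<tau> g v)"
    proof (rule ev_act[OF Q(3) g vT])
      fix u assume u: "u \<in> T" and m: "(B - C Q u, u) \<in> I"
      have "\<Phi> g ` B - C Q' (\<tau> g u) \<subseteq> \<Phi> g ` (B - C Q u)"
      proof
        fix y assume y: "y \<in> \<Phi> g ` B - C Q' (\<tau> g u)"
        then obtain b where b: "b \<in> B" "y = \<Phi> g b" by blast
        have "b \<notin> C Q u"
        proof
          assume "b \<in> C Q u"
          then obtain h b0 where h: "h \<in> Q" "prefix (\<tau> h v0) u" "b0 \<in> B0" "b = \<Phi> h b0" unfolding C_def by blast
          have hG: "h \<in> G" using h Q by blast
          have "b0 \<in> X" using h(3) simple_sub[OF B0] by blast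
          then have "y = \<Phi> (g + h) b0" using Phi_add[OF g hG] b(2) h(4) by simp
          moreover have "prefix (\<tau> (g + h) v0) (\<tau> g u)"
            unfolding act_add[OF g hG v0] by (rule act_prefix[OF g act_T[OF hG v0] u h(2)])
          moreover have "g + h \<in> Q'" unfolding Q'_def using h(1) by blast
          ultimately have "y \<in> C Q' (\<tau> g u)" unfolding C_def using h(3) by blast
          then show False using y by blast
        qed
        then show "y \<in> \<Phi> g ` (B - C Q u)" using b by blast
      qed
      then show "(\<Phi> g ` B - C Q' (\<tau> g u), \<tau> g u) \<in> I"
        using ideal_down[OF I ideal_act[OF I m g]] simple_Diff[OF sB' sC[OF Q']] by blast
    qed
    then show "(\<Phi> g ` B, \<tau> g v) \<in> J" using JI[OF sB' act_T[OF g vT] Q'] by blast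
  qed
  moreover have "I \<subseteq> J"
  proof
    fix p assume p: "p \<in> I"
    obtain B v where Bv: "p = (B, v)" by (cases p)
    have "ev (\<lambda>u. (B - C {} u, u) \<in> I) v"
      unfolding ev_def C_def using p Bv ideal_prefix[OF I] by auto
    then show "p \<in> J" unfolding Bv
      by (intro JI[where Q = "{}"]) (use p Bv ideal_simple[OF I] ideal_T[OF I] in auto)
  qed
  moreover have "J \<noteq> I"
  proof -
    have e: "B0 - C {0} u = {}" if "prefix v0 u" for u
    proof -
      have "x \<in> \<Phi> 0 ` B0" if "x \<in> B0" for x using Phi_0[of x] that simple_sub[OF B0] by force
      then show ?thesis unfolding C_def using act_0[OF v0] \<open>prefix v0 u\<close> by auto
    qed
    have "(B0 - C {0} u, u) \<in> I" if "u \<in> T" "prefix v0 u" for u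
      unfolding e[OF that(2)] using ideal_empty[OF I that(1)] .
    then have "ev (\<lambda>u. (B0 - C {0} u, u) \<in> I) v0" unfolding ev_def by blast
    then have "(B0, v0) \<in> J" by (intro JI[where Q = "{0}"]) (use B0 v0 zero_G in auto)
    moreover have "(B0, v0) \<notin> I" using mem_ideal_iff[OF v0 B0] ne by blast
    ultimately show ?thesis by blast
  qed
  ultimately have "(X, []) \<in> J" using maximal by blast
  then obtain Q where Q: "finite Q" "Q \<subseteq> G" "ev (\<lambda>u. (X - C Q u, u) \<in> I) []" using JE(1) by blast
  then obtain n where n: "\<And>u. u \<in> T \<Longrightarrow> n \<le> length u \<Longrightarrow> (X - C Q u, u) \<in> I" unfolding ev_def by auto
  have "\<exists>g\<in>Q. prefix (\<tau> g v0) u \<and> x \<in> \<Phi> g ` B0" if u: "u \<in> T" "n \<le> length u" and x: "x \<in> res u" for u x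
  proof -
    have "(X - C Q u) \<inter> res u = {}"
      using mem_ideal_iff[OF u(1) simple_Diff[OF simple_UNIV sC[OF Q(1,2)]]] n[OF u] by blast
    then have "x \<in> C Q u" using x res_sub by blast
    then show ?thesis unfolding C_def by blast
  qed
  then show ?thesis using that Q by blast
qed

lemma len_res_level:
  assumes "v \<in> T" "w \<in> T" "length v = length w"
  shows "len (res v) = len (res w)"
proof -
  obtain g where "g \<in> G" "\<tau> g v = w" using level_transitive assms by blast
  then show ?thesis using res_image simple_len_image res_simple assms by metis
qed

text \<open>The count is invariant under the group. \<open>B0\<close> consists of the points of
  \<open>res []\<close> that lie in every set containing a point \<open>x0\<close> of maximal count,
  so its points have maximal count too; its translates cover \<open>res []\<close>.\<close>

lemma res_multiplicity:
  "\<exists>k. \<forall>x\<in>res []. card {v \<in> T. length v = n \<and> x \<in> res v} = k"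
proof -
  define L where "L = {v \<in> T. length v = n}"
  have fL: "finite L" unfolding L_def by (rule finite_level)
  define c where "c x = card {v \<in> L. x \<in> res v}" for x
  have "\<exists>x. x \<in> res [] \<and> (\<forall>y. y \<in> res [] \<longrightarrow> c y \<le> c x)"
  proof -
    obtain x where x: "x \<in> res []" using res_Nil by blast
    show ?thesis
    proof (rule ex_has_greatest_nat)
      show "x \<in> res []" by (rule x)
      show "\<forall>y. y \<in> res [] \<longrightarrow> c y < Suc (card L)"
        unfolding c_def using fL by (auto intro!: card_mono simp: less_Suc_eq_le)
    qed
  qed
  then obtain x0 where x0: "x0 \<in> res []" and xmax: "\<And>y. y \<in> res [] \<Longrightarrow> c y \<le> c x0" by blast
  define B0 where "B0 = X \<inter> (\<Inter>v\<in>{v \<in> L. x0 \<in> res v} \<union> {[]}. res v)"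
  have sB0: "simple B0" unfolding B0_def
  proof (rule simple_INT)
    show "finite ({v \<in> L. x0 \<in> res v} \<union> {[]})" using fL by simp
    show "simple (res v)" if "v \<in> {v \<in> L. x0 \<in> res v} \<union> {[]}" for v
      using that Nil_T by (intro res_simple) (auto simp: L_def)
  qed
  have "x0 \<in> B0" unfolding B0_def using x0 res_sub by blast
  then obtain Q m where Q: "finite Q" "Q \<subseteq> G"
    "\<And>u x. u \<in> T \<Longrightarrow> m \<le> length u \<Longrightarrow> x \<in> res u \<Longrightarrow> \<exists>g\<in>Q. prefix (\<tau> g []) u \<and> x \<in> \<Phi> g ` B0"
    using res_cover[OF Nil_T sB0] x0 by blast
  have "c x = c x0" if x: "x \<in> res []" for x
  proof -
    obtain u where u: "u \<in> T" "length u = m" "x \<in> res u"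
      using res_extend[OF Nil_T x, of m] by auto
    then obtain g y where g: "g \<in> Q" "y \<in> B0" "x = \<Phi> g y" using Q(3)[of u x] by auto
    have gG: "g \<in> G" using g Q by blast
    have yX: "y \<in> X" and yr: "y \<in> res []" using g(2) unfolding B0_def by auto
    have "{v \<in> L. x0 \<in> res v} \<subseteq> {v \<in> L. y \<in> res v}" using g(2) unfolding B0_def by auto
    then have "c x0 \<le> c y" unfolding c_def using fL by (intro card_mono) auto
    then have "c y = c x0" using xmax[OF yr] by simp
    moreover have "c y \<le> c x"
    proof -
      have "inj_on (\<tau> g) {v \<in> L. y \<in> res v}" unfolding L_def inj_on_def using act_inj[OF gG] by blast
      moreover have "\<tau> g ` {v \<in> L. y \<in> res v} \<subseteq> {v \<in> L. x \<in> res v}"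
        unfolding L_def g(3) using res_act[OF gG] act_T[OF gG] act_length[OF gG] by auto
      ultimately show ?thesis unfolding c_def using fL by (intro card_inj_on_le) auto
    qed
    ultimately show ?thesis using xmax[OF x] by simp
  qed
  then show ?thesis unfolding c_def L_def by (intro exI[of _ "c x0"]) (auto simp: c_def L_def conj_assoc)
qed

text \<open>Integrate the constant multiplicity; by transitivity all sets \<open>res w\<close> of
  the level have the same length.\<close>

lemma len_res_ratio:
  assumes "v \<in> T"
  obtains k where "real (card {w \<in> T. length w = length v}) * len (res v) = real k * len (res [])"
proof -
  define L where "L = {w \<in> T. length w = length v}"
  have fL: "finite L" unfolding L_def by (rule finite_level)
  obtain k where k: "\<And>x. x \<in> res [] \<Longrightarrow> card {w \<in> T. length w = length v \<and> x \<in> res w} = k"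
    using res_multiplicity by blast
  have LT: "w \<in> T" if "w \<in> L" for w using that unfolding L_def by simp
  have ind: "(\<Sum>w\<in>L. indicator (res w) x) = real k * indicator (res []) x" for x :: real
  proof (cases "x \<in> res []")
    case True
    have "(\<Sum>w\<in>L. indicator (res w) x) = real (card {w \<in> L. x \<in> res w})"
      using fL by (simp add: indicator_def sum.If_cases Int_def)
    also have "{w \<in> L. x \<in> res w} = {w \<in> T. length w = length v \<and> x \<in> res w}" unfolding L_def by auto
    finally show ?thesis using k[OF True] True by simp
  next
    case False
    then have "x \<notin> res w" if "w \<in> L" for w using res_mono[OF LT[OF that], of "[]"] by auto
    then show ?thesis using False by simp
  qed
  have "(\<Sum>w\<in>L. len (res w)) = (\<Sum>w\<in>L. integral\<^sup>L lborel (indicator (res w)))"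
    by simp
  also have "\<dots> = integral\<^sup>L lborel (\<lambda>x. \<Sum>w\<in>L. indicator (res w) x)"
    by (rule Bochner_Integration.integral_sum[symmetric])
      (use simple_finite_measure[OF res_simple[OF LT]] in \<open>auto simp: fmeasurable_def intro!: integrable_real_indicator\<close>)
  also have "\<dots> = real k * len (res [])" unfolding ind by simp
  finally have "(\<Sum>w\<in>L. len (res w)) = real k * len (res [])" .
  moreover have "(\<Sum>w\<in>L. len (res w)) = real (card L) * len (res v)"
  proof -
    have "len (res w) = len (res v)" if "w \<in> L" for w
      using len_res_level[OF assms LT[OF that]] that unfolding L_def by simp
    then show ?thesis by simp
  qed
  ultimately show ?thesis using that[of k] unfolding L_def by simp
qed

lemma len_simple_M:
  assumes "cut_set C B" "C \<subseteq> M" shows "len B \<in> M"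
  by (rule len_in_subgroup[OF assms zspan_0 one_M zspan_add zspan_neg])

lemma res_nonempty: assumes "v \<in> T" shows "res v \<noteq> {}"
proof -
  obtain x where "x \<in> res []" using res_Nil by blast
  then obtain w where w: "w \<in> T" "length w = length v" "x \<in> res w" using res_extend[OF Nil_T, of x "length v"] by auto
  then obtain g where "g \<in> G" "\<tau> g w = v" using level_transitive assms by metis
  then show ?thesis using res_image[of g w] w by auto
qed

lemma res_stabilizes:
  obtains v where "v \<in> T" "\<And>u. u \<in> T \<Longrightarrow> prefix v u \<Longrightarrow> res u = res v"
proof -
  define Y where "Y = len (res [])"
  have Y: "Y > 0" unfolding Y_def by (rule len_pos[OF res_simple[OF Nil_T] res_Nil])
  obtain d :: nat where d: "d > 0" "\<And>q::rat. of_rat q * Y \<in> M \<Longrightarrow> of_nat d * q \<in> \<int>"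
    using zspan_denominators[OF finite_A, of Y] Y by auto
  have "\<exists>m::nat. real d * len (res v) = real m * Y" if v: "v \<in> T" for v
  proof -
    define N where "N = card {w \<in> T. length w = length v}"
    have N: "N > 0" unfolding N_def using finite_level[of "length v"] v by (auto simp: card_gt_0_iff)
    obtain k where k: "real N * len (res v) = real k * Y" using len_res_ratio[OF v] unfolding N_def Y_def .
    define q :: rat where "q = of_nat k / of_nat N"
    have lq: "len (res v) = of_rat q * Y" unfolding q_def using k N by (simp add: of_rat_divide field_simps)
    moreover have "len (res v) \<in> M" by (rule len_simple_M[OF res_cut_set[OF v] boundary_M])
    ultimately have "of_nat d * q \<in> \<int>" using d(2) by simp
    then obtain z where z: "of_nat d * q = of_int z" by (auto elim: Ints_cases)
    have "0 \<le> of_nat d * q" unfolding q_def by simp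
    then have "0 \<le> z" using z by simp
    then have z': "of_nat d * q = of_nat (nat z)" using z by simp
    have "real d * len (res v) = of_rat (of_nat d * q) * Y" unfolding lq by (simp add: of_rat_mult)
    also have "\<dots> = real (nat z) * Y" unfolding z' by simp
    finally show ?thesis by blast
  qed
  then obtain m where m: "\<And>v. v \<in> T \<Longrightarrow> real d * len (res v) = real (m v) * Y" by metis
  \<comment> \<open>\<open>m v / d\<close> is the ratio of the lengths of \<open>res v\<close> and
    \<open>res []\<close>. At a vertex where it is least, no descendant can lose a non-empty
    interval.\<close>
  obtain v where v: "v \<in> T" "\<And>u. u \<in> T \<Longrightarrow> m v \<le> m u"
    using ex_has_least_nat[of "\<lambda>v. v \<in> T" "[]" m] Nil_T by blast
  have "res u = res v" if u: "u \<in> T" "prefix v u" for u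
  proof (rule ccontr)
    assume "res u \<noteq> res v"
    then have ne: "res v - res u \<noteq> {}" using res_mono[OF u] by blast
    have s: "simple (res v - res u)" using simple_Diff res_simple u v by blast
    have "res v = res u \<union> (res v - res u)" using res_mono[OF u] by blast
    then have "len (res v) = len (res u) + len (res v - res u)"
      using len_Un[OF res_simple[OF u(1)] s] by (metis Diff_disjoint)
    then have "len (res u) < len (res v)" using len_pos[OF s ne] by simp
    then have "real (m u) * Y < real (m v) * Y" using m[OF u(1)] m[OF v(1)] d(1)
      by (metis mult_strict_left_mono of_nat_0_less_iff)
    then show False using v(2)[OF u(1)] Y by simp
  qed
  then show ?thesis using that v by blast
qed

end

section \<open>Free actions and growth\<close>

text \<open>A gauge of size on the span whose balls grow polynomially, also when representations are
  not unique.\<close>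

definition zbox :: "real set \<Rightarrow> nat \<Rightarrow> real set" where
  "zbox A m = {(\<Sum>a\<in>A. of_int (k a) * a) | k. \<forall>a\<in>A. \<bar>k a\<bar> \<le> int m}"

lemma zspan_zbox: "finite A \<Longrightarrow> x \<in> zspan A \<Longrightarrow> \<exists>m. x \<in> zbox A m"
proof -
  assume A: "finite A" and "x \<in> zspan A"
  then obtain k where k: "x = (\<Sum>a\<in>A. of_int (k a) * a)" unfolding zspan_def by auto
  have "\<bar>k a\<bar> \<le> int (\<Sum>a\<in>A. nat \<bar>k a\<bar>)" if "a \<in> A" for a
  proof -
    have "\<bar>k a\<bar> = int (nat \<bar>k a\<bar>)" by simp
    also have "\<dots> \<le> int (\<Sum>a\<in>A. nat \<bar>k a\<bar>)"
      unfolding of_nat_le_iff by (rule member_le_sum[OF that]) (use A in auto)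
    finally show ?thesis .
  qed
  then show ?thesis unfolding zbox_def using k by blast
qed

lemma zbox_mono: "x \<in> zbox A m \<Longrightarrow> m \<le> n \<Longrightarrow> x \<in> zbox A n"
  unfolding zbox_def by fastforce

lemma zbox_add: "x \<in> zbox A m \<Longrightarrow> y \<in> zbox A n \<Longrightarrow> x + y \<in> zbox A (m + n)"
proof -
  assume "x \<in> zbox A m" "y \<in> zbox A n"
  then obtain k l where k: "x = (\<Sum>a\<in>A. of_int (k a) * a)" "\<forall>a\<in>A. \<bar>k a\<bar> \<le> int m"
    and l: "y = (\<Sum>a\<in>A. of_int (l a) * a)" "\<forall>a\<in>A. \<bar>l a\<bar> \<le> int n" unfolding zbox_def by auto
  have "x + y = (\<Sum>a\<in>A. of_int (k a + l a) * a)" unfolding k l by (simp add: sum.distrib distrib_right)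
  moreover have "\<forall>a\<in>A. \<bar>k a + l a\<bar> \<le> int (m + n)" using k(2) l(2) by fastforce
  ultimately show ?thesis unfolding zbox_def by (intro CollectI exI[of _ "\<lambda>a. k a + l a"]) auto
qed

lemma zbox_0: "0 \<in> zbox A 0"
  unfolding zbox_def by (auto intro!: exI[of _ "\<lambda>_. 0"])

lemma card_zbox:
  assumes "finite A"
  shows "finite (zbox A m)" "card (zbox A m) \<le> (2 * m + 1) ^ card A"
proof -
  define F where "F = (\<Pi>\<^sub>E a\<in>A. {- int m..int m})"
  have "card {- int m..int m} = 2 * m + 1" by (simp add: nat_eq_iff)
  then have F: "finite F" "card F = (2 * m + 1) ^ card A"
    unfolding F_def using assms by (auto simp only: finite_PiE card_PiE finite_atLeastAtMost_int prod_constant)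
  have "zbox A m \<subseteq> (\<lambda>k. \<Sum>a\<in>A. of_int (k a) * a) ` F"
  proof
    fix x assume "x \<in> zbox A m"
    then obtain k where k: "x = (\<Sum>a\<in>A. of_int (k a) * a)" "\<forall>a\<in>A. \<bar>k a\<bar> \<le> int m" unfolding zbox_def by auto
    have "restrict k A \<in> F" unfolding F_def using k(2) by (auto simp: abs_le_iff)
    moreover have "x = (\<Sum>a\<in>A. of_int (restrict k A a) * a)" unfolding k(1) by (rule sum.cong) auto
    ultimately show "x \<in> (\<lambda>k. \<Sum>a\<in>A. of_int (k a) * a) ` F" by blast
  qed
  then show "finite (zbox A m)" "card (zbox A m) \<le> (2 * m + 1) ^ card A"
    using finite_surj[OF F(1)] surj_card_le[OF F(1)] unfolding F(2) by blast+
qed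

text \<open>Words of length exactly \<open>k\<close>; when \<open>0 \<in> S\<close>, these are the
  balls of radius \<open>k\<close> in the generated monoid.\<close>

definition words :: "'g::group_add set \<Rightarrow> nat \<Rightarrow> 'g set" where
  "words S k = sum_list ` {ss. set ss \<subseteq> S \<and> length ss = k}"

lemma words_Suc: "words S (Suc k) = (\<Union>s\<in>S. (+) s ` words S k)"
proof
  show "words S (Suc k) \<subseteq> (\<Union>s\<in>S. (+) s ` words S k)"
    unfolding words_def by (force simp: length_Suc_conv)
  show "(\<Union>s\<in>S. (+) s ` words S k) \<subseteq> words S (Suc k)"
  proof
    fix x assume "x \<in> (\<Union>s\<in>S. (+) s ` words S k)"
    then obtain s ss where "s \<in> S" "set ss \<subseteq> S" "length ss = k" "x = s + sum_list ss"
      unfolding words_def by blast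
    then show "x \<in> words S (Suc k)" unfolding words_def by (intro image_eqI[of _ _ "s # ss"]) auto
  qed
qed

lemma words_zero: "words S 0 = {0}"
  unfolding words_def by auto

lemma words_subset: "S \<subseteq> S' \<Longrightarrow> words S k \<subseteq> words S' k"
  unfolding words_def by blast

lemma finite_words: "finite S \<Longrightarrow> finite (words S k)"
  unfolding words_def using finite_lists_length_eq by auto

lemma words_mono: "0 \<in> S \<Longrightarrow> words S k \<subseteq> words S (Suc k)"
  unfolding words_Suc by force

lemma words_add:
  assumes "x \<in> words S k" "y \<in> words S l" shows "x + y \<in> words S (k + l)"
proof -
  obtain ss tt where s: "set ss \<subseteq> S" "length ss = k" "x = sum_list ss" "set tt \<subseteq> S" "length tt = l" "y = sum_list tt"
    using assms unfolding words_def by auto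
  show ?thesis unfolding words_def by (rule image_eqI[of _ _ "ss @ tt"]) (use s in auto)
qed

text \<open>As soon as two consecutive word balls agree, the generated monoid is finite.\<close>

lemma card_words_ge:
  assumes S: "finite S" "0 \<in> S" and inf: "infinite (\<Union>k. words S k)"
  shows "k + 1 \<le> card (words S k)"
proof (induction k)
  case 0
  show ?case by (simp add: words_zero)
next
  case (Suc k)
  have "words S k \<noteq> words S (Suc k)"
  proof
    assume eq: "words S k = words S (Suc k)"
    have "words S (k + j) = words S k" for j
    proof (induction j)
      case (Suc j)
      have "words S (k + Suc j) = (\<Union>s\<in>S. (+) s ` words S k)" using words_Suc[of S "k + j"] Suc by simp
      also have "\<dots> = words S k" unfolding words_Suc[of S k, symmetric] using eq ..
      finally show ?case .
    qed simp
    moreover have "words S j \<subseteq> words S (j + i)" for i j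
      by (induction i) (use words_mono[OF S(2)] in auto)
    ultimately have "words S j \<subseteq> words S k" for j by (metis add.commute)
    then have "(\<Union>j. words S j) \<subseteq> words S k" by blast
    then show False using inf finite_words[OF S(1)] finite_subset by blast
  qed
  then have "words S k \<subset> words S (Suc k)" using words_mono[OF S(2)] by blast
  then have "card (words S k) < card (words S (Suc k))" using finite_words[OF S(1)] by (rule psubset_card_mono[rotated])
  then show ?case using Suc by simp
qed

context tree_group
begin

text \<open>Non-trivial elements of the rigid stabilizers at the members of an antichain are
  pairwise distinct.\<close>

lemma rist_infinite: assumes "v \<in> T" shows "infinite (rist v)"
proof -
  obtain W :: "nat \<Rightarrow> _" where W: "\<And>l. W l \<in> T" "\<And>l. prefix v (W l)" "\<And>l m. l \<noteq> m \<Longrightarrow> W l \<parallel> W m"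
    using antichain_below[OF assms] by blast
  have "\<forall>l. \<exists>r. r \<in> rist (W l) \<and> r \<noteq> 0" using rist_ex W(1) by metis
  then obtain r where r: "\<And>l. r l \<in> rist (W l)" "\<And>l. r l \<noteq> 0" by metis
  have "inj r"
  proof (rule injI, rule ccontr)
    fix l m assume "r l = r m" "l \<noteq> m"
    then show False using rist_inter[OF W(3), of l m "r l"] r by metis
  qed
  moreover have "range r \<subseteq> rist v" using r(1) rist_mono[OF W(2)] by blast
  ultimately show ?thesis using finite_subset range_inj_infinite by blast
qed

lemma sum_list_fixer: "set ss \<subseteq> fixer U \<Longrightarrow> sum_list ss \<in> fixer U"
  by (induction ss) (auto intro: fixer_0 fixer_add)

text \<open>The supports are disjoint. If two such sums agree, the quotient of the last summands is
  supported both below the last vertex and below the earlier ones, hence trivial, and induction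
  applies to the rest.\<close>

lemma sum_rist_inj:
  fixes n :: nat
  assumes W: "\<And>l m. l \<noteq> m \<Longrightarrow> W l \<parallel> W m"
    and f: "\<And>i. i < n \<Longrightarrow> f i \<in> rist (W i)" "\<And>i. i < n \<Longrightarrow> f' i \<in> rist (W i)"
    and eq: "sum_list (map f [0..<n]) = sum_list (map f' [0..<n])"
  shows "\<forall>i<n. f i = f' i"
  using f eq
proof (induction n)
  case (Suc n)
  define U where "U = {x. \<exists>i<n. prefix (W i) x}"
  have mem: "sum_list (map h [0..<n]) \<in> fixer U" if h: "\<And>i. i < Suc n \<Longrightarrow> h i \<in> rist (W i)" for h
  proof -
    have "h i \<in> fixer U" if i: "i < n" for i
    proof -
      have "{x. prefix (W i) x} \<subseteq> U" unfolding U_def using i by blast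
      then show ?thesis using h[of i] i fixer_mono unfolding rist_def by auto
    qed
    then have "set (map h [0..<n]) \<subseteq> fixer U" by auto
    then show ?thesis by (rule sum_list_fixer)
  qed
  let ?p = "sum_list (map f [0..<n])" and ?p' = "sum_list (map f' [0..<n])"
  have e: "?p + f n = ?p' + f' n" using Suc.prems(3) by simp
  have "- ?p' + (?p + f n) - f n = - ?p' + (?p' + f' n) - f n" unfolding e ..
  then have d: "- ?p' + ?p = f' n - f n"
    by (simp add: add.assoc diff_conv_add_uminus del: add_uminus_conv_diff)
  have "- ?p' + ?p \<in> fixer U" by (intro fixer_add fixer_neg mem Suc.prems)
  moreover have "f' n - f n \<in> fixer {x. prefix (W n) x}"
    using Suc.prems(1,2)[of n] rist_diff unfolding rist_def by blast
  ultimately have "f' n - f n \<in> fixer (U \<inter> {x. prefix (W n) x})" using d by (intro fixer_Int) auto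
  moreover have "U \<inter> {x. prefix (W n) x} = {}"
  proof -
    have "\<not> prefix (W n) x" if "i < n" "prefix (W i) x" for i x
      using W[of i n] that prefix_same_cases by blast
    then show ?thesis unfolding U_def by blast
  qed
  ultimately have z: "f' n - f n = 0" using fixer_empty by auto
  then have "?p = ?p'" using d by (metis add.right_neutral add_minus_cancel)
  then have "\<forall>i<n. f i = f' i" using Suc.IH Suc.prems by simp
  then show ?case using z by (auto simp: less_Suc_eq)
qed simp

end

section \<open>Rigid stabilizers below a vertex with constant residual sets\<close>

context maximal_invariant_ideal
begin

context
  fixes v assumes v: "v \<in> T" and stable: "\<And>u. u \<in> T \<Longrightarrow> prefix v u \<Longrightarrow> res u = res v"
begin

text \<open>Take \<open>u'\<close> below \<open>u\<close>, deep enough for \<open>res_cover\<close>.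
  A translate that counts over \<open>u'\<close> has its vertex above \<open>u'\<close> and at the
  level of \<open>u\<close>, so this vertex is \<open>u\<close>; and \<open>res u'\<close> is all of
  \<open>res v\<close> by stability.\<close>

lemma stable_cover:
  assumes u: "u \<in> T" "prefix v u" and B0: "simple B0" "B0 \<inter> res v \<noteq> {}"
  obtains Q where "finite Q" "Q \<subseteq> {g \<in> G. \<tau> g u = u}" "res v \<subseteq> (\<Union>g\<in>Q. \<Phi> g ` B0)"
proof -
  obtain Q n where Q: "finite Q" "Q \<subseteq> G"
    "\<And>u' x. u' \<in> T \<Longrightarrow> n \<le> length u' \<Longrightarrow> x \<in> res u' \<Longrightarrow> \<exists>g\<in>Q. prefix (\<tau> g u) u' \<and> x \<in> \<Phi> g ` B0"
    using res_cover[OF u(1) B0(1)] B0(2) stable[OF u] by metis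
  obtain u' where u': "u' \<in> T" "prefix u u'" "length u' = max n (length u)"
    using extend_below[OF u(1), of "max n (length u)"] by auto
  have ru': "res u' = res v" using stable[OF u'(1)] u(2) u'(2) prefix_order.trans by blast
  define Q' where "Q' = {g \<in> Q. \<tau> g u = u}"
  have "res v \<subseteq> (\<Union>g\<in>Q'. \<Phi> g ` B0)"
  proof
    fix x assume "x \<in> res v"
    then obtain g where g: "g \<in> Q" "prefix (\<tau> g u) u'" "x \<in> \<Phi> g ` B0" using Q(3)[OF u'(1), of x] u'(3) ru' by auto
    have "\<tau> g u = u" using g(2) u'(2) act_length[of g u] u(1) g(1) Q(2)
      by (metis parallelE prefix_same_cases same_length_parallel subsetD)
    then show "x \<in> (\<Union>g\<in>Q'. \<Phi> g ` B0)" unfolding Q'_def using g by blast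
  qed
  then show ?thesis using that[of Q'] Q unfolding Q'_def by auto
qed

text \<open>Some element of \<open>rist'' u\<close> moves a point of \<open>res v\<close>, since
  otherwise \<open>(res v, u)\<close> would lie in \<open>nul\<close>. Conjugates by elements fixing
  \<open>u\<close> stay in \<open>rist'' u\<close>, and by \<open>stable_cover\<close> the
  corresponding translates of its support cover \<open>res v\<close>.\<close>

lemma rist''_moves_all:
  assumes u: "u \<in> T" "prefix v u" and y: "y \<in> res v"
  obtains r where "r \<in> rist'' u" "\<Phi> r y \<noteq> y"
proof -
  have "\<exists>r\<in>rist'' u. \<exists>z\<in>res v. \<Phi> r z \<noteq> z"
  proof (rule ccontr)
    assume neg: "\<not> ?thesis"
    have "ev (\<lambda>w. \<forall>r\<in>rist'' w. \<forall>x\<in>res v. \<Phi> r x = x) u"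
      unfolding ev_def using neg rist''_mono by blast
    then have "(res v, u) \<in> nul" unfolding nul_def using u res_simple[OF v] by blast
    then have "(res v, u) \<in> I" using nulI by blast
    then have "res v \<inter> res u = {}" using mem_ideal_iff[OF u(1) res_simple[OF v]] by blast
    then show False using stable[OF u] y by blast
  qed
  then obtain r z where r: "r \<in> rist'' u" "z \<in> res v" "\<Phi> r z \<noteq> z" by blast
  have rG: "r \<in> G" using rist''_G[OF r(1)] .
  define B0 where "B0 = X - {x \<in> X. \<Phi> r x = x}"
  have sB: "simple B0" unfolding B0_def by (rule simple_Diff[OF simple_UNIV simple_fixed[OF rG]])
  have nB: "B0 \<inter> res v \<noteq> {}" unfolding B0_def using r res_sub by blast
  obtain Q where Q: "finite Q" "Q \<subseteq> {g \<in> G. \<tau> g u = u}" "res v \<subseteq> (\<Union>g\<in>Q. \<Phi> g ` B0)"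
    using stable_cover[OF u sB nB] .
  then obtain g b where g: "g \<in> Q" "b \<in> B0" "y = \<Phi> g b" using y by blast
  have gG: "g \<in> G" "\<tau> g u = u" using g Q by auto
  have bX: "b \<in> X" "\<Phi> r b \<noteq> b" using g(2) unfolding B0_def by auto
  have r': "g + r - g \<in> rist'' u" using rist''_conj[OF r(1) gG(1) u(1)] gG(2) by simp
  have "\<Phi> (g + r - g) y \<noteq> y"
  proof
    assume "\<Phi> (g + r - g) y = y"
    moreover have "\<Phi> ((g + r) + - g) y = \<Phi> (g + r) (\<Phi> (- g) y)"
      by (rule Phi_add) (use gG rG add_G neg_G g(3) Phi_in[OF gG(1) bX(1)] in auto)
    ultimately have "\<Phi> (g + r) b = \<Phi> g b" using g(3) gG bX by simp
    then have "\<Phi> g (\<Phi> r b) = \<Phi> g b" using Phi_add[OF gG(1) rG bX(1)] by simp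
    then show False using Phi_inj[OF gG(1)] bX Phi_in[OF rG bX(1)] by (metis inj_onD)
  qed
  then show ?thesis using that r' by blast
qed

lemma rist_free:
  assumes p: "p \<in> rist v" "p \<noteq> 0" and z: "z \<in> res v"
  shows "\<Phi> p z \<noteq> z"
proof
  assume fz: "\<Phi> p z = z"
  have pG: "p \<in> G" using p rist_G by blast
  define B0 where "B0 = {x \<in> X. \<Phi> p x = x}"
  have sB: "simple B0" unfolding B0_def by (rule simple_fixed[OF pG])
  have nB: "B0 \<inter> res v \<noteq> {}" unfolding B0_def using z fz res_sub by blast
  obtain Q where Q: "finite Q" "Q \<subseteq> {g \<in> G. \<tau> g v = v}" "res v \<subseteq> (\<Union>g\<in>Q. \<Phi> g ` B0)"
    using stable_cover[OF v prefix_order.refl sB nB] .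
  \<comment> \<open>Translates of the fixed set of \<open>p\<close> cover \<open>res v\<close>, so
    each point of \<open>res v\<close> is fixed by a conjugate in \<open>P\<close>; the conjugating
    elements fix \<open>v\<close>, which keeps \<open>P\<close> inside
    \<open>rist v\<close>.\<close>
  define P where "P = (\<lambda>g. g + p - g) ` Q"
  define H where "H = {g \<in> G. \<Phi> g z = z}"
  have zX: "z \<in> X" using z res_sub by blast
  obtain w where w: "w \<in> T" "prefix v w" "rist'' w \<subseteq> H"
  proof (rule confined_contains_rist''[where H = H and P = P and v = v])
    show "g + h \<in> H" if "g \<in> H" "h \<in> H" for g h using that Phi_add[of g h z] zX add_G unfolding H_def by simp
    show "- g \<in> H" if "g \<in> H" for g
      using that Phi_neg_Phi[of g z] zX neg_G unfolding H_def by force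
    show "v \<in> T" by (rule v)
    show "finite P" unfolding P_def using Q by blast
    show "P \<subseteq> rist v"
    proof
      fix q assume "q \<in> P"
      then obtain g where g: "g \<in> Q" "q = g + p - g" unfolding P_def by blast
      then have "g \<in> G" "\<tau> g v = v" using Q by auto
      then show "q \<in> rist v" using rist_conj[OF p(1) _ v, of g] g(2) by simp
    qed
    show "0 \<notin> P"
    proof
      assume "0 \<in> P"
      then obtain g where "g + p - g = 0" unfolding P_def by force
      then have "g + p = g + 0" by simp
      then show False using p(2) add_left_imp_eq by blast
    qed
    fix g assume g: "g \<in> rist v"
    have gG: "g \<in> G" using g rist_G by blast
    have "\<Phi> g z \<in> res v" using res_act[OF gG v z] rist_fixes[OF g v] by simp
    then obtain h b where h: "h \<in> Q" "b \<in> B0" "\<Phi> g z = \<Phi> h b" using Q(3) by blast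
    have hG: "h \<in> G" using h Q by blast
    have bX: "b \<in> X" "\<Phi> p b = b" using h(2) unfolding B0_def by auto
    define q where "q = h + p - h"
    have qG: "q \<in> G" unfolding q_def using hG pG add_G diff_G by blast
    have "\<Phi> ((h + p) + - h) (\<Phi> h b) = \<Phi> (h + p) (\<Phi> (- h) (\<Phi> h b))"
      by (rule Phi_add) (use hG pG add_G neg_G Phi_in[OF hG bX(1)] in auto)
    then have "\<Phi> q (\<Phi> g z) = \<Phi> g z" unfolding h(3) q_def using hG pG bX Phi_add[OF hG pG bX(1)] by simp
    moreover have "\<Phi> (- g + q + g) z = \<Phi> (- g) (\<Phi> q (\<Phi> g z))"
      using Phi_add[of "- g + q" g z] Phi_add[of "- g" q "\<Phi> g z"] gG qG neg_G add_G zX Phi_in by simp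
    ultimately have "\<Phi> (- g + q + g) z = z" using gG zX by simp
    moreover have "- g + q + g \<in> G" using gG qG neg_G add_G by blast
    moreover have "q \<in> P" unfolding P_def q_def using h(1) by blast
    ultimately show "\<exists>p\<in>P. - g + p + g \<in> H" unfolding H_def by blast
  qed blast
  obtain r where "r \<in> rist'' w" "\<Phi> r z \<noteq> z" using rist''_moves_all[OF w(1,2) z] .
  then show False using w(3) unfolding H_def by blast
qed

lemma rist_preserves_res: "f \<in> rist v \<Longrightarrow> z \<in> res v \<Longrightarrow> \<Phi> f z \<in> res v"
  using res_act[OF rist_G v] rist_fixes[OF _ v] by metis

lemma rist_orbit_inj:
  assumes "f \<in> rist v" "h \<in> rist v" "z \<in> res v" "\<Phi> f z = \<Phi> h z"
  shows "f = h"
proof (rule ccontr)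
  assume "f \<noteq> h"
  have G: "f \<in> G" "h \<in> G" and zX: "z \<in> X" using assms(1,2) rist_G subsetD[OF res_sub assms(3)] by blast+
  have "\<Phi> (- h + f) z = \<Phi> (- h) (\<Phi> f z)" using Phi_add[of "- h" f z] G neg_G zX by simp
  also have "\<dots> = z" unfolding assms(4) using G zX by simp
  finally have "\<Phi> (- h + f) z = z" .
  moreover have "- h + f \<in> rist v" using assms rist_add rist_neg by blast
  moreover have "- h + f \<noteq> 0"
  proof
    assume "- h + f = 0"
    then have "h + (- h + f) = h + 0" by simp
    then show False using \<open>f \<noteq> h\<close> by (simp add: add_minus_cancel)
  qed
  ultimately show False using rist_free assms(3) by blast
qed

text \<open>A finite subgroup of the freely acting \<open>rist v\<close> has a fundamental domain of measure
  \<open>len (res v) / card F\<close>, which lies in the finitely generated group \<open>M\<close>.\<close>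

lemma finite_subgroup_bound:
  obtains d :: nat where "\<And>F. finite F \<Longrightarrow> F \<subseteq> rist v \<Longrightarrow> 0 \<in> F \<Longrightarrow>
    (\<And>f h. f \<in> F \<Longrightarrow> h \<in> F \<Longrightarrow> f + h \<in> F) \<Longrightarrow> (\<And>f. f \<in> F \<Longrightarrow> - f \<in> F) \<Longrightarrow> card F \<le> d"
proof -
  define Y where "Y = len (res v)"
  have Y: "Y > 0" unfolding Y_def by (rule len_pos[OF res_simple[OF v] res_nonempty[OF v]])
  obtain d :: nat where d: "d > 0" "\<And>q::rat. of_rat q * Y \<in> M \<Longrightarrow> of_nat d * q \<in> \<int>"
    using zspan_denominators[OF finite_A, of Y] Y by auto
  have "card F \<le> d" if F: "finite F" "F \<subseteq> rist v" "0 \<in> F" and Fadd: "\<And>f h. f \<in> F \<Longrightarrow> h \<in> F \<Longrightarrow> f + h \<in> F"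
    and Fneg: "\<And>f. f \<in> F \<Longrightarrow> - f \<in> F" for F
  proof -
    have FG: "f \<in> G" if "f \<in> F" for f using that F(2) rist_G by blast
    have "\<forall>f\<in>F. \<exists>C. C \<subseteq> M \<and> ptrans C (\<Phi> f)" using G_ptrans FG by blast
    from bchoice[OF this] obtain C where C: "\<forall>f\<in>F. C f \<subseteq> M \<and> ptrans (C f) (\<Phi> f)" by blast
    \<comment> \<open>The least point of each \<open>F\<close>-orbit in \<open>res v\<close>.
      Whether \<open>x \<le> \<Phi> f x\<close> holds is constant between cut points, so this
      fundamental domain is a finite union of intervals with cut points in \<open>M\<close>.\<close>
    define E where "E = {x \<in> res v. \<forall>f\<in>F. x \<le> \<Phi> f x}"
    define C' where "C' = boundary (length v) \<union> (\<Union>f\<in>F. C f)"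
    have C'fin: "finite C'" unfolding C'_def using finite_boundary F(1) C unfolding ptrans_def by auto
    have C'M: "C' \<subseteq> M" unfolding C'_def using boundary_M C by blast
    have cE: "cut_set C' E"
      unfolding cut_set_def
    proof (intro conjI allI impI C'fin)
      show "E \<subseteq> X" unfolding E_def using res_sub by blast
      fix x y :: real assume xy: "0 \<le> x" "x < y" "y < 1" "{x<..y} \<inter> C' = {}"
      have "x \<in> res v \<longleftrightarrow> y \<in> res v"
        by (rule cut_setD[OF res_cut_set[OF v] xy(1-3)]) (use xy(4) in \<open>auto simp: C'_def\<close>)
      moreover have "x \<le> \<Phi> f x \<longleftrightarrow> y \<le> \<Phi> f y" if f: "f \<in> F" for f
      proof -
        have "{x<..y} \<inter> C f = {}" using xy(4) f unfolding C'_def by blast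
        then have "\<Phi> f y = \<Phi> f x + (y - x)" using ptransD[of "C f" "\<Phi> f" x y] C f xy by blast
        then show ?thesis by linarith
      qed
      ultimately show "x \<in> E \<longleftrightarrow> y \<in> E" unfolding E_def by blast
    qed
    then have sE: "simple E" unfolding simple_def by blast
    have Er: "E \<subseteq> res v" unfolding E_def by blast
    have "res v = (\<Union>f\<in>F. \<Phi> f ` E)"
    proof
      show "(\<Union>f\<in>F. \<Phi> f ` E) \<subseteq> res v" using rist_preserves_res F(2) Er by blast
      show "res v \<subseteq> (\<Union>f\<in>F. \<Phi> f ` E)"
      proof
        fix x assume x: "x \<in> res v"
        have xX: "x \<in> X" using x res_sub by blast
        have "finite ((\<lambda>f. \<Phi> f x) ` F)" "(\<lambda>f. \<Phi> f x) ` F \<noteq> {}" using F by auto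
        then have "Min ((\<lambda>f. \<Phi> f x) ` F) \<in> (\<lambda>f. \<Phi> f x) ` F" by (rule Min_in)
        then obtain f where f: "f \<in> F" "Min ((\<lambda>f. \<Phi> f x) ` F) = \<Phi> f x" by blast
        have mf: "\<Phi> f x \<le> \<Phi> h x" if "h \<in> F" for h
          using Min_le[of "(\<lambda>f. \<Phi> f x) ` F" "\<Phi> h x"] F(1) that f(2) by auto
        have "\<Phi> f x \<le> \<Phi> h (\<Phi> f x)" if h: "h \<in> F" for h
          using mf[OF Fadd[OF h f(1)]] Phi_add[OF FG[OF h] FG[OF f(1)] xX] by simp
        then have "\<Phi> f x \<in> E" unfolding E_def using rist_preserves_res[OF _ x] f F(2) by blast
        moreover have "x = \<Phi> (- f) (\<Phi> f x)" using FG[OF f(1)] xX by simp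
        ultimately show "x \<in> (\<Union>f\<in>F. \<Phi> f ` E)" using Fneg[OF f(1)] by blast
      qed
    qed
    moreover have "\<Phi> f ` E \<inter> \<Phi> h ` E = {}" if fh: "f \<in> F" "h \<in> F" "f \<noteq> h" for f h
    proof (rule ccontr)
      assume "\<Phi> f ` E \<inter> \<Phi> h ` E \<noteq> {}"
      then obtain t where "t \<in> \<Phi> f ` E" "t \<in> \<Phi> h ` E" by blast
      then obtain x y where xy: "x \<in> E" "y \<in> E" "\<Phi> f x = \<Phi> h y" by force
      have le: "b \<le> a" if ab: "a \<in> E" "b \<in> E" "p \<in> F" "q \<in> F" "\<Phi> p a = \<Phi> q b" for a b p q
      proof -
        have aX: "a \<in> X" "b \<in> X" "p \<in> G" "q \<in> G"
          using subsetD[OF res_sub subsetD[OF Er ab(1)]] subsetD[OF res_sub subsetD[OF Er ab(2)]]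
            FG[OF ab(3)] FG[OF ab(4)] by blast+
        have "\<Phi> (- p + q) b = \<Phi> (- p) (\<Phi> p a)" using Phi_add[of "- p" q b] aX neg_G ab(5) by simp
        also have "\<dots> = a" using aX by simp
        finally have "a = \<Phi> (- p + q) b" by simp
        moreover have "b \<le> \<Phi> (- p + q) b" using ab(2) Fadd[OF Fneg[OF ab(3)] ab(4)] unfolding E_def by blast
        ultimately show ?thesis by simp
      qed
      have "x = y" using le[OF xy(1,2) fh(1,2) xy(3)] le[OF xy(2,1) fh(2,1) xy(3)[symmetric]] by simp
      then have "f = h" using rist_orbit_inj[of f h x] subsetD[OF Er xy(1)] subsetD[OF F(2) fh(1)]
          subsetD[OF F(2) fh(2)] xy(3) by blast
      then show False using fh by simp
    qed
    moreover have "simple (\<Phi> f ` E)" if "f \<in> F" for f using simple_image[OF FG[OF that] sE] .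
    ultimately have "Y = (\<Sum>f\<in>F. len (\<Phi> f ` E))" unfolding Y_def using len_UN[OF F(1), of "\<lambda>f. \<Phi> f ` E"] by simp
    also have "\<dots> = real (card F) * len E" using simple_len_image[OF FG sE] by simp
    finally have YE: "Y = real (card F) * len E" .
    have cF: "card F > 0" using F by (auto simp: card_gt_0_iff)
    have "len E = of_rat (1 / of_nat (card F)) * Y" unfolding YE using cF by (simp add: of_rat_divide)
    then have "of_rat (1 / of_nat (card F)) * Y \<in> M" using len_simple_M[OF cE C'M] by metis
    \<comment> \<open>So \<open>d / card F\<close> is a positive integer and \<open>card F\<close>
      is at most \<open>d\<close>.\<close>
    then have "of_nat d * (1 / of_nat (card F)) \<in> (\<int> :: rat set)" by (rule d(2))
    then obtain z where z: "of_nat d * (1 / of_nat (card F)) = (of_int z :: rat)" by (auto elim: Ints_cases)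
    then have "(of_nat d :: rat) = of_int z * of_nat (card F)" using cF by (simp add: field_simps)
    then have dz: "int d = z * int (card F)" by (metis of_int_eq_iff of_int_mult of_int_of_nat_eq)
    have "z > 0" using dz d(1) cF by (metis of_nat_0_less_iff zero_less_mult_pos2)
    then have "int (card F) \<le> int d" unfolding dz using mult_right_mono[of 1 z "int (card F)"] by simp
    then show ?thesis by simp
  qed
  then show ?thesis using that by blast
qed

text \<open>A finite submonoid of a group is a subgroup, since translation by an element is
  injective and hence onto. The monoid generated by \<open>d + 1\<close> elements can therefore not
  be finite, as finite subgroups of \<open>rist v\<close> have order at most
  \<open>d\<close>.\<close>

lemma rist_infinite_fg:
  assumes u: "u \<in> T" "prefix v u"
  obtains S' where "finite S'" "S' \<subseteq> rist u" "0 \<in> S'" "infinite (\<Union>k. words S' k)"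
proof -
  obtain d :: nat where d: "\<And>F. finite F \<Longrightarrow> F \<subseteq> rist v \<Longrightarrow> 0 \<in> F \<Longrightarrow>
    (\<And>f h. f \<in> F \<Longrightarrow> h \<in> F \<Longrightarrow> f + h \<in> F) \<Longrightarrow> (\<And>f. f \<in> F \<Longrightarrow> - f \<in> F) \<Longrightarrow> card F \<le> d"
    using finite_subgroup_bound by blast
  obtain R where R: "finite R" "card R = d + 1" "R \<subseteq> rist u"
    using infinite_arbitrarily_large[OF rist_infinite[OF u(1)], of "d + 1"] by auto
  define S' where "S' = insert 0 R"
  have S': "finite S'" "S' \<subseteq> rist u" "0 \<in> S'" unfolding S'_def using R rist_0 by auto
  define F where "F = (\<Union>k. words S' k)"
  have "infinite F"
  proof
    assume fin: "finite F"
    have Fadd: "f + h \<in> F" if "f \<in> F" "h \<in> F" for f h using that words_add unfolding F_def by blast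
    have F0: "0 \<in> F" unfolding F_def words_def by (intro UN_I[of 0]) auto
    have Fr: "F \<subseteq> rist u"
    proof -
      have "sum_list ss \<in> rist u" if "set ss \<subseteq> S'" for ss
        using that by (induction ss) (use rist_0 rist_add S'(2) in auto)
      then show ?thesis unfolding F_def words_def by auto
    qed
    have Fneg: "- f \<in> F" if f: "f \<in> F" for f
    proof -
      have "(+) f ` F = F" by (rule endo_inj_surj[OF fin]) (use Fadd f in auto)
      then obtain h where h: "h \<in> F" "f + h = 0" using F0 by (metis imageE)
      then have "h = - f" by (metis add.right_neutral minus_add_cancel)
      then show ?thesis using h by simp
    qed
    have "F \<subseteq> rist v" using Fr rist_mono[OF u(2)] by blast
    then have "card F \<le> d" using d[OF fin _ F0 Fadd Fneg] by blast
    moreover have "R \<subseteq> F"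
    proof
      fix r assume "r \<in> R"
      then show "r \<in> F" unfolding F_def words_def S'_def by (intro UN_I[of 1] image_eqI[of _ _ "[r]"]) auto
    qed
    then have "card R \<le> card F" by (rule card_mono[OF fin])
    ultimately show False using R(2) by linarith
  qed
  then show ?thesis using that S' unfolding F_def by blast
qed

text \<open>A piecewise translation has only finitely many displacements, those at \<open>0\<close>
  and at the cut points, and each of them lies in some box.\<close>

lemma displacement_box:
  assumes "finite S'" "S' \<subseteq> G"
  obtains c where "\<And>s x. s \<in> S' \<Longrightarrow> x \<in> X \<Longrightarrow> \<Phi> s x - x \<in> zbox A c"
proof -
  have "\<exists>c. \<forall>s\<in>S'. \<forall>x\<in>X. \<Phi> s x - x \<in> zbox A c"
    using assms
  proof (induction S' rule: finite_induct)
    case (insert s S')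
    then obtain c where c: "\<forall>s\<in>S'. \<forall>x\<in>X. \<Phi> s x - x \<in> zbox A c" by auto
    have sG: "s \<in> G" using insert by auto
    obtain C where C: "ptrans C (\<Phi> s)" using G_ptrans[OF sG] by blast
    define K where "K = (insert 0 C) \<inter> X"
    have Kfin: "finite K" unfolding K_def using C unfolding ptrans_def by auto
    have "\<forall>k\<in>K. \<exists>m. \<Phi> s k - k \<in> zbox A m" using zspan_zbox[OF finite_A] disp_G[OF sG] unfolding K_def by blast
    from bchoice[OF this] obtain m where m: "\<forall>k\<in>K. \<Phi> s k - k \<in> zbox A (m k)" by blast
    define c' where "c' = (\<Sum>k\<in>K. m k)"
    have "\<Phi> s x - x \<in> zbox A c'" if x: "x \<in> X" for x
    proof -
      obtain k where k: "k \<in> insert 0 C" "0 \<le> k" "k \<le> x" "\<Phi> s x = \<Phi> s k + (x - k)"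
        using ptrans_cell[OF C, of x] x by auto
      have kK: "k \<in> K" unfolding K_def using k x by auto
      have "m k \<le> c'" unfolding c'_def using member_le_sum[OF kK, of m] Kfin by simp
      then have "\<Phi> s k - k \<in> zbox A c'" using m kK zbox_mono by blast
      then show ?thesis using k(4) by simp
    qed
    then have "\<forall>t\<in>insert s S'. \<forall>x\<in>X. \<Phi> t x - x \<in> zbox A (c + c')"
      using c zbox_mono[of _ A c "c + c'"] zbox_mono[of _ A c' "c + c'"] by auto
    then show ?case by blast
  qed simp
  then show ?thesis using that by blast
qed

text \<open>The orbit of a point under a finitely generated group grows at most polynomially of
  degree \<open>card A\<close>, whereas \<open>card A + 1\<close> commuting infinite subgroups acting freely force
  faster growth.\<close>

lemma stable_contradiction: False
proof -
  \<comment> \<open>One factor more than the degree \<open>card A\<close> of the polynomial that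
    bounds the boxes.\<close>
  define N where "N = card A + 1"
  obtain W :: "nat \<Rightarrow> _" where W: "\<And>l. W l \<in> T" "\<And>l. prefix v (W l)" "\<And>l m. l \<noteq> m \<Longrightarrow> W l \<parallel> W m"
    using antichain_below[OF v] by blast
  have "\<forall>l. \<exists>S'. finite S' \<and> S' \<subseteq> rist (W l) \<and> 0 \<in> S' \<and> infinite (\<Union>k. words S' k)"
  proof
    fix l
    obtain S' where "finite S'" "S' \<subseteq> rist (W l)" "0 \<in> S'" "infinite (\<Union>k. words S' k)"
      using rist_infinite_fg[OF W(1)[of l] W(2)[of l]] .
    then show "\<exists>S'. finite S' \<and> S' \<subseteq> rist (W l) \<and> 0 \<in> S' \<and> infinite (\<Union>k. words S' k)" by blast
  qed
  from choice[OF this] obtain R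
    where R': "\<forall>l. finite (R l) \<and> R l \<subseteq> rist (W l) \<and> 0 \<in> R l \<and> infinite (\<Union>k. words (R l) k)" ..
  have R: "finite (R l)" "R l \<subseteq> rist (W l)" "0 \<in> R l" "infinite (\<Union>k. words (R l) k)" for l
    using R' by simp_all
  define S' where "S' = (\<Union>i<N. R i)"
  have Sv: "S' \<subseteq> rist v" unfolding S'_def using R(2) rist_mono[OF W(2)] by blast
  have SG: "S' \<subseteq> G" using Sv rist_G by blast
  have Sfin: "finite S'" unfolding S'_def using R(1) by blast
  obtain c where c: "\<And>s x. s \<in> S' \<Longrightarrow> x \<in> X \<Longrightarrow> \<Phi> s x - x \<in> zbox A c" using displacement_box[OF Sfin SG] by blast
  obtain z where z: "z \<in> res v" using res_nonempty[OF v] by blast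
  have zX: "z \<in> X" using z res_sub by blast
  have word: "sum_list ss \<in> rist v \<and> \<Phi> (sum_list ss) z - z \<in> zbox A (length ss * c)" if "set ss \<subseteq> S'" for ss
    using that
  proof (induction ss)
    case Nil then show ?case using rist_0 Phi_0[OF zX] zbox_0 by simp
  next
    case (Cons s ss)
    then have IH: "sum_list ss \<in> rist v" "\<Phi> (sum_list ss) z - z \<in> zbox A (length ss * c)" and s: "s \<in> S'" by auto
    have G: "s \<in> G" "sum_list ss \<in> G" using s SG IH rist_G by auto
    let ?y = "\<Phi> (sum_list ss) z"
    have "(\<Phi> s ?y - ?y) + (?y - z) \<in> zbox A (c + length ss * c)"
      by (rule zbox_add[OF c[OF s Phi_in[OF G(2) zX]] IH(2)])
    then have "\<Phi> (s + sum_list ss) z - z \<in> zbox A (c + length ss * c)" using Phi_add[OF G zX] by simp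
    moreover have "s + sum_list ss \<in> rist v" using rist_add s Sv IH(1) by blast
    ultimately show ?case by simp
  qed
  \<comment> \<open>On the left, tuples of words of length \<open>k\<close>, one for each of
    \<open>N\<close> incomparable vertices. On the right, the possible displacements of
    \<open>z\<close> under their sums, which are words of length \<open>N * k\<close>. By freeness
    and disjointness of supports the displacement determines the tuple.\<close>
  have bound: "(k + 1) ^ N \<le> (2 * (N * k * c) + 1) ^ card A" for k
  proof -
    define F where "F = (\<Pi>\<^sub>E i\<in>{..<N}. words (R i) k)"
    define h where "h f = sum_list (map f [0..<N])" for f :: "nat \<Rightarrow> 'b"
    have "card F = (\<Prod>i<N. card (words (R i) k))" unfolding F_def by (simp add: card_PiE)
    moreover have "(\<Prod>i<N. k + 1) \<le> (\<Prod>i<N. card (words (R i) k))"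
      by (rule prod_mono) (use card_words_ge[OF R(1) R(3) R(4)] in auto)
    ultimately have cF: "(k + 1) ^ N \<le> card F" by simp
    have Ffin: "finite F" unfolding F_def using finite_words[OF R(1)] by (simp add: finite_PiE)
    have wr: "words (R i) k \<subseteq> rist (W i)" for i
    proof -
      have "sum_list ss \<in> rist (W i)" if "set ss \<subseteq> R i" for ss
        using that by (induction ss) (auto intro: rist_0 rist_add subsetD[OF R(2)])
      then show ?thesis unfolding words_def by auto
    qed
    have fw: "f i \<in> words (R i) k" if f: "f \<in> F" and i: "i < N" for f i
      by (rule PiE_mem[OF f[unfolded F_def]]) (use i in simp)
    have fr: "f i \<in> rist (W i)" if f: "f \<in> F" and i: "i < N" for f i
      using fw[OF f i] wr by blast
    have hw: "h f \<in> words S' (N * k)" if f: "f \<in> F" for f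
    proof -
      have "sum_list (map f [0..<n]) \<in> words S' (n * k)" if "n \<le> N" for n
        using that
      proof (induction n)
        case 0 then show ?case by (simp add: words_zero)
      next
        case (Suc n)
        then have "n < N" by simp
        then have "R n \<subseteq> S'" unfolding S'_def by blast
        then have "f n \<in> words S' k" using fw[OF f \<open>n < N\<close>] words_subset by blast
        moreover have "sum_list (map f [0..<n]) \<in> words S' (n * k)" using Suc by simp
        ultimately have "sum_list (map f [0..<n]) + f n \<in> words S' (n * k + k)" by (rule words_add[rotated])
        then show ?case by (simp add: add.commute)
      qed
      then show ?thesis unfolding h_def by blast
    qed
    have hr: "h f \<in> rist v" "\<Phi> (h f) z - z \<in> zbox A (N * k * c)" if f: "f \<in> F" for f
    proof -
      obtain ss where "set ss \<subseteq> S'" "length ss = N * k" "h f = sum_list ss"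
        using hw[OF f] unfolding words_def by blast
      then show "h f \<in> rist v" "\<Phi> (h f) z - z \<in> zbox A (N * k * c)" using word[of ss] by simp_all
    qed
    have "inj_on (\<lambda>f. \<Phi> (h f) z - z) F"
    proof (rule inj_onI)
      fix f f' assume ff: "f \<in> F" "f' \<in> F" "\<Phi> (h f) z - z = \<Phi> (h f') z - z"
      then have "h f = h f'" using rist_orbit_inj[OF hr(1)[OF ff(1)] hr(1)[OF ff(2)] z] by simp
      then have "\<forall>i<N. f i = f' i"
        unfolding h_def by (intro sum_rist_inj[where W = W] W(3) fr[OF ff(1)] fr[OF ff(2)])
      then show "f = f'" using ff(1,2) unfolding F_def by (intro PiE_ext) auto
    qed
    then have "card F \<le> card (zbox A (N * k * c))"
      by (rule card_inj_on_le[OF _ _ card_zbox(1)[OF finite_A]]) (use hr(2) in blast)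
    then show ?thesis using cF card_zbox(2)[OF finite_A, of "N * k * c"] by linarith
  qed
  \<comment> \<open>The bound is evaluated at \<open>k = K\<close>: since
    \<open>2 * (N * K * c) + 1\<close> is at most \<open>(2 * (N * c) + 1) * (K + 1)\<close>, its
    right side is at most \<open>K * (K + 1) ^ card A\<close>, which is less than its left
    side.\<close>
  define K where "K = (2 * (N * c) + 1) ^ card A"
  have "(K + 1) ^ N \<le> (2 * (N * K * c) + 1) ^ card A" by (rule bound)
  also have "\<dots> \<le> ((2 * (N * c) + 1) * (K + 1)) ^ card A"
    by (rule power_mono) (simp_all add: algebra_simps)
  also have "\<dots> = K * (K + 1) ^ card A" unfolding K_def power_mult_distrib ..
  finally have "(K + 1) * (K + 1) ^ card A \<le> K * (K + 1) ^ card A" unfolding N_def by simp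
  then show False by simp
qed

end

end

theorem (in iet_tree_group) iet_tree_group_False: False
proof -
  obtain I where I: "ideal I" "nul \<subseteq> I" "(X, []) \<notin> I" "\<And>J. ideal J \<Longrightarrow> I \<subseteq> J \<Longrightarrow> (X, []) \<notin> J \<Longrightarrow> J = I"
    using maximal_ideal_exists by blast
  interpret maximal_invariant_ideal T G \<tau> \<Phi> S D A I
    by unfold_locales (use I in auto)
  obtain v where "v \<in> T" "\<And>u. u \<in> T \<Longrightarrow> prefix v u \<Longrightarrow> res u = res v" using res_stabilizes by blast
  then show False using stable_contradiction by blast
qed

section \<open>Translation of the definitions\<close>

text \<open>Composition is written additively, so that the (non-commutative) class \<open>group_add\<close> applies.\<close>

typedef 'b bijn = "{f :: 'b \<Rightarrow> 'b. bij f}" morphisms app Bijn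
  by (rule exI[of _ id]) simp

setup_lifting type_definition_bijn

instantiation bijn :: (type) group_add
begin

lift_definition zero_bijn :: "'a bijn" is id by simp
lift_definition plus_bijn :: "'a bijn \<Rightarrow> 'a bijn \<Rightarrow> 'a bijn" is "(\<circ>)" by (rule bij_comp)
lift_definition uminus_bijn :: "'a bijn \<Rightarrow> 'a bijn" is inv by (rule bij_imp_bij_inv)
definition minus_bijn :: "'a bijn \<Rightarrow> 'a bijn \<Rightarrow> 'a bijn" where "minus_bijn a b = a + - b"

instance
proof
  fix a b c :: "'a bijn"
  show "a + b + c = a + (b + c)" by transfer (simp add: comp_assoc)
  show "0 + a = a" by transfer simp
  show "a + 0 = a" by transfer simp
  show "- a + a = 0" by transfer (simp add: bij_is_inj)
  show "a + - b = a - b" unfolding minus_bijn_def ..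
qed

end

text \<open>Conjugation by \<open>x \<mapsto> - x\<close> turns left-continuous exchanges into right-continuous ones.\<close>

definition flip :: "(real \<Rightarrow> real) \<Rightarrow> real \<Rightarrow> real" where
  "flip f x = frac (- f (- x))"

lemma frac_eq_iff_Ints: "frac x = frac y \<longleftrightarrow> x - y \<in> (\<int> :: real set)"
proof
  assume "frac x = frac y"
  then have "x - y = of_int (\<lfloor>x\<rfloor> - \<lfloor>y\<rfloor>)" unfolding frac_def by simp
  then show "x - y \<in> \<int>" by (metis Ints_of_int)
next
  assume "x - y \<in> \<int>"
  then obtain n where "x = y + of_int n" by (metis Ints_cases add.commute diff_add_cancel)
  then show "frac x = frac y" by (simp add: frac_def)
qed

lemma frac_diff_Ints: "x - frac x \<in> (\<int> :: real set)" "frac x - x \<in> (\<int> :: real set)"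
  by (simp_all add: frac_def)

lemma neg_frac_neg_Ints: "- frac (- x) - x \<in> (\<int> :: real set)"
  by (simp add: frac_def)

lemma frac_unit: "0 \<le> x \<Longrightarrow> x < 1 \<Longrightarrow> frac x = (x::real)"
  by (simp add: frac_eq)

lemma is_IET_periodic:
  assumes "is_IET f" "x - y \<in> \<int>" shows "f x = f y"
proof -
  have p: "f (z + 1) = f z" for z using assms(1) unfolding is_IET_def by blast
  have n: "f (z + real n) = f z" for z n
  proof (induction n)
    case (Suc n)
    then show ?case using p[of "z + real n"] by (simp add: algebra_simps)
  qed simp
  have z: "f (z + of_int k) = f z" for z k
  proof (cases "k \<ge> 0")
    case True then show ?thesis using n[of z "nat k"] by simp
  next
    case False then show ?thesis using n[of "z + of_int k" "nat (- k)"] by simp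
  qed
  obtain k where "x - y = of_int k" using assms(2) by (rule Ints_cases)
  then have "x = y + of_int k" by simp
  then show ?thesis using z by simp
qed

lemma is_IET_range: "is_IET f \<Longrightarrow> 0 \<le> f x \<and> f x < 1"
  unfolding is_IET_def by blast

lemma flip_comp:
  assumes "is_IET f" shows "flip (f \<circ> h) x = flip f (flip h x)"
proof -
  have "- frac (- h (- x)) - h (- x) \<in> \<int>" by (rule neg_frac_neg_Ints)
  then have "f (- frac (- h (- x))) = f (h (- x))" by (rule is_IET_periodic[OF assms])
  then show ?thesis unfolding flip_def by simp
qed

lemma bij_betw_neg_frac: "bij_betw (\<lambda>x::real. frac (- x)) {0..<1} {0..<1}"
proof (rule bij_betw_byWitness[where f' = "\<lambda>x. frac (- x)"])
  have "frac (- frac (- x)) = x" if "x \<in> {0..<1}" for x :: real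
  proof -
    have "frac (- frac (- x)) = frac x" unfolding frac_eq_iff_Ints by (rule neg_frac_neg_Ints)
    then show ?thesis using that frac_unit by simp
  qed
  then show "\<forall>a\<in>{0..<1::real}. frac (- frac (- a)) = a" "\<forall>a'\<in>{0..<1::real}. frac (- frac (- a')) = a'" by auto
qed (auto simp: frac_lt_1)

lemma flip_bij:
  assumes f: "is_IET f" shows "bij_betw (flip f) {0..<1} {0..<1}"
proof -
  have fb: "bij_betw f {0..<1} {0..<1}" using f unfolding is_IET_def by blast
  have "f (- x) = f (frac (- x))" for x
    by (rule is_IET_periodic[OF f]) (rule frac_diff_Ints)
  then have e: "flip f = (\<lambda>x. frac (- x)) \<circ> (f \<circ> (\<lambda>x. frac (- x)))" unfolding flip_def by auto
  show ?thesis unfolding e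
    by (rule bij_betw_trans[OF bij_betw_trans[OF bij_betw_neg_frac fb] bij_betw_neg_frac])
qed

text \<open>Between reflected discontinuities the displacement of the flipped map is locally
  constant modulo \<open>1\<close>. Zeros of the map are added as cut points because a translation
  of the circle jumps in \<open>[0, 1)\<close> where its value passes \<open>0\<close>.\<close>

lemma flip_ptrans:
  assumes f: "is_IET f" obtains C where "ptrans C (flip f)"
proof -
  obtain D where D: "finite D" and loc: "\<And>x. \<exists>e>0. \<exists>c. (\<forall>y. x - e < y \<and> y \<le> x \<longrightarrow> f y = frac (y + c)) \<and>
        (frac x \<notin> D \<longrightarrow> (\<forall>y. x < y \<and> y < x + e \<longrightarrow> f y = frac (y + c)))"
    using f unfolding is_IET_def by blast
  let ?F = "flip f"
  define C where "C = (\<lambda>d. frac (- d)) ` D \<union> {x \<in> {0..<1}. ?F x = 0}"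
  have bij: "bij_betw ?F {0..<1} {0..<1}" by (rule flip_bij[OF f])
  have "finite {x \<in> {0..<1}. ?F x \<in> {0}}"
    using finite_vimage_IntI[of "{0}" ?F "{0..<1}"] bij unfolding bij_betw_def
    by (simp add: vimage_def Int_def conj_commute)
  then have Cfin: "finite C" unfolding C_def using D by simp
  have "?F y - ?F x = y - x" if xy: "0 \<le> x" "x < y" "y < 1" "{x<..y} \<inter> C = {}" for x y
  proof -
    have shift: "frac (?F t - t) = frac (- c)" if "f (- t) = frac (- t + c)" for t c
    proof -
      have e: "(?F t - t) - (- c) = (?F t + f (- t)) - (f (- t) - (- t + c))" by simp
      have "?F t + f (- t) \<in> \<int>" unfolding flip_def using frac_diff_Ints(2)[of "- f (- t)"] by simp
      moreover have "f (- t) - (- t + c) \<in> \<int>" unfolding that by (rule frac_diff_Ints)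
      ultimately have "(?F t - t) - (- c) \<in> \<int>" unfolding e by (rule Ints_diff)
      then show ?thesis by (simp only: frac_eq_iff_Ints)
    qed
    \<comment> \<open>The principle \<open>Bolzano\<close> turns local constancy modulo
      \<open>1\<close> into constancy on the whole gap.\<close>
    have const: "frac (?F u - u) = frac (?F x - x)" if u: "x \<le> u" "u \<le> y" for u
    proof (rule Bolzano[where a = x and b = u
          and P = "\<lambda>a b. x \<le> a \<longrightarrow> b \<le> y \<longrightarrow> frac (?F b - b) = frac (?F a - a)", THEN mp, THEN mp])
      show "x \<le> u" "x \<le> x" "u \<le> y" using u by simp_all
      fix t0 assume t0': "x \<le> t0" "t0 \<le> u"
      then have t0: "x \<le> t0" "t0 \<le> y" using u by auto
      obtain e c where e: "e > 0" "\<And>z. - t0 - e < z \<Longrightarrow> z \<le> - t0 \<Longrightarrow> f z = frac (z + c)"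
        "\<And>z. frac (- t0) \<notin> D \<Longrightarrow> - t0 < z \<Longrightarrow> z < - t0 + e \<Longrightarrow> f z = frac (z + c)"
        using loc[of "- t0"] by blast
      \<comment> \<open>For \<open>t\<close> to the right of \<open>t0\<close> the point
        \<open>- t\<close> is to the left of \<open>- t0\<close>, where left-continuity applies even
        at a discontinuity. For \<open>t\<close> to the left, \<open>t0\<close> lies in the gap and
        is no reflected discontinuity.\<close>
      have one: "frac (?F t - t) = frac (- c)" if t: "x \<le> t" "t \<le> y" "\<bar>t - t0\<bar> < e" for t
      proof (cases "t0 \<le> t")
        case True
        have "f (- t) = frac (- t + c)" by (rule e(2)) (use True t in auto)
        then show ?thesis by (rule shift)
      next
        case False
        have "frac (- t0) \<notin> D"
        proof
          assume "frac (- t0) \<in> D"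
          then have "frac (- frac (- t0)) \<in> C" unfolding C_def by blast
          moreover have "frac (- frac (- t0)) = frac t0"
            unfolding frac_eq_iff_Ints by (rule neg_frac_neg_Ints)
          moreover have "frac t0 = t0" using t0 xy by (intro frac_unit) auto
          moreover have "t0 \<in> {x<..y}" using False t t0 by auto
          ultimately show False using xy(4) by auto
        qed
        then have "f (- t) = frac (- t + c)" by (rule e(3)) (use False t in auto)
        then show ?thesis by (rule shift)
      qed
      show "\<exists>d>0. \<forall>a b. a \<le> t0 \<and> t0 \<le> b \<and> b - a < d \<longrightarrow> x \<le> a \<longrightarrow> b \<le> y \<longrightarrow> frac (?F b - b) = frac (?F a - a)"
      proof (intro exI[of _ e] conjI allI impI)
        fix a b assume ab: "a \<le> t0 \<and> t0 \<le> b \<and> b - a < e" "x \<le> a" "b \<le> y"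
        then show "frac (?F b - b) = frac (?F a - a)" using one[of a] one[of b] by simp
      qed (rule e(1))
    next
      fix a b c' :: real
      assume "x \<le> a \<longrightarrow> b \<le> y \<longrightarrow> frac (?F b - b) = frac (?F a - a)"
        "x \<le> b \<longrightarrow> c' \<le> y \<longrightarrow> frac (?F c' - c') = frac (?F b - b)" "a \<le> b" "b \<le> c'"
      then show "x \<le> a \<longrightarrow> c' \<le> y \<longrightarrow> frac (?F c' - c') = frac (?F a - a)" by auto
    qed
    define k where "k = ?F x - x"
    have Ft: "?F t = frac (t + k)" if t: "x \<le> t" "t \<le> y" for t
    proof -
      have "(?F t - t) - k \<in> \<int>" using const[OF t] unfolding k_def frac_eq_iff_Ints .
      then have "frac (?F t) = frac (t + k)" unfolding frac_eq_iff_Ints by (simp add: algebra_simps)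
      moreover have "frac (?F t) = ?F t" unfolding flip_def by (simp add: frac_lt_1 frac_unit)
      ultimately show ?thesis by simp
    qed
    have nF: "?F t \<noteq> 0" if t: "x < t" "t \<le> y" for t
    proof
      assume "?F t = 0"
      then have "t \<in> C" unfolding C_def using t xy by auto
      then show False using xy(4) t by auto
    qed
    \<comment> \<open>If the integer part changed, the point \<open>t\<close> where
      \<open>t + k\<close> equals the last integer reached would be a zero of the flipped map inside
      the gap.\<close>
    have "\<lfloor>y + k\<rfloor> = \<lfloor>x + k\<rfloor>"
    proof (rule ccontr)
      assume ne: "\<lfloor>y + k\<rfloor> \<noteq> \<lfloor>x + k\<rfloor>"
      have "\<lfloor>x + k\<rfloor> \<le> \<lfloor>y + k\<rfloor>" using xy by (intro floor_mono) simp
      with ne have "\<lfloor>x + k\<rfloor> + 1 \<le> \<lfloor>y + k\<rfloor>" by simp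
      define t where "t = of_int \<lfloor>y + k\<rfloor> - k"
      have "x < t" "t \<le> y" unfolding t_def using \<open>\<lfloor>x + k\<rfloor> + 1 \<le> \<lfloor>y + k\<rfloor>\<close> by linarith+
      moreover from this have "?F t = 0" using Ft[of t] unfolding t_def by simp
      ultimately show False using nF by blast
    qed
    then show ?thesis using Ft[of x] Ft[of y] xy unfolding frac_def by simp
  qed
  then have "ptrans C ?F" unfolding ptrans_def using Cfin bij by blast
  then show ?thesis using that by blast
qed

section \<open>Tree automorphisms as maps on words\<close>

lemma tree_aut_bij: "tree_aut T g \<Longrightarrow> bij g"
proof -
  assume g: "tree_aut T g"
  have "bij_betw g T T" and o: "\<And>x. x \<notin> T \<Longrightarrow> g x = x" using g unfolding tree_aut_def by auto
  moreover have "bij_betw g (- T) (- T)" using bij_betw_cong[of "- T" g id "- T"] o by (simp add: bij_betw_id)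
  ultimately have "bij_betw g (T \<union> - T) (T \<union> - T)" by (intro bij_betw_combine) auto
  then show ?thesis by simp
qed

lemma rooted_prefix:
  assumes "rooted_tree T" "w \<in> T" "prefix v w" shows "v \<in> T"
proof -
  obtain z where "w = v @ z" using assms(3) by (auto simp: prefix_def)
  then have "v @ z \<in> T" using assms(2) by simp
  then show ?thesis
  proof (induction z rule: rev_induct)
    case (snoc a z)
    then have "(v @ z) @ [a] \<in> T" by simp
    then have "v @ z \<in> T" using assms(1) unfolding rooted_tree_def by blast
    then show ?case using snoc by blast
  qed simp
qed

lemma tree_aut_snoc:
  assumes "tree_aut T g" "v \<in> T" "v @ [a] \<in> T" obtains b where "g (v @ [a]) = g v @ [b]"
  using assms unfolding tree_aut_def by blast

lemma tree_aut_T: "tree_aut T g \<Longrightarrow> v \<in> T \<Longrightarrow> g v \<in> T"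
  unfolding tree_aut_def by (auto intro: bij_betw_apply)

lemma tree_aut_prefix:
  assumes T: "rooted_tree T" and g: "tree_aut T g" and w: "w \<in> T" "prefix v w"
  shows "prefix (g v) (g w)"
proof -
  obtain z where "w = v @ z" using w(2) by (auto simp: prefix_def)
  then have "v @ z \<in> T" using w by simp
  then have "prefix (g v) (g (v @ z))"
  proof (induction z rule: rev_induct)
    case (snoc a z)
    then have 1: "(v @ z) @ [a] \<in> T" by simp
    then have 2: "v @ z \<in> T" using rooted_prefix[OF T] by (metis prefixI)
    obtain b where "g ((v @ z) @ [a]) = g (v @ z) @ [b]" using tree_aut_snoc[OF g 2 1] .
    then show ?case using snoc.IH[OF 2] by simp
  qed simp
  then show ?thesis using \<open>w = v @ z\<close> by simp
qed

lemma tree_aut_length: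
  assumes T: "rooted_tree T" and g: "tree_aut T g" and "v \<in> T"
  shows "length (g v) = length v"
  using assms(3)
proof (induction v rule: rev_induct)
  case Nil then show ?case using g unfolding tree_aut_def by simp
next
  case (snoc a v)
  then have v: "v \<in> T" using rooted_prefix[OF T] by (metis prefixI)
  obtain b where "g (v @ [a]) = g v @ [b]" using tree_aut_snoc[OF g v snoc.prems] .
  then show ?case using snoc.IH[OF v] by simp
qed

lemma locally_finite_level:
  assumes "locally_finite_tree T" shows "finite {v \<in> T. length v = n}"
proof (induction n)
  case 0
  have "{v \<in> T. length v = 0} \<subseteq> {[]}" by auto
  then show ?case using finite_subset by blast
next
  case (Suc n)
  have "{v \<in> T. length v = Suc n} \<subseteq> (\<Union>v\<in>{v \<in> T. length v = n}. children T v)"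
  proof
    fix w assume w: "w \<in> {v \<in> T. length v = Suc n}"
    then obtain v a where va: "w = v @ [a]" by (metis (mono_tags) length_0_conv mem_Collect_eq nat.distinct(1) rev_exhaust)
    then have "v \<in> T" using w assms unfolding locally_finite_tree_def rooted_tree_def by blast
    then show "w \<in> (\<Union>v\<in>{v \<in> T. length v = n}. children T v)" using w va unfolding children_def by auto
  qed
  moreover have "finite (\<Union>v\<in>{v \<in> T. length v = n}. children T v)"
    using Suc assms unfolding locally_finite_tree_def by blast
  ultimately show ?case by (rule finite_subset)
qed

lemma neg_sum_list: "- sum_list ss = sum_list (rev (map uminus ss))" for ss :: "'g::group_add list"
  by (induction ss) (simp_all add: minus_add)

theorem theorem6p10:
  fixes T :: "'a list set" and G :: "('a list \<Rightarrow> 'a list) set"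
  assumes "locally_finite_tree T"
    and "is_subgroup_aut T G"
    and "finitely_generated G"
    and "weakly_branch T G"
  shows "\<not> embeds_in_IET G"
proof
  assume "embeds_in_IET G"
  then obtain \<phi> :: "('a list \<Rightarrow> 'a list) \<Rightarrow> (real \<Rightarrow> real)"
    where inj: "inj_on \<phi> G" and iet: "\<And>g. g \<in> G \<Longrightarrow> is_IET (\<phi> g)"
      and hom: "\<And>g h. g \<in> G \<Longrightarrow> h \<in> G \<Longrightarrow> \<phi> (g \<circ> h) = \<phi> g \<circ> \<phi> h"
    unfolding embeds_in_IET_def by blast
  have T: "rooted_tree T" using assms(1) unfolding locally_finite_tree_def by blast
  have aut: "tree_aut T g" if "g \<in> G" for g using assms(2) that unfolding is_subgroup_aut_def by blast
  have Gid: "id \<in> G" and Gcomp: "\<And>g h. g \<in> G \<Longrightarrow> h \<in> G \<Longrightarrow> g \<circ> h \<in> G" and Ginv: "\<And>g. g \<in> G \<Longrightarrow> inv g \<in> G"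
    using assms(2) unfolding is_subgroup_aut_def by blast+
  define G' where "G' = {g :: 'a list bijn. app g \<in> G}"
  define \<Phi> where "\<Phi> g = flip (\<phi> (app g))" for g :: "'a list bijn"
  have ap: "app (g + h) = app g \<circ> app h" "app 0 = id" "app (- g) = inv (app g)" for g h :: "'a list bijn"
    by (transfer, simp)+
  have lift: "\<exists>g'\<in>G'. app g' = g" if "g \<in> G" for g
    unfolding G'_def using Bijn_inverse[of g] tree_aut_bij[OF aut[OF that]] that by (intro bexI[of _ "Bijn g"]) auto
  have appG: "app g \<in> G" if "g \<in> G'" for g using that unfolding G'_def by simp
  \<comment> \<open>The value of \<open>\<phi>\<close> at \<open>id\<close> is not prescribed, but
    it is idempotent and a bijection of \<open>[0, 1)\<close>, hence the identity there.\<close>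
  have phi_id: "\<phi> id y = frac y" for y
  proof -
    have i: "is_IET (\<phi> id)" using iet Gid by blast
    have b: "bij_betw (\<phi> id) {0..<1} {0..<1}" using i unfolding is_IET_def by blast
    have fy: "frac y \<in> {0..<1}" by (simp add: frac_lt_1)
    have "\<phi> id (\<phi> id (frac y)) = \<phi> id (frac y)" using hom[OF Gid Gid] by (metis comp_apply comp_id)
    then have "\<phi> id (frac y) = frac y"
      using b fy is_IET_range[OF i] unfolding bij_betw_def by (meson atLeastLessThan_iff inj_onD)
    moreover have "\<phi> id y = \<phi> id (frac y)" by (rule is_IET_periodic[OF i frac_diff_Ints(1)])
    ultimately show ?thesis by simp
  qed
  have Phi_add: "\<Phi> (g + h) x = \<Phi> g (\<Phi> h x)" if "g \<in> G'" "h \<in> G'" for g h x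
    unfolding \<Phi>_def ap hom[OF appG[OF that(1)] appG[OF that(2)]] by (rule flip_comp[OF iet[OF appG[OF that(1)]]])
  have neg_neg_frac: "frac (- frac (- x)) = frac x" for x :: real
    unfolding frac_eq_iff_Ints by (rule neg_frac_neg_Ints)
  have Phi_0: "\<Phi> 0 x = x" if "x \<in> {0..<1}" for x
    unfolding \<Phi>_def flip_def ap phi_id neg_neg_frac using that frac_unit by simp
  \<comment> \<open>If the flipped action is trivial, \<open>\<phi> (app g)\<close> is the map
    \<open>frac\<close>, which is also \<open>\<phi> id\<close>; injectivity of
    \<open>\<phi>\<close> applies.\<close>
  have Phi_faithful: "g = 0" if g: "g \<in> G'" and fixed: "\<And>x. x \<in> {0..<1} \<Longrightarrow> \<Phi> g x = x" for g
  proof -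
    have i: "is_IET (\<phi> (app g))" using iet appG[OF g] by blast
    have "\<phi> (app g) y = frac y" for y
    proof -
      define x where "x = frac (- y)"
      have "- x - y \<in> \<int>" unfolding x_def by (rule neg_frac_neg_Ints)
      then have "\<phi> (app g) (- x) = \<phi> (app g) y" by (rule is_IET_periodic[OF i])
      moreover have "\<Phi> g x = x" by (rule fixed) (simp add: x_def frac_lt_1)
      ultimately have "frac (- \<phi> (app g) y) = frac (- y)" unfolding \<Phi>_def flip_def x_def by simp
      then have "- (- \<phi> (app g) y - - y) \<in> \<int>" unfolding frac_eq_iff_Ints by (rule Ints_minus)
      then have "frac (\<phi> (app g) y) = frac y" unfolding frac_eq_iff_Ints by simp
      then show ?thesis using is_IET_range[OF i, of y] frac_unit by simp
    qed
    then have "\<phi> (app g) = \<phi> id" using phi_id by auto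
    then have "app g = id" using inj appG[OF g] Gid by (meson inj_onD)
    then show "g = 0" using ap(2) app_inject by metis
  qed
  obtain S0 where S0: "finite S0" "S0 \<subseteq> G" "gen_group S0 = G" using assms(3) unfolding finitely_generated_def by blast
  \<comment> \<open>Inverses are adjoined because group elements are to be sums of generators
    without signs.\<close>
  define S where "S = Bijn ` S0 \<union> uminus ` Bijn ` S0"
  have appS0: "app (Bijn s) = s" if "s \<in> S0" for s
    using Bijn_inverse[of s] tree_aut_bij[OF aut] S0(2) that by auto
  have SG: "S \<subseteq> G'" unfolding S_def G'_def using appS0 S0(2) Ginv by (auto simp: ap)
  have Sneg: "- s \<in> S" if "s \<in> S" for s using that unfolding S_def by auto
  have Sfin: "finite S" unfolding S_def using S0(1) by simp
  have gen: "\<exists>ss. set ss \<subseteq> S \<and> app (sum_list ss) = g" if "g \<in> gen_group S0" for g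
    using that
  proof (induction rule: gen_group.induct)
    case gen_id show ?case by (rule exI[of _ "[]"]) (simp only: sum_list.Nil ap(2) list.set empty_subsetI)
  next
    case (gen_base s)
    then show ?case using appS0 unfolding S_def by (intro exI[of _ "[Bijn s]"]) simp
  next
    case (gen_comp g h)
    then obtain ss tt where "set ss \<subseteq> S" "app (sum_list ss) = g" "set tt \<subseteq> S" "app (sum_list tt) = h" by blast
    then show ?case using ap(1) by (intro exI[of _ "ss @ tt"]) simp
  next
    case (gen_inv g)
    then obtain ss where "set ss \<subseteq> S" "app (sum_list ss) = g" by blast
    then show ?case using ap(3)[of "sum_list ss"] Sneg
      by (intro exI[of _ "rev (map uminus ss)"]) (auto simp: neg_sum_list)
  qed
  have "\<forall>s\<in>S. \<exists>C. ptrans C (\<Phi> s)"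
  proof
    fix s assume "s \<in> S"
    then have "is_IET (\<phi> (app s))" using iet appG SG by blast
    then show "\<exists>C. ptrans C (\<Phi> s)" unfolding \<Phi>_def using flip_ptrans by blast
  qed
  from bchoice[OF this] obtain C where C: "\<forall>s\<in>S. ptrans (C s) (\<Phi> s)" ..
  define D where "D = (\<Union>s\<in>S. C s)"
  have Dfin: "finite D" unfolding D_def using Sfin C unfolding ptrans_def by blast
  have pS: "ptrans D (\<Phi> s)" if "s \<in> S" for s
    using ptrans_mono[of "C s" "\<Phi> s" D] C that Dfin unfolding D_def by blast
  \<comment> \<open>Besides \<open>1\<close> and the cut points, the displacements at
    \<open>0\<close> and at the cut points; by \<open>ptrans_cell\<close> the generators have no
    others.\<close>
  define A where "A = insert 1 D \<union> (\<lambda>(s, c). \<Phi> s c - c) ` (S \<times> insert 0 D)"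
  have Afin: "finite A" unfolding A_def using Dfin Sfin by simp
  have Asub: "A \<subseteq> zspan A" by (rule zspan_superset[OF Afin])
  interpret iet_tree_group T G' app \<Phi> S D A
  proof unfold_locales
    show "0 \<in> G'" unfolding G'_def mem_Collect_eq ap(2) by (rule Gid)
    show "g + h \<in> G'" if "g \<in> G'" "h \<in> G'" for g h using that Gcomp unfolding G'_def by (simp add: ap)
    show "- g \<in> G'" if "g \<in> G'" for g using that Ginv unfolding G'_def by (simp add: ap)
    show "app (g + h) v = app g (app h v)" for g h :: "'a list bijn" and v by (simp add: ap)
    show "app 0 v = v" for v :: "'a list" unfolding ap(2) by simp
    show "app g v \<in> T" if "g \<in> G'" "v \<in> T" for g v using tree_aut_T[OF aut[OF appG]] that by blast
    show "length (app g v) = length v" if "g \<in> G'" "v \<in> T" for g v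
      using tree_aut_length[OF T aut[OF appG]] that by blast
    show "prefix (app g v) (app g w)" if "g \<in> G'" "v \<in> T" "w \<in> T" "prefix v w" for g v w
      using tree_aut_prefix[OF T aut[OF appG]] that by blast
    show "g = 0" if g: "g \<in> G'" and fixed: "\<And>v. v \<in> T \<Longrightarrow> app g v = v" for g
    proof -
      have "app g v = v" for v using fixed[of v] aut[OF appG[OF g]] unfolding tree_aut_def by blast
      then have "app g = id" by auto
      then show ?thesis using ap(2) app_inject by metis
    qed
    show "[] \<in> T" using T unfolding rooted_tree_def by blast
    show "v \<in> T" if "w \<in> T" "prefix v w" for v w using rooted_prefix[OF T that] .
    show "finite {v \<in> T. length v = n}" for n by (rule locally_finite_level[OF assms(1)])
    show "\<exists>g\<in>G'. app g v = w" if vw: "v \<in> T" "w \<in> T" "length v = length w" for v w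
    proof -
      obtain g where g: "g \<in> G" "g v = w" using assms(4) vw unfolding weakly_branch_def by blast
      then show ?thesis using lift by blast
    qed
    show "\<exists>g\<in>G'. g \<noteq> 0 \<and> (\<forall>w\<in>T. \<not> prefix v w \<longrightarrow> app g w = w)" if v: "v \<in> T" for v
    proof -
      obtain g where g: "g \<in> G" "g \<noteq> id" "\<forall>w\<in>T. \<not> (\<exists>u. w = v @ u) \<longrightarrow> g w = w"
        using assms(4) v unfolding weakly_branch_def by blast
      obtain g' where g': "g' \<in> G'" "app g' = g" using lift[OF g(1)] by blast
      moreover have "g' \<noteq> 0" using g(2) g'(2) ap(2) by auto
      ultimately show ?thesis using g(3) unfolding prefix_def by blast
    qed
    show "S \<subseteq> G'" by (rule SG)
    show "\<exists>ss. set ss \<subseteq> S \<and> g = sum_list ss" if g: "g \<in> G'" for g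
    proof -
      have "app g \<in> gen_group S0" using appG[OF g] S0(3) by simp
      from gen[OF this] obtain ss where "set ss \<subseteq> S" "app (sum_list ss) = app g" by blast
      then show ?thesis unfolding app_inject by blast
    qed
    show "finite A" by (rule Afin)
    show "1 \<in> zspan A" "D \<subseteq> zspan A" using Asub unfolding A_def by auto
    show "finite D" by (rule Dfin)
    show "ptrans D (\<Phi> s)" if "s \<in> S" for s by (rule pS[OF that])
    show "\<Phi> s x - x \<in> zspan A" if s: "s \<in> S" and x: "x \<in> {0..<1}" for s x
    proof -
      obtain c where c: "c \<in> insert 0 D" "\<Phi> s x = \<Phi> s c + (x - c)"
        using ptrans_cell[OF pS[OF s], of x] x by auto
      have "\<Phi> s c - c \<in> A" unfolding A_def using s c(1) by force
      moreover have "\<Phi> s x - x = \<Phi> s c - c" using c(2) by simp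
      ultimately show ?thesis using Asub by auto
    qed
  qed (use Phi_add Phi_0 Phi_faithful in auto)
  show False by (rule iet_tree_group_False)
qed

end
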